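(* Let $T\in\mathcal{O}_C'(\mathbb{R})$, and let $C_T$, $C_Tf=T\star f$, denote the convolution operator acting either on $E=\mathcal{S}(\mathbb{R})$ or on $E=\mathcal{O}_C(\mathbb{R})$. In both cases the spectra of $C_T\in\mathcal{L}(E)$ satisfy \[ (\overline{\mathrm{Im}\,\mathcal{F}(T)})^c\subseteq\rho(C_T)\subseteq(\mathrm{Im}\,\mathcal{F}(T))^c,\qquad \rho^*(C_T)=(\overline{\mathrm{Im}\,\mathcal{F}(T)})^c, \] \[ \mathrm{Im}\,\mathcal{F}(T)\subseteq\sigma(C_T)\subseteq\overline{\mathrm{Im}\,\mathcal{F}(T)},\qquad \sigma^*(C_T)=\overline{\mathrm{Im}\,\mathcal{F}(T)}. \] Moreover, the point spectrum of $C_T$ acting on $\mathcal{S}(\mathbb{R})$ is \[ \sigma_p(C_T)=\{\lambda\in\mathbb{C}\colon(\mathcal{F}(T))^{-1}(\lambda)\text{ has non-empty interior}\}\subseteq\mathrm{Im}\,\mathcal{F}(T). \] Here $\mathrm{Im}\,\mathcal{F}(T)\subseteq\mathbb{C}$ is the range of the function $\mathcal{F}(T)\in\mathcal{O}_M(\mathbb{R})$, $A^c=\mathbb{C}\setminus A$, and $(\mathcal{F}(T))^{-1}(\lambda)=\{\xi\in\mathbb{R}\colon\mathcal{F}(T)(\xi)=\lambda\}$.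
   Context: All functions are complex-valued. $\mathcal{S}(\mathbb{R})$ is the Schwartz space of $f\in C^\infty(\mathbb{R})$ with $\|f\|_n:=\sup_{x\in\mathbb{R}}\sup_{0\le i\le n}(1+x^2)^n|f^{(i)}(x)|<\infty$ for all $n\in\mathbb{N}_0$, a Fréchet space with these norms; $\mathcal{S}'(\mathbb{R})$ is its strong dual. For $m,n\in\mathbb{N}$ and $f\in C^\infty(\mathbb{R})$ let $|f|_{m,n}:=\sup_{x\in\mathbb{R}}\sup_{0\le i\le m}(1+x^2)^{-n}|f^{(i)}(x)|$. $\mathcal{O}_M(\mathbb{R})$ is the space of $f\in C^\infty(\mathbb{R})$ such that for every $m$ there is $n$ with $|f|_{m,n}<\infty$. $\mathcal{O}_C(\mathbb{R})$ is the space of $f\in C^\infty(\mathbb{R})$ such that there is $n$ with $|f|_{m,n}<\infty$ for all $m$, with the locally convex inductive limit topology (over $n$) of the Fréchet spaces $\{f\in C^\infty(\mathbb{R})\colon|f|_{m,n}<\infty\ \forall m\}$ normed by $|\cdot|_{m,n}$, $m\in\mathbb{N}$. $\mathcal{O}_C'(\mathbb{R})$ is the strong dual of $\mathcal{O}_C(\mathbb{R})$; it is regarded as a subspace of $\mathcal{S}'(\mathbb{R})$ and is the space of convolutors of $\mathcal{S}(\mathbb{R})$. For $T\in\mathcal{O}_C'(\mathbb{R})$ and $f\in\mathcal{S}(\mathbb{R})$ or $f\in\mathcal{O}_C(\mathbb{R})$, $(T\star f)(x)=\langle T_y,f(x-y)\rangle$, $x\in\mathbb{R}$; the map $C_T\colon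 f\mapsto T\star f$ is continuous from $\mathcal{S}(\mathbb{R})$ into itself and from $\mathcal{O}_C(\mathbb{R})$ into itself. The Fourier transform is $\mathcal{F}(f)(\xi)=\hat f(\xi)=\int_{\mathbb{R}}e^{-ix\xi}f(x)\,dx$, extended to $\mathcal{S}'(\mathbb{R})$ by $\mathcal{F}(T)(f)=\langle T,\hat f\rangle$; it is a topological isomorphism from $\mathcal{O}_C'(\mathbb{R})$ onto $\mathcal{O}_M(\mathbb{R})$, so $\mathcal{F}(T)$ is a function in $\mathcal{O}_M(\mathbb{R})$ for $T\in\mathcal{O}_C'(\mathbb{R})$. For a locally convex Hausdorff space $E$, $\mathcal{L}(E)$ is the space of continuous linear operators on $E$. For $A\in\mathcal{L}(E)$: $\rho(A)$ is the set of $\lambda\in\mathbb{C}$ such that $\lambda I-A$ is bijective with $R(\lambda,A):=(\lambda I-A)^{-1}\in\mathcal{L}(E)$; $\sigma(A)=\mathbb{C}\setminus\rho(A)$; $\sigma_p(A)=\{\lambda\in\mathbb{C}\colon\lambda I-A\text{ is not injective}\}$; $\rho^*(A)$ is the set of $\lambda\in\mathbb{C}$ for which there is $\delta>0$ such that $B(\lambda,\delta)=\{\mu\in\mathbb{C}\colon|\mu-\lambda|<\delta\}\subseteq\rho(A)$ and $\{R(\mu,A)\colon\mu\in B(\lambda,\delta)\}$ is equicontinuous in $\mathcal{L}(E)$; $\sigma^*(A)=\mathbb{C}\setminus\rho^*(A)$. *)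

theory Defs
  imports "HOL-Analysis.Analysis"
begin

section \<open>Locally convex spaces of complex-valued functions\<close>

text \<open>
  A locally convex space of complex-valued functions, with the pointwise vector space operations,
  is represented by its topology \<open>E\<close>; the underlying vector space is \<open>topspace E\<close>.
  Functionals and operators are total HOL functions, of which only the values on
  \<open>topspace E\<close> matter.
\<close>

definition seminorm_on :: "('a \<Rightarrow> complex) set \<Rightarrow> (('a \<Rightarrow> complex) \<Rightarrow> real) \<Rightarrow> bool" where
  "seminorm_on V p \<longleftrightarrow>
     (\<forall>f\<in>V. 0 \<le> p f) \<and>
     (\<forall>f\<in>V. \<forall>c. p (\<lambda>x. c * f x) = cmod c * p f) \<and>
     (\<forall>f\<in>V. \<forall>g\<in>V. p (\<lambda>x. f x + g x) \<le> p f + p g)"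

definition seminorm_topology ::
  "('a \<Rightarrow> complex) set \<Rightarrow> (('a \<Rightarrow> complex) \<Rightarrow> real) set \<Rightarrow> ('a \<Rightarrow> complex) topology" where
  "seminorm_topology V P = topology (\<lambda>U. U \<subseteq> V \<and>
     (\<forall>f\<in>U. \<exists>F e. finite F \<and> F \<subseteq> P \<and> 0 < e \<and> {g\<in>V. \<forall>p\<in>F. p (\<lambda>x. g x - f x) < e} \<subseteq> U))"

lemma openin_seminorm_topology:
  "openin (seminorm_topology V P) U \<longleftrightarrow> U \<subseteq> V \<and>
     (\<forall>f\<in>U. \<exists>F e. finite F \<and> F \<subseteq> P \<and> 0 < e \<and> {g\<in>V. \<forall>p\<in>F. p (\<lambda>x. g x - f x) < e} \<subseteq> U)"
proof -
  let ?O = "\<lambda>U. U \<subseteq> V \<and>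
     (\<forall>f\<in>U. \<exists>F e. finite F \<and> F \<subseteq> P \<and> 0 < e \<and> {g\<in>V. \<forall>p\<in>F. p (\<lambda>x. g x - f x) < e} \<subseteq> U)"
  have "istopology ?O"
    unfolding istopology_def
  proof (intro conjI allI impI ballI)
    fix S T f assume S: "?O S" and T: "?O T" and f: "f \<in> S \<inter> T"
    obtain F e where F: "finite F" "F \<subseteq> P" "0 < e" "{g\<in>V. \<forall>p\<in>F. p (\<lambda>x. g x - f x) < e} \<subseteq> S"
      using S f by blast
    obtain G d where G: "finite G" "G \<subseteq> P" "0 < d" "{g\<in>V. \<forall>p\<in>G. p (\<lambda>x. g x - f x) < d} \<subseteq> T"
      using T f by blast
    have "{g\<in>V. \<forall>p\<in>F \<union> G. p (\<lambda>x. g x - f x) < min e d} \<subseteq> S \<inter> T"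
    proof
      fix g assume "g \<in> {g\<in>V. \<forall>p\<in>F \<union> G. p (\<lambda>x. g x - f x) < min e d}"
      then have g: "g \<in> V" "\<forall>p\<in>F \<union> G. p (\<lambda>x. g x - f x) < min e d"
        by blast+
      have "\<forall>p\<in>F. p (\<lambda>x. g x - f x) < e" "\<forall>p\<in>G. p (\<lambda>x. g x - f x) < d"
        by (rule ballI, rule less_le_trans[OF bspec[OF g(2)] min.cobounded1], erule UnI1)
          (rule ballI, rule less_le_trans[OF bspec[OF g(2)] min.cobounded2], erule UnI2)
      then show "g \<in> S \<inter> T"
        using F(4) G(4) g(1) by blast
    qed
    moreover have "finite (F \<union> G)" "F \<union> G \<subseteq> P" "0 < min e d"
      using F(1-3) G(1-3) by simp_all
    ultimately show "\<exists>F e. finite F \<and> F \<subseteq> P \<and> 0 < e \<and>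
        {g\<in>V. \<forall>p\<in>F. p (\<lambda>x. g x - f x) < e} \<subseteq> S \<inter> T"
      by iprover
  next
    fix S T assume "?O S" "?O T" then show "S \<inter> T \<subseteq> V" by blast
  next
    fix K assume "\<forall>S\<in>K. ?O S" then show "\<Union>K \<subseteq> V" by blast
  next
    fix K f assume K: "\<forall>S\<in>K. ?O S" and f: "f \<in> \<Union>K"
    obtain S where S: "S \<in> K" "f \<in> S" using f by (rule UnionE)
    have "?O S" using K S(1) by (rule bspec)
    then have "\<exists>F e. finite F \<and> F \<subseteq> P \<and> 0 < e \<and> {g\<in>V. \<forall>p\<in>F. p (\<lambda>x. g x - f x) < e} \<subseteq> S"
      by (rule bspec[OF conjunct2, OF _ S(2)])
    moreover have "S \<subseteq> \<Union>K" using S(1) by (rule Union_upper)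
    ultimately show "\<exists>F e. finite F \<and> F \<subseteq> P \<and> 0 < e \<and>
        {g\<in>V. \<forall>p\<in>F. p (\<lambda>x. g x - f x) < e} \<subseteq> \<Union>K"
      by (meson subset_trans)
  qed
  then show ?thesis
    by (simp add: seminorm_topology_def topology_inverse')
qed

lemma topspace_seminorm_topology [simp]: "topspace (seminorm_topology V P) = V"
proof
  show "topspace (seminorm_topology V P) \<subseteq> V"
    by (metis openin_seminorm_topology openin_topspace)
  have "openin (seminorm_topology V P) V"
    unfolding openin_seminorm_topology
    by (auto intro!: exI[of _ "{}"] exI[of _ "1::real"])
  then show "V \<subseteq> topspace (seminorm_topology V P)"
    by (rule openin_subset)
qed

definition continuous_dual :: "('a \<Rightarrow> complex) topology \<Rightarrow> (('a \<Rightarrow> complex) \<Rightarrow> complex) set" where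
  "continuous_dual E = {T.
     (\<forall>f\<in>topspace E. \<forall>g\<in>topspace E. T (\<lambda>x. f x + g x) = T f + T g) \<and>
     (\<forall>c. \<forall>f\<in>topspace E. T (\<lambda>x. c * f x) = c * T f) \<and>
     continuous_map E euclidean T}"

definition continuous_operators ::
  "('a \<Rightarrow> complex) topology \<Rightarrow> (('a \<Rightarrow> complex) \<Rightarrow> ('a \<Rightarrow> complex)) set" where
  "continuous_operators E = {A.
     (\<forall>f\<in>topspace E. \<forall>g\<in>topspace E. A (\<lambda>x. f x + g x) = (\<lambda>x. A f x + A g x)) \<and>
     (\<forall>c. \<forall>f\<in>topspace E. A (\<lambda>x. c * f x) = (\<lambda>x. c * A f x)) \<and>
     continuous_map E E A}"

text \<open>Equicontinuity at \<open>0\<close>, which for linear operators is equicontinuity.\<close>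

definition equicontinuous_operators ::
  "('a \<Rightarrow> complex) topology \<Rightarrow> (('a \<Rightarrow> complex) \<Rightarrow> ('a \<Rightarrow> complex)) set \<Rightarrow> bool" where
  "equicontinuous_operators E H \<longleftrightarrow> H \<subseteq> continuous_operators E \<and>
     (\<forall>U. openin E U \<and> (\<lambda>x. 0) \<in> U \<longrightarrow>
        (\<exists>W. openin E W \<and> (\<lambda>x. 0) \<in> W \<and> (\<forall>A\<in>H. A ` W \<subseteq> U)))"


section \<open>Spectra\<close>

definition spectral_shift ::
  "complex \<Rightarrow> (('a \<Rightarrow> complex) \<Rightarrow> ('a \<Rightarrow> complex)) \<Rightarrow> ('a \<Rightarrow> complex) \<Rightarrow> ('a \<Rightarrow> complex)" where
  "spectral_shift l A f = (\<lambda>x. l * f x - A f x)"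

definition resolvent ::
  "('a \<Rightarrow> complex) topology \<Rightarrow> complex \<Rightarrow> (('a \<Rightarrow> complex) \<Rightarrow> ('a \<Rightarrow> complex)) \<Rightarrow>
     ('a \<Rightarrow> complex) \<Rightarrow> ('a \<Rightarrow> complex)" where
  "resolvent E l A = inv_into (topspace E) (spectral_shift l A)"

definition resolvent_set ::
  "('a \<Rightarrow> complex) topology \<Rightarrow> (('a \<Rightarrow> complex) \<Rightarrow> ('a \<Rightarrow> complex)) \<Rightarrow> complex set" where
  "resolvent_set E A = {l. bij_betw (spectral_shift l A) (topspace E) (topspace E) \<and>
     resolvent E l A \<in> continuous_operators E}"

definition spectrum ::
  "('a \<Rightarrow> complex) topology \<Rightarrow> (('a \<Rightarrow> complex) \<Rightarrow> ('a \<Rightarrow> complex)) \<Rightarrow> complex set" where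
  "spectrum E A = - resolvent_set E A"

definition point_spectrum ::
  "('a \<Rightarrow> complex) topology \<Rightarrow> (('a \<Rightarrow> complex) \<Rightarrow> ('a \<Rightarrow> complex)) \<Rightarrow> complex set" where
  "point_spectrum E A = {l. \<not> inj_on (spectral_shift l A) (topspace E)}"

definition star_resolvent_set ::
  "('a \<Rightarrow> complex) topology \<Rightarrow> (('a \<Rightarrow> complex) \<Rightarrow> ('a \<Rightarrow> complex)) \<Rightarrow> complex set" where
  "star_resolvent_set E A = {l. \<exists>\<delta>>0. ball l \<delta> \<subseteq> resolvent_set E A \<and>
     equicontinuous_operators E ((\<lambda>m. resolvent E m A) ` ball l \<delta>)}"

definition star_spectrum ::
  "('a \<Rightarrow> complex) topology \<Rightarrow> (('a \<Rightarrow> complex) \<Rightarrow> ('a \<Rightarrow> complex)) \<Rightarrow> complex set" where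
  "star_spectrum E A = - star_resolvent_set E A"


section \<open>The function spaces\<close>

definition nth_deriv :: "nat \<Rightarrow> (real \<Rightarrow> complex) \<Rightarrow> (real \<Rightarrow> complex)" where
  "nth_deriv i = ((\<lambda>g x. vector_derivative g (at x)) ^^ i)"

definition C_infinity :: "(real \<Rightarrow> complex) set" where
  "C_infinity = {f. \<forall>i x. nth_deriv i f differentiable (at x)}"

text \<open>
  The values whose supremum is a weighted norm. As \<open>Sup\<close> on the reals is unspecified for unbounded
  sets, finiteness of the supremum is stated separately by \<open>bdd_above\<close>.
\<close>

definition weighted_values :: "(real \<Rightarrow> real) \<Rightarrow> nat \<Rightarrow> (real \<Rightarrow> complex) \<Rightarrow> real set" where
  "weighted_values w m f = {w x * cmod (nth_deriv i f x) | x i. i \<le> m}"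

abbreviation schwartz_values :: "nat \<Rightarrow> (real \<Rightarrow> complex) \<Rightarrow> real set" where
  "schwartz_values n \<equiv> weighted_values (\<lambda>x. (1 + x\<^sup>2) ^ n) n"

definition schwartz_norm :: "nat \<Rightarrow> (real \<Rightarrow> complex) \<Rightarrow> real" where
  "schwartz_norm n f = Sup (schwartz_values n f)"

definition schwartz :: "(real \<Rightarrow> complex) set" where
  "schwartz = {f \<in> C_infinity. \<forall>n. bdd_above (schwartz_values n f)}"

definition schwartz_space :: "(real \<Rightarrow> complex) topology" where
  "schwartz_space = seminorm_topology schwartz (range schwartz_norm)"

abbreviation growth_values :: "nat \<Rightarrow> nat \<Rightarrow> (real \<Rightarrow> complex) \<Rightarrow> real set" where
  "growth_values m n \<equiv> weighted_values (\<lambda>x. inverse ((1 + x\<^sup>2) ^ n)) m"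

definition growth_norm :: "nat \<Rightarrow> nat \<Rightarrow> (real \<Rightarrow> complex) \<Rightarrow> real" where
  "growth_norm m n f = Sup (growth_values m n f)"

definition OM :: "(real \<Rightarrow> complex) set" where
  "OM = {f \<in> C_infinity. \<forall>m\<ge>1. \<exists>n\<ge>1. bdd_above (growth_values m n f)}"

definition OC_step :: "nat \<Rightarrow> (real \<Rightarrow> complex) set" where
  "OC_step n = {f \<in> C_infinity. \<forall>m\<ge>1. bdd_above (growth_values m n f)}"

definition OC_step_space :: "nat \<Rightarrow> (real \<Rightarrow> complex) topology" where
  "OC_step_space n = seminorm_topology (OC_step n) {growth_norm m n | m. m \<ge> 1}"

definition OC :: "(real \<Rightarrow> complex) set" where
  "OC = (\<Union>n\<in>{1..}. OC_step n)"

text \<open>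
  The locally convex inductive limit topology, i.e. the finest locally convex topology that makes
  all inclusions \<open>OC_step n \<subseteq> OC\<close> continuous: it is generated by all seminorms
  whose restrictions to the steps are continuous.
\<close>

definition OC_space :: "(real \<Rightarrow> complex) topology" where
  "OC_space = seminorm_topology OC
     {p. seminorm_on OC p \<and> (\<forall>n\<ge>1. continuous_map (OC_step_space n) euclideanreal p)}"


section \<open>Convolution and Fourier transform\<close>

text \<open>Elements of the dual of \<open>O\<^sub>C\<close> are the elements of \<open>continuous_dual OC_space\<close>.\<close>

definition convolution ::
  "((real \<Rightarrow> complex) \<Rightarrow> complex) \<Rightarrow> (real \<Rightarrow> complex) \<Rightarrow> (real \<Rightarrow> complex)" where
  "convolution T f = (\<lambda>x. T (\<lambda>y. f (x - y)))"

definition fourier :: "(real \<Rightarrow> complex) \<Rightarrow> (real \<Rightarrow> complex)" where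
  "fourier f \<xi> = (LINT x|lborel. exp (- \<i> * of_real x * of_real \<xi>) * f x)"

definition fourier_distr ::
  "((real \<Rightarrow> complex) \<Rightarrow> complex) \<Rightarrow> (real \<Rightarrow> complex) \<Rightarrow> complex" where
  "fourier_distr T f = T (fourier f)"

text \<open>
  A function \<open>g \<in> OM\<close> is identified with the tempered distribution given by integration against
  \<open>g\<close>, which determines \<open>g\<close>. For \<open>T\<close> in the dual of \<open>O\<^sub>C\<close> the Fourier transform
  of \<open>T\<close> is such a function.
\<close>

definition fourier_function :: "((real \<Rightarrow> complex) \<Rightarrow> complex) \<Rightarrow> (real \<Rightarrow> complex)" where
  "fourier_function T = (THE g. g \<in> OM \<and>
     (\<forall>f\<in>schwartz. fourier_distr T f = (LINT \<xi>|lborel. g \<xi> * f \<xi>)))"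

end

theory Submission
  imports "HOL-Probability.Sinc_Integral" "HOL-Probability.Characteristic_Functions"
    "HOL-Real_Asymp.Real_Asymp" Defs
begin

(* The import of Defs comes last, since HOL-Probability has another constant convolution. *)

text \<open>
  Under the Fourier transform \<open>C\<^sub>T\<close> is multiplication by \<open>g = F(T)\<close>, and for \<open>l\<close> at positive
  distance from the range of \<open>g\<close> the function \<open>1 / (l - g)\<close> is again in \<open>O\<^sub>M\<close>, with bounds that are
  uniform for \<open>l\<close> in a small ball. So the resolvents are Fourier multipliers with symbols that are
  bounded in \<open>O\<^sub>M\<close>. Such a multiplier is estimated on Schwartz functions in every norm with a weight
  \<open>(1 + x\<^sup>2)\<^sup>p\<close>, where \<open>p\<close> is any integer: positive \<open>p\<close> give its continuity on \<open>S\<close>, negative \<open>p\<close> let it be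
  extended to \<open>O\<^sub>C\<close> by density, and all identities between multipliers on \<open>O\<^sub>C\<close> follow from those on \<open>S\<close>.
  Conversely, if \<open>l = g \<xi>\<close>, then \<open>e\<^sup>i\<^sup>x\<^sup>\<xi>\<close> is an eigenfunction in \<open>O\<^sub>C\<close>, while on \<open>S\<close> the Fourier transform
  of everything in the range of \<open>l - C\<^sub>T\<close> vanishes at \<open>\<xi>\<close>.
\<close>

section \<open>Smooth functions and weighted derivative bounds\<close>

text \<open>The basic multiplier estimates are uniform in the symbol from the start:
  \<open>star_resolvent_set\<close> asks for equicontinuity over a ball of spectral parameters, so
  the constants are fixed by a growth exponent q and a bound B before the symbol is chosen. A symbol
  of growth q is made integrable by moving K = 2 (q + 1) factors 1 + i\<xi> from it to the function,
  at the cost of K derivatives; smoothness of the symbol becomes decay of the kernel, and Peetre's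
  inequality carries the weight across the convolution. Gaussian truncations tend to f only after
  one more power of the weight is given away; hence operators on \<open>OC\<close> are estimated
  from step n to step n + 1, which an inductive limit tolerates. Finally,
  \<open>fourier_function\<close> is a definite description: existence and uniqueness of that
  function belong to the proof, and existence comes from evaluating T on the characters
  e^(-ix\<xi>).\<close>

definition dv :: "(real \<Rightarrow> complex) \<Rightarrow> real \<Rightarrow> complex" where
  "dv f = (\<lambda>x. vector_derivative f (at x))"

lemma nth_deriv_0 [simp]: "nth_deriv 0 f = f"
  by (simp add: nth_deriv_def)

lemma nth_deriv_Suc: "nth_deriv (Suc i) f = dv (nth_deriv i f)"
  by (simp add: nth_deriv_def dv_def)

lemma nth_deriv_Suc': "nth_deriv (Suc i) f = nth_deriv i (dv f)"
  by (induction i) (simp_all add: nth_deriv_Suc)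

lemma dv_eqI: "(\<And>x. (f has_vector_derivative f' x) (at x)) \<Longrightarrow> dv f = f'"
  by (auto simp: dv_def vector_derivative_at)

text \<open>A chain in which each member is the derivative of the one before settles smoothness and
  all derivative formulas at once. Characters, Fourier transforms, powers of \<open>rc\<close>,
  limits of sequences and \<open>ft T\<close> are treated this way.\<close>

lemma nth_deriv_eqI:
  assumes "\<And>i x. (F i has_vector_derivative F (Suc i) x) (at x)"
  shows "F 0 \<in> C_infinity" "nth_deriv i (F 0) = F i"
proof -
  have *: "nth_deriv i (F 0) = F i" for i
    by (induction i) (auto simp: nth_deriv_Suc intro!: dv_eqI assms)
  then show "nth_deriv i (F 0) = F i" by simp
  show "F 0 \<in> C_infinity"
    using assms by (auto simp: C_infinity_def * intro!: differentiableI_vector)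
qed

text \<open>Closure under products and reciprocals needs an induction on the order, and
  \<open>C_infinity\<close> has no order to induct on. With \<open>ndiff\<close> the first
  derivative is split off and the claim for n applies to the terms of the product or quotient
  rule.\<close>

definition ndiff :: "nat \<Rightarrow> (real \<Rightarrow> complex) \<Rightarrow> bool" where
  "ndiff n f \<longleftrightarrow> (\<forall>i<n. \<forall>x. nth_deriv i f differentiable (at x))"

lemma ndiff_0 [simp]: "ndiff 0 f"
  by (simp add: ndiff_def)

lemma ndiff_Suc: "ndiff (Suc n) f \<longleftrightarrow> (\<forall>x. f differentiable (at x)) \<and> ndiff n (dv f)"
  unfolding ndiff_def All_less_Suc2 by (simp add: nth_deriv_Suc')

lemma ndiff_SucD: "ndiff (Suc n) f \<Longrightarrow> ndiff n f"
  by (simp add: ndiff_def)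

lemma C_infinity_iff_ndiff: "f \<in> C_infinity \<longleftrightarrow> (\<forall>n. ndiff n f)"
  by (auto simp: C_infinity_def ndiff_def)

lemma has_vector_derivative_dv:
  "f differentiable (at x) \<Longrightarrow> (f has_vector_derivative dv f x) (at x)"
  by (simp add: dv_def vector_derivative_works)

lemma ndiff_add: "ndiff n f \<Longrightarrow> ndiff n g \<Longrightarrow> ndiff n (\<lambda>x. f x + g x)"
proof (induction n arbitrary: f g)
  case (Suc n)
  have "dv (\<lambda>x. f x + g x) = (\<lambda>x. dv f x + dv g x)"
    using Suc.prems by (intro dv_eqI derivative_intros has_vector_derivative_dv) (auto simp: ndiff_Suc)
  then show ?case
    using Suc by (auto simp: ndiff_Suc intro: differentiable_add)
qed simp

lemma ndiff_mult: "ndiff n f \<Longrightarrow> ndiff n g \<Longrightarrow> ndiff n (\<lambda>x. f x * g x)"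
proof (induction n arbitrary: f g)
  case (Suc n)
  have "dv (\<lambda>x. f x * g x) = (\<lambda>x. f x * dv g x + dv f x * g x)"
    using Suc.prems
    by (intro dv_eqI has_vector_derivative_mult has_vector_derivative_dv) (auto simp: ndiff_Suc)
  then show ?case
    using Suc ndiff_SucD[OF Suc.prems(1)] ndiff_SucD[OF Suc.prems(2)]
    by (auto simp: ndiff_Suc intro!: ndiff_add differentiable_mult)
qed simp

lemma dv_const [simp]: "dv (\<lambda>x. c) = (\<lambda>x. 0)"
  by (intro dv_eqI) auto

lemma ndiff_const: "ndiff n (\<lambda>x. c)"
  by (induction n arbitrary: c) (auto simp: ndiff_Suc)

lemma has_vector_derivative_inverse_complex:
  fixes u :: "real \<Rightarrow> complex"
  assumes "(u has_vector_derivative u') (at x)" "u x \<noteq> 0"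
  shows "((\<lambda>x. inverse (u x)) has_vector_derivative - u' * (inverse (u x) * inverse (u x))) (at x)"
  using Deriv.has_derivative_inverse[OF assms(2) assms(1)[unfolded has_vector_derivative_def]]
  by (simp add: has_vector_derivative_def algebra_simps fun_eq_iff scaleR_conv_of_real)

lemma dv_inverse:
  assumes "\<And>x. u differentiable (at x)" "\<And>x. u x \<noteq> 0"
  shows "dv (\<lambda>x. inverse (u x)) = (\<lambda>x. (-1 * dv u x) * (inverse (u x) * inverse (u x)))"
  using assms has_vector_derivative_inverse_complex[OF has_vector_derivative_dv]
  by (intro dv_eqI) simp

lemma ndiff_inverse:
  assumes "\<And>x. u x \<noteq> 0"
  shows "ndiff n u \<Longrightarrow> ndiff n (\<lambda>x. inverse (u x))"
proof (induction n)
  case (Suc n)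
  have d: "u differentiable (at x)" for x
    using Suc.prems by (simp add: ndiff_Suc)
  have "ndiff n (\<lambda>x. inverse (u x))"
    using Suc ndiff_SucD by blast
  then have "ndiff n (dv (\<lambda>x. inverse (u x)))"
    unfolding dv_inverse[of u, OF d assms]
    using Suc.prems by (intro ndiff_mult ndiff_const) (auto simp: ndiff_Suc)
  moreover have "(\<lambda>x. inverse (u x)) differentiable (at x)" for x
    using has_vector_derivative_inverse_complex[OF has_vector_derivative_dv[OF d] assms]
      differentiableI_vector by blast
  ultimately show ?case by (simp add: ndiff_Suc)
qed simp

lemma C_infinity_add: "f \<in> C_infinity \<Longrightarrow> g \<in> C_infinity \<Longrightarrow> (\<lambda>x. f x + g x) \<in> C_infinity"
  by (simp add: C_infinity_iff_ndiff ndiff_add)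

lemma C_infinity_mult: "f \<in> C_infinity \<Longrightarrow> g \<in> C_infinity \<Longrightarrow> (\<lambda>x. f x * g x) \<in> C_infinity"
  by (simp add: C_infinity_iff_ndiff ndiff_mult)

lemma C_infinity_const: "(\<lambda>x. c) \<in> C_infinity"
  by (simp add: C_infinity_iff_ndiff ndiff_const)

lemma C_infinity_cmult: "f \<in> C_infinity \<Longrightarrow> (\<lambda>x. c * f x) \<in> C_infinity"
  by (intro C_infinity_mult C_infinity_const)

lemma C_infinity_diff:
  assumes "f \<in> C_infinity" "g \<in> C_infinity"
  shows "(\<lambda>x. f x - g x) \<in> C_infinity"
  using C_infinity_add[OF assms(1) C_infinity_cmult[OF assms(2), of "-1"]] by simp

lemma C_infinity_inverse:
  "u \<in> C_infinity \<Longrightarrow> (\<And>x. u x \<noteq> 0) \<Longrightarrow> (\<lambda>x. inverse (u x)) \<in> C_infinity"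
  by (simp add: C_infinity_iff_ndiff ndiff_inverse)

lemma C_infinity_differentiable: "f \<in> C_infinity \<Longrightarrow> f differentiable (at x)"
  unfolding C_infinity_def by (metis (mono_tags, lifting) mem_Collect_eq nth_deriv_0)

lemma C_infinity_dv: "f \<in> C_infinity \<Longrightarrow> dv f \<in> C_infinity"
  by (metis C_infinity_iff_ndiff ndiff_Suc)

lemma C_infinity_nth_deriv: "f \<in> C_infinity \<Longrightarrow> nth_deriv i f \<in> C_infinity"
  by (induction i) (simp_all add: nth_deriv_Suc C_infinity_dv)

lemma C_infinity_vderiv: "f \<in> C_infinity \<Longrightarrow> (f has_vector_derivative dv f x) (at x)"
  by (intro has_vector_derivative_dv C_infinity_differentiable)

lemma C_infinity_nth_vderiv:
  "f \<in> C_infinity \<Longrightarrow> (nth_deriv i f has_vector_derivative nth_deriv (Suc i) f x) (at x)"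
  by (simp add: nth_deriv_Suc C_infinity_vderiv C_infinity_nth_deriv)

lemma C_infinity_continuous: "f \<in> C_infinity \<Longrightarrow> continuous_on S f"
  by (meson C_infinity_differentiable continuous_at_imp_continuous_on differentiable_imp_continuous_within)

lemma C_infinity_measurable [measurable_dest]: "f \<in> C_infinity \<Longrightarrow> f \<in> borel_measurable borel"
  by (intro borel_measurable_continuous_onI C_infinity_continuous)

lemma nth_deriv_add:
  assumes "f \<in> C_infinity" "g \<in> C_infinity"
  shows "nth_deriv i (\<lambda>x. f x + g x) = (\<lambda>x. nth_deriv i f x + nth_deriv i g x)"
  using assms by (intro nth_deriv_eqI(2)[of "\<lambda>i x. nth_deriv i f x + nth_deriv i g x", simplified]
      has_vector_derivative_add C_infinity_nth_vderiv)

lemma nth_deriv_cmult: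
  assumes "f \<in> C_infinity"
  shows "nth_deriv i (\<lambda>x. c * f x) = (\<lambda>x. c * nth_deriv i f x)"
  using assms by (intro nth_deriv_eqI(2)[of "\<lambda>i x. c * nth_deriv i f x", simplified]
      has_vector_derivative_mult_right C_infinity_nth_vderiv)

lemma nth_deriv_diff:
  assumes "f \<in> C_infinity" "g \<in> C_infinity"
  shows "nth_deriv i (\<lambda>x. f x - g x) = (\<lambda>x. nth_deriv i f x - nth_deriv i g x)"
  using assms by (intro nth_deriv_eqI(2)[of "\<lambda>i x. nth_deriv i f x - nth_deriv i g x", simplified]
      has_vector_derivative_diff C_infinity_nth_vderiv)

lemma dv_mult:
  assumes "f \<in> C_infinity" "g \<in> C_infinity"
  shows "dv (\<lambda>x. f x * g x) = (\<lambda>x. f x * dv g x + dv f x * g x)"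
  using assms by (intro dv_eqI has_vector_derivative_mult C_infinity_vderiv)

lemma nth_deriv_affine:
  assumes "f \<in> C_infinity"
  shows "(\<lambda>x. f (a + b * x)) \<in> C_infinity"
    "nth_deriv i (\<lambda>x. f (a + b * x)) = (\<lambda>x. of_real (b ^ i) * nth_deriv i f (a + b * x))"
proof -
  let ?F = "\<lambda>i x. of_real (b ^ i) * nth_deriv i f (a + b * x)"
  have "(?F i has_vector_derivative ?F (Suc i) x) (at x)" for i x
  proof -
    have "((\<lambda>x. a + b * x) has_vector_derivative b) (at x)"
      by (auto intro!: derivative_eq_intros)
    from vector_diff_chain_at[OF this C_infinity_nth_vderiv[OF assms, of i "a + b * x"]]
    have "((\<lambda>x. nth_deriv i f (a + b * x)) has_vector_derivative
        b *\<^sub>R nth_deriv (Suc i) f (a + b * x)) (at x)"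
      by (simp add: o_def)
    from has_vector_derivative_mult_right[OF this, of "of_real (b ^ i)"]
    show ?thesis by (simp add: scaleR_conv_of_real mult_ac)
  qed
  from nth_deriv_eqI[of ?F, OF this]
  show "(\<lambda>x. f (a + b * x)) \<in> C_infinity"
    "nth_deriv i (\<lambda>x. f (a + b * x)) = (\<lambda>x. of_real (b ^ i) * nth_deriv i f (a + b * x))"
    by simp_all
qed

text \<open>The factor \<open>2 ^ i\<close> counts the terms of the Leibniz rule: each
  differentiation turns one product into two, so binomial coefficients need not be written
  down.\<close>

lemma nth_deriv_mult_bound:
  assumes "f \<in> C_infinity" "g \<in> C_infinity"
    and "\<And>j. j \<le> i \<Longrightarrow> cmod (nth_deriv j f x) \<le> A" "\<And>j. j \<le> i \<Longrightarrow> cmod (nth_deriv j g x) \<le> B"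
  shows "cmod (nth_deriv i (\<lambda>x. f x * g x) x) \<le> 2 ^ i * A * B"
  using assms
proof (induction i arbitrary: f g)
  case 0
  have "cmod (f x) * cmod (g x) \<le> A * B"
    using 0(3)[of 0] 0(4)[of 0] by (intro mult_mono) (auto intro: order_trans[OF norm_ge_zero])
  then show ?case by (simp add: norm_mult)
next
  case (Suc i)
  note sm = Suc.prems(1,2)[THEN C_infinity_dv]
  have "nth_deriv (Suc i) (\<lambda>x. f x * g x) x =
      nth_deriv i (\<lambda>x. f x * dv g x) x + nth_deriv i (\<lambda>x. dv f x * g x) x"
    unfolding nth_deriv_Suc' dv_mult[OF Suc.prems(1,2)]
    by (subst nth_deriv_add) (auto intro: C_infinity_mult Suc.prems sm)
  moreover have "cmod (nth_deriv i (\<lambda>x. f x * dv g x) x) \<le> 2 ^ i * A * B"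
    using Suc.prems sm by (intro Suc.IH) (auto simp: nth_deriv_Suc'[symmetric])
  moreover have "cmod (nth_deriv i (\<lambda>x. dv f x * g x) x) \<le> 2 ^ i * A * B"
    using Suc.prems sm by (intro Suc.IH) (auto simp: nth_deriv_Suc'[symmetric])
  ultimately show ?case
    using norm_triangle_ineq[of "nth_deriv i (\<lambda>x. f x * dv g x) x" "nth_deriv i (\<lambda>x. dv f x * g x) x"]
    by simp
qed

section \<open>Polynomial weights and Peetre's inequality\<close>

definition wt :: "int \<Rightarrow> real \<Rightarrow> real" where
  "wt p x = (1 + x\<^sup>2) powi p"

lemma one_plus_square_pos [simp]: "0 < 1 + (x::real)\<^sup>2"
  by (simp add: add_pos_nonneg)

lemma one_plus_square_neq_0 [simp]: "1 + (x::real)\<^sup>2 \<noteq> 0"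
  using one_plus_square_pos[of x] by linarith

lemma wt_pos [simp]: "0 < wt p x"
  by (simp add: wt_def)

lemma wt_nonneg [simp]: "0 \<le> wt p x"
  using wt_pos[of p x] by linarith

lemma wt_0 [simp]: "wt 0 x = 1"
  by (simp add: wt_def)

lemma wt_1: "wt 1 x = 1 + x\<^sup>2"
  by (simp add: wt_def)

lemma wt_of_nat: "wt (int n) x = (1 + x\<^sup>2) ^ n"
  by (simp add: wt_def power_int_of_nat)

lemma wt_minus: "wt (- p) x = inverse (wt p x)"
  by (simp add: wt_def power_int_minus)

lemma wt_add: "wt (p + q) x = wt p x * wt q x"
  by (simp add: wt_def power_int_add)

lemma wt_mono: "p \<le> q \<Longrightarrow> wt p x \<le> wt q x"
  unfolding wt_def by (rule power_int_increasing) auto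

lemma wt_ge_1: "0 \<le> p \<Longrightarrow> 1 \<le> wt p x"
  using wt_mono[of 0 p x] by simp

lemma wt_uminus_arg [simp]: "wt p (- x) = wt p x"
  by (simp add: wt_def)

lemma continuous_on_wt [continuous_intros]: "continuous_on S (wt p)"
  unfolding wt_def by (intro continuous_intros) auto

lemma abs_le_wt: "\<bar>x\<bar> \<le> wt 1 x"
proof -
  have "0 \<le> (\<bar>x\<bar> - 1)\<^sup>2" by simp
  then have "2 * \<bar>x\<bar> \<le> 1 + x\<^sup>2" by (simp add: power2_diff)
  then show ?thesis by (simp add: wt_1)
qed

lemma peetre_pos: "wt (int n) x \<le> 2 ^ n * wt (int n) y * wt (int n) (x - y)"
proof -
  \<comment> \<open>For n = 1, right side minus left side is 1 + (x - 2y)^2 + 2 (y (x -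
    y))^2.\<close>
  have "0 \<le> (x - 2 * y)\<^sup>2" "0 \<le> (y * (x - y))\<^sup>2" by simp_all
  then have "1 + x\<^sup>2 \<le> 2 * (1 + y\<^sup>2) * (1 + (x - y)\<^sup>2)"
    by (simp add: power2_eq_square algebra_simps)
  then have "(1 + x\<^sup>2) ^ n \<le> (2 * (1 + y\<^sup>2) * (1 + (x - y)\<^sup>2)) ^ n"
    by (intro power_mono) auto
  then show ?thesis by (simp only: wt_of_nat power_mult_distrib)
qed

text \<open>Peetre's inequality. For negative p it is the positive case with x and y exchanged,
  divided by the weights at both points.\<close>

lemma peetre: "wt p y \<le> 2 ^ nat \<bar>p\<bar> * wt p x * wt \<bar>p\<bar> (x - y)"
proof (cases "0 \<le> p")
  case True
  then obtain n where "p = int n" by (metis nonneg_int_cases)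
  then show ?thesis
    using peetre_pos[of n y x] wt_uminus_arg[of p "x - y"] by simp
next
  case False
  then obtain n where p: "p = - int n"
    by (metis int_cases2 nonneg_int_cases of_nat_0_le_iff)
  have "wt (int n) x \<le> 2 ^ n * wt (int n) y * wt (int n) (x - y)" by (rule peetre_pos)
  then show ?thesis
    unfolding p using wt_pos[of "int n" x] wt_pos[of "int n" y] wt_pos[of "int n" "x-y"]
    by (simp add: wt_minus divide_simps mult_ac)
qed

text \<open>A bound instead of a supremum, because \<open>Sup\<close> says nothing on unbounded
  sets. The integer p puts both scales of norms on one footing: p = -n belongs to the Schwartz
  norms, p = n to the growth norms.\<close>

definition dbound :: "nat \<Rightarrow> int \<Rightarrow> real \<Rightarrow> (real \<Rightarrow> complex) \<Rightarrow> bool" where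
  "dbound m p A f \<longleftrightarrow> (\<forall>i\<le>m. \<forall>x. cmod (nth_deriv i f x) \<le> A * wt p x)"

lemma dboundD: "dbound m p A f \<Longrightarrow> i \<le> m \<Longrightarrow> cmod (nth_deriv i f x) \<le> A * wt p x"
  by (simp add: dbound_def)

lemma dboundD0: "dbound m p A f \<Longrightarrow> cmod (f x) \<le> A * wt p x"
  using dboundD[of m p A f 0] by simp

lemma dbound_nonneg: "dbound m p A f \<Longrightarrow> 0 \<le> A"
proof -
  assume "dbound m p A f"
  from dboundD0[OF this, of 0] show ?thesis
    by (metis norm_ge_zero order_trans wt_pos zero_le_mult_iff not_less)
qed

lemma dbound_mono:
  assumes "dbound m p A f" "m' \<le> m" "p \<le> q" "A \<le> B"
  shows "dbound m' q B f"
  unfolding dbound_def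
proof (intro allI impI)
  fix i x assume "i \<le> m'"
  then have "cmod (nth_deriv i f x) \<le> A * wt p x"
    using assms(1,2) by (intro dboundD[where m = m]) auto
  also have "\<dots> \<le> B * wt q x"
    using assms dbound_nonneg[OF assms(1)] by (intro mult_mono wt_mono) auto
  finally show "cmod (nth_deriv i f x) \<le> B * wt q x" .
qed

lemma dbound_Suc: "dbound (Suc m) p A f \<longleftrightarrow> (\<forall>x. cmod (f x) \<le> A * wt p x) \<and> dbound m p A (dv f)"
  unfolding dbound_def less_Suc_eq_le[symmetric] All_less_Suc2 by (simp add: nth_deriv_Suc')

lemma dbound_nth_deriv: "dbound (m + i) p A f \<Longrightarrow> dbound m p A (nth_deriv i f)"
  by (induction i arbitrary: f) (auto simp: nth_deriv_Suc' dbound_Suc)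

lemma dbound_collect:
  assumes "\<And>i. i \<le> m \<Longrightarrow> \<exists>A. \<forall>x. cmod (nth_deriv i f x) \<le> A * wt p x"
  shows "\<exists>A. dbound m p A f"
proof -
  obtain A where A: "\<And>i x. i \<le> m \<Longrightarrow> cmod (nth_deriv i f x) \<le> A i * wt p x"
    using assms by metis
  have "cmod (nth_deriv i f x) \<le> Max (A ` {..m}) * wt p x" if "i \<le> m" for i x
  proof (rule order_trans[OF A[OF that]])
    show "A i * wt p x \<le> Max (A ` {..m}) * wt p x"
      using that by (intro mult_right_mono Max_ge) auto
  qed
  then show ?thesis by (auto simp: dbound_def)
qed

lemma dbound_add:
  assumes "f \<in> C_infinity" "g \<in> C_infinity" "dbound m p A f" "dbound m p B g"
  shows "dbound m p (A + B) (\<lambda>x. f x + g x)"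
  unfolding dbound_def nth_deriv_add[OF assms(1,2)]
  using dboundD[OF assms(3)] dboundD[OF assms(4)]
  by (auto simp: distrib_right intro!: norm_triangle_le add_mono)

lemma dbound_cmult:
  assumes "f \<in> C_infinity" "dbound m p A f"
  shows "dbound m p (cmod c * A) (\<lambda>x. c * f x)"
  unfolding dbound_def nth_deriv_cmult[OF assms(1)]
  using dboundD[OF assms(2)] by (auto simp: norm_mult mult.assoc intro: mult_left_mono)

lemma dbound_diff:
  assumes "f \<in> C_infinity" "g \<in> C_infinity" "dbound m p A f" "dbound m p B g"
  shows "dbound m p (A + B) (\<lambda>x. f x - g x)"
  using dbound_add[OF assms(1) C_infinity_cmult[OF assms(2)] assms(3) dbound_cmult[OF assms(2,4)], of "-1"]
  by simp

lemma dbound_mult: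
  assumes "f \<in> C_infinity" "g \<in> C_infinity" "dbound m p A f" "dbound m q B g"
  shows "dbound m (p + q) (2 ^ m * A * B) (\<lambda>x. f x * g x)"
  unfolding dbound_def
proof (intro allI impI)
  fix i x assume i: "i \<le> m"
  note nn = dbound_nonneg[OF assms(3)] dbound_nonneg[OF assms(4)]
  have "cmod (nth_deriv i (\<lambda>x. f x * g x) x) \<le> 2 ^ i * (A * wt p x) * (B * wt q x)"
    using assms i by (intro nth_deriv_mult_bound dboundD[where m = m]) auto
  also have "\<dots> \<le> 2 ^ m * (A * wt p x) * (B * wt q x)"
    using i nn by (intro mult_right_mono mult_nonneg_nonneg power_increasing) auto
  finally show "cmod (nth_deriv i (\<lambda>x. f x * g x) x) \<le> 2 ^ m * A * B * wt (p + q) x"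
    by (simp add: wt_add mult_ac)
qed

lemma dbound_const: "dbound m 0 (cmod c) (\<lambda>x. c)"
proof -
  have "nth_deriv (Suc i) (\<lambda>x. c) = (\<lambda>x. 0)" for i
    by (induction i arbitrary: c) (simp_all add: nth_deriv_Suc')
  then have "cmod (nth_deriv i (\<lambda>x. c) x) \<le> cmod c" for i x
    by (cases i) simp_all
  then show ?thesis by (simp add: dbound_def)
qed

text \<open>Exponent and constant are fixed before u, which later makes resolvents uniform over a
  ball. The induction on m uses (1/u)' = -u' (1/u)^2, where only lower orders of 1/u are
  needed.\<close>

lemma dbound_inverse:
  assumes "0 \<le> q"
  shows "\<exists>q' C. 0 \<le> q' \<and> 0 \<le> C \<and> (\<forall>u. u \<in> C_infinity \<and> (\<forall>x. \<delta> \<le> cmod (u x)) \<and> 0 < \<delta> \<and> dbound m q A u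
    \<longrightarrow> dbound m q' C (\<lambda>x. inverse (u x)))"
proof (induction m)
  case 0
  \<comment> \<open>The condition 0 < \<delta> sits inside the implication, so the absolute value is
    what keeps the constant nonnegative for every \<delta>.\<close>
  have "cmod (inverse (u x)) \<le> inverse \<bar>\<delta>\<bar>" if "\<delta> \<le> cmod (u x)" "0 < \<delta>" for u and x :: real
    using that by (simp add: norm_inverse le_imp_inverse_le)
  then show ?case
    by (intro exI[of _ 0] exI[of _ "inverse \<bar>\<delta>\<bar>"]) (auto simp: dbound_def)
next
  case (Suc m)
  then obtain q' C where C: "0 \<le> q'" "0 \<le> C"
    "\<And>u. u \<in> C_infinity \<Longrightarrow> (\<And>x. \<delta> \<le> cmod (u x)) \<Longrightarrow> 0 < \<delta> \<Longrightarrow> dbound m q A u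
      \<Longrightarrow> dbound m q' C (\<lambda>x. inverse (u x))" by blast
  \<comment> \<open>One q for u' and one q' for each factor 1/u; the two uses of
    \<open>dbound_mult\<close> contribute the powers of 2. The maximum retains the bound of 1/u
    itself.\<close>
  let ?q = "q + (q' + q')" and ?C = "max C (2 ^ m * A * (2 ^ m * C * C))"
  have "dbound (Suc m) ?q ?C (\<lambda>x. inverse (u x))"
    if u: "u \<in> C_infinity" "\<And>x. \<delta> \<le> cmod (u x)" "0 < \<delta>" "dbound (Suc m) q A u" for u
  proof -
    have nz: "u x \<noteq> 0" for x using u(2)[of x] u(3) by auto
    note inv = C_infinity_inverse[OF u(1) nz]
    have b: "dbound m q' C (\<lambda>x. inverse (u x))"
      using u by (intro C dbound_mono[OF u(4)]) auto
    have "dbound m q A (\<lambda>x. -1 * dv u x)"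
      using dbound_cmult[of "dv u" m q A "-1"] u(1,4) by (simp add: C_infinity_dv dbound_Suc)
    then have "dbound m ?q (2 ^ m * A * (2 ^ m * C * C)) (dv (\<lambda>x. inverse (u x)))"
      unfolding dv_inverse[of u, OF C_infinity_differentiable[OF u(1)] nz]
      using u inv b by (intro dbound_mult C_infinity_mult C_infinity_const C_infinity_dv)
    then have 1: "dbound m ?q ?C (dv (\<lambda>x. inverse (u x)))"
      by (rule dbound_mono) auto
    have "dbound 0 ?q ?C (\<lambda>x. inverse (u x))"
      using C(1) assms by (intro dbound_mono[OF b]) auto
    then show ?thesis using 1 dboundD0 by (auto simp: dbound_Suc)
  qed
  then show ?case using C(1,2) assms
    by (intro exI[of _ ?q] exI[of _ ?C]) auto
qed

section \<open>Integrals and the Fourier transform\<close>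

text \<open>The weight of exponent -1 is the standard integrable majorant; its integral is the
  source of the factors pi in the estimates.\<close>

lemma integrable_wt: "integrable lborel (wt (-1))"
  and integral_wt: "(LINT x|lborel. wt (-1) x) = pi"
  using integrable_inverse_1_plus_square LBINT_inverse_1_plus_square
  by (simp_all add: wt_def[abs_def] power_int_minus interval_lebesgue_integral_def
      set_lebesgue_integral_def set_integrable_def)

lemma integrable_wt_bound:
  fixes f :: "real \<Rightarrow> complex"
  assumes "f \<in> borel_measurable borel" "\<And>x. cmod (f x) \<le> C * wt (-1) x"
  shows "integrable lborel f"
  by (rule Bochner_Integration.integrable_bound[OF integrable_mult_right[OF integrable_wt, of C]])
    (use assms in \<open>auto intro!: AE_I2 order_trans[OF assms(2)]\<close>)

lemma norm_integral_wt_bound: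
  fixes f :: "real \<Rightarrow> complex"
  assumes "f \<in> borel_measurable borel" "\<And>x. cmod (f x) \<le> C * wt (-1) x"
  shows "cmod (LINT x|lborel. f x) \<le> C * pi"
proof -
  have "cmod (LINT x|lborel. f x) \<le> (LINT x|lborel. C * wt (-1) x)"
    by (rule Bochner_Integration.integral_norm_bound_integral[OF integrable_wt_bound[OF assms]])
      (auto intro: integrable_mult_right integrable_wt assms)
  then show ?thesis by (simp add: integral_wt)
qed

text \<open>The Fourier kernel e^(-ix\<xi>), curried so that \<open>ce \<xi>\<close> is a character
  to which a functional on \<open>OC\<close> can be applied.\<close>

definition ce :: "real \<Rightarrow> real \<Rightarrow> complex" where
  "ce \<xi> x = cis (- (\<xi> * x))"

lemma norm_ce [simp]: "cmod (ce \<xi> x) = 1"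
  by (simp add: ce_def)

lemma ce_commute: "ce \<xi> x = ce x \<xi>"
  by (simp add: ce_def mult.commute)

lemma ce_add: "ce (\<xi> + \<eta>) x = ce \<xi> x * ce \<eta> x"
  by (simp add: ce_def cis_mult distrib_right)

lemma ce_add_right: "ce \<xi> (x + y) = ce \<xi> x * ce \<xi> y"
  by (simp add: ce_def cis_mult distrib_left)

lemma ce_0 [simp]: "ce 0 x = 1" "ce \<xi> 0 = 1"
  by (simp_all add: ce_def)

lemma ce_minus: "ce (- \<xi>) (- x) = ce \<xi> x" "ce (- \<xi>) x = ce \<xi> (- x)"
  by (simp_all add: ce_def)

lemma ce_has_vector_derivative:
  "(ce \<xi> has_vector_derivative (- \<i> * of_real \<xi>) * ce \<xi> x) (at x)"
proof -
  have "((\<lambda>z. exp (- \<i> * of_real \<xi> * z)) has_field_derivative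
      (- \<i> * of_real \<xi>) * exp (- \<i> * of_real \<xi> * of_real x)) (at (of_real x))"
    by (auto intro!: derivative_eq_intros)
  from has_vector_derivative_real_field[OF this]
  show ?thesis by (simp add: ce_def[abs_def] cis_conv_exp mult_ac)
qed

lemma continuous_on_ce [continuous_intros]: "continuous_on S (ce \<xi>)"
  unfolding ce_def[abs_def] by (intro continuous_intros)

lemma ce_measurable [measurable (raw)]:
  "f \<in> borel_measurable M \<Longrightarrow> g \<in> borel_measurable M \<Longrightarrow> (\<lambda>x. ce (f x) (g x)) \<in> borel_measurable M"
proof -
  have "cis \<in> borel_measurable borel"
    by (intro borel_measurable_continuous_onI continuous_intros)
  then show "f \<in> borel_measurable M \<Longrightarrow> g \<in> borel_measurable M \<Longrightarrow> ?thesis"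
    unfolding ce_def by measurable
qed

lemma fourier_ce: "fourier f \<xi> = (LINT x|lborel. ce \<xi> x * f x)"
  by (simp add: fourier_def ce_def cis_conv_exp mult_ac)

lemma integrable_ce:
  assumes "integrable lborel f" "g \<in> borel_measurable borel"
  shows "integrable lborel (\<lambda>x. ce \<xi> (g x) * f x)"
  by (rule Bochner_Integration.integrable_bound[OF assms(1)])
    (use assms in \<open>auto simp: norm_mult\<close>)

lemma fourier_bound:
  assumes "f \<in> borel_measurable borel" "\<And>x. cmod (f x) \<le> C * wt (-1) x"
  shows "cmod (fourier f \<xi>) \<le> C * pi"
  unfolding fourier_ce using assms
  by (intro norm_integral_wt_bound) (auto simp: norm_mult)

lemma integral_vector_derivative_zero:
  fixes G :: "real \<Rightarrow> complex"
  assumes "\<And>x. (G has_vector_derivative g x) (at x)" "continuous_on UNIV g" "integrable lborel g"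
    "(G \<longlongrightarrow> 0) at_top" "(G \<longlongrightarrow> 0) at_bot"
  shows "(LINT x|lborel. g x) = 0"
proof -
  have "(LBINT x=-\<infinity>..\<infinity>. g x) = 0 - 0"
    using assms
    by (intro interval_integral_FTC_integrable[where F = G])
      (auto simp: ereal_tendsto_simps continuous_on_eq_continuous_at set_integrable_def)
  then show ?thesis
    by (simp add: interval_lebesgue_integral_def set_lebesgue_integral_def)
qed

lemma tendsto_zero_wt_bound:
  fixes f :: "real \<Rightarrow> complex"
  assumes "\<And>x. cmod (f x) \<le> C * wt (-1) x"
  shows "(f \<longlongrightarrow> 0) at_top" "(f \<longlongrightarrow> 0) at_bot"
proof -
  have "((\<lambda>x. C * inverse (1 + x\<^sup>2)) \<longlongrightarrow> 0) at_top" "((\<lambda>x. C * inverse (1 + x\<^sup>2)) \<longlongrightarrow> 0) at_bot"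
    for C :: real by real_asymp+
  note * = this[of C]
  show "(f \<longlongrightarrow> 0) at_top" "(f \<longlongrightarrow> 0) at_bot"
    by (rule Lim_null_comparison[OF _ *(1)] Lim_null_comparison[OF _ *(2)],
      use assms in \<open>auto simp: wt_def power_int_minus\<close>)+
qed

text \<open>Integration by parts: the derivative of the character times k has integral 0, because
  the product tends to 0 at both ends.\<close>

lemma fourier_dv:
  assumes k: "k \<in> C_infinity" "dbound (Suc 0) (-1) C k"
  shows "fourier (dv k) \<xi> = \<i> * of_real \<xi> * fourier k \<xi>"
proof -
  have b: "cmod (k x) \<le> C * wt (-1) x" "cmod (dv k x) \<le> C * wt (-1) x" for x
    using k(2) by (auto simp: dbound_def nth_deriv_Suc le_Suc_eq)
  note sm = k(1) C_infinity_dv[OF k(1)]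
  note int = integrable_wt_bound[OF C_infinity_measurable[OF sm(1)] b(1)]
    integrable_wt_bound[OF C_infinity_measurable[OF sm(2)] b(2)]
  let ?g = "\<lambda>x. ce \<xi> x * dv k x + ((- \<i> * of_real \<xi>) * ce \<xi> x) * k x"
  have "((\<lambda>x. ce \<xi> x * k x) has_vector_derivative ?g x) (at x)" for x
    by (intro has_vector_derivative_mult ce_has_vector_derivative C_infinity_vderiv sm)
  moreover have i: "integrable lborel (\<lambda>x. ce \<xi> x * dv k x)" "integrable lborel (\<lambda>x. ce \<xi> x * k x)"
    using int by (auto intro: integrable_ce)
  moreover have "integrable lborel ?g"
    using i by (simp add: mult.assoc)
  moreover have "continuous_on UNIV ?g"
    by (intro continuous_intros C_infinity_continuous sm)
  moreover have "((\<lambda>x. ce \<xi> x * k x) \<longlongrightarrow> 0) at_top" "((\<lambda>x. ce \<xi> x * k x) \<longlongrightarrow> 0) at_bot"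
    by (rule tendsto_zero_wt_bound[of _ C], simp add: norm_mult b)+
  ultimately have "(LINT x|lborel. ?g x) = 0"
    by (intro integral_vector_derivative_zero)
  then show ?thesis
    using i by (simp add: fourier_ce mult.assoc)
qed

lemma fourier_nth_deriv:
  assumes "k \<in> C_infinity" "dbound m (-1) C k" "i \<le> m"
  shows "fourier (nth_deriv i k) \<xi> = (\<i> * of_real \<xi>) ^ i * fourier k \<xi>"
  using assms(3)
proof (induction i)
  case (Suc i)
  have "dbound (Suc 0) (-1) C (nth_deriv i k)"
    using Suc.prems by (intro dbound_nth_deriv dbound_mono[OF assms(2)]) auto
  with Suc show ?case
    using fourier_dv[of "nth_deriv i k"] assms(1) by (simp add: nth_deriv_Suc C_infinity_nth_deriv)
qed simp

lemma one_plus_power_le: "0 \<le> t \<Longrightarrow> (1 + t) ^ a \<le> 2 ^ a * (1 + t ^ a)" for t :: real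
proof -
  assume t: "0 \<le> t"
  then have "(1 + t) ^ a \<le> (2 * max 1 t) ^ a" by (intro power_mono) auto
  also have "\<dots> \<le> 2 ^ a * (1 + t ^ a)"
    using t by (auto simp: power_mult_distrib max_def)
  finally show ?thesis .
qed

text \<open>Only the derivatives of order 0 and 2a enter, because (1 + t)^a \<le> 2^a (1 + t^a) with
  t = \<xi>^2. Each has a transform bounded by C pi, which doubles the constant.\<close>

lemma fourier_decay:
  assumes k: "k \<in> C_infinity" "dbound (2 * a) (-1) C k"
  shows "cmod (fourier k \<xi>) \<le> 2 ^ Suc a * (C * pi) * wt (- int a) \<xi>"
proof -
  have *: "cmod (fourier (nth_deriv i k) \<xi>) \<le> C * pi" if "i \<le> 2 * a" for i
    using k that by (intro fourier_bound dboundD[where m="2*a"] C_infinity_measurable C_infinity_nth_deriv) auto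
  have "(1 + \<xi>\<^sup>2) ^ a * cmod (fourier k \<xi>) \<le> 2 ^ a * (1 + (\<xi>\<^sup>2) ^ a) * cmod (fourier k \<xi>)"
    by (intro mult_right_mono one_plus_power_le) auto
  also have "\<dots> = 2 ^ a * (cmod (fourier (nth_deriv 0 k) \<xi>) + cmod (fourier (nth_deriv (2 * a) k) \<xi>))"
    unfolding fourier_nth_deriv[OF k order_refl] by (simp add: norm_mult norm_power power_mult distrib_right)
  also have "\<dots> \<le> 2 ^ a * (C * pi + C * pi)"
    by (intro mult_left_mono add_mono *) auto
  finally show ?thesis
    using wt_pos[of "int a" \<xi>] by (simp add: wt_minus wt_of_nat field_simps)
qed

text \<open>A quadratic Taylor remainder is the form in which differentiability arises for Fourier
  integrals, for functionals applied to characters and for \<open>flat\<close> at the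
  origin.\<close>

lemma has_vector_derivative_quadratic:
  fixes f :: "real \<Rightarrow> complex"
  assumes "\<And>h. \<bar>h\<bar> \<le> 1 \<Longrightarrow> cmod (f (x + h) - f x - of_real h * d) \<le> K * h\<^sup>2"
  shows "(f has_vector_derivative d) (at x)"
proof -
  have "((\<lambda>h. K * \<bar>h\<bar>) \<longlongrightarrow> K * \<bar>0\<bar>) (at 0)"
    by (intro tendsto_intros)
  then have lim: "((\<lambda>h. K * \<bar>h\<bar>) \<longlongrightarrow> 0) (at 0)"
    by simp
  have "\<forall>\<^sub>F h in at 0. norm (cmod (f (x + h) - f x - h *\<^sub>R d) / norm h) \<le> K * \<bar>h\<bar>"
    unfolding eventually_at
  proof (intro exI[of _ 1] conjI ballI impI)
    fix h :: real assume h: "h \<noteq> 0 \<and> dist h 0 < 1"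
    then have "cmod (f (x + h) - f x - of_real h * d) \<le> K * h\<^sup>2" by (intro assms) auto
    also have "K * h\<^sup>2 = K * \<bar>h\<bar> * \<bar>h\<bar>" by (simp add: power2_eq_square mult.assoc)
    finally have "cmod (f (x + h) - f x - of_real h * d) / \<bar>h\<bar> \<le> K * \<bar>h\<bar>"
      using h by (subst pos_divide_le_eq) auto
    then show "norm (cmod (f (x + h) - f x - h *\<^sub>R d) / norm h) \<le> K * \<bar>h\<bar>"
      by (simp only: scaleR_conv_of_real norm_divide real_norm_def abs_divide abs_norm_cancel abs_idempotent)
  qed simp
  from Lim_null_comparison[OF this lim]
  have "((\<lambda>h. cmod (f (x + h) - f x - h *\<^sub>R d) / norm h) \<longlongrightarrow> 0) (at 0)" .
  then show ?thesis
    by (simp add: has_vector_derivative_def has_derivative_at bounded_linear_scaleR_left)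
qed

lemma ce_taylor1: "cmod (ce \<xi> x - 1) \<le> \<bar>\<xi> * x\<bar>"
  using iexp_approx1[of "- (\<xi> * x)" 0] by (simp add: ce_def cis_conv_exp)

lemma ce_taylor2: "cmod (ce \<xi> x - 1 + \<i> * of_real \<xi> * of_real x) \<le> (\<xi> * x)\<^sup>2"
proof -
  have "cmod (ce \<xi> x - 1 + \<i> * of_real \<xi> * of_real x) \<le> (\<xi> * x)\<^sup>2 / 2"
    using iexp_approx1[of "- (\<xi> * x)" 1]
    by (simp add: ce_def cis_conv_exp algebra_simps power2_eq_square abs_mult)
  then show ?thesis
    by (rule order_trans) simp
qed

text \<open>The second-order remainder of the character costs a factor x^2, that is one power of the
  weight. Starting from exponent -2, exponent -1 remains and is integrable.\<close>

lemma fourier_has_vector_derivative: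
  assumes f: "f \<in> borel_measurable borel" "\<And>x. cmod (f x) \<le> C * wt (-2) x"
  shows "(fourier f has_vector_derivative fourier (\<lambda>x. (- \<i> * of_real x) * f x) \<xi>) (at \<xi>)"
proof (rule has_vector_derivative_quadratic)
  fix h :: real assume "\<bar>h\<bar> \<le> 1"
  have C: "0 \<le> C * wt (-2) x" for x
    by (rule order_trans[OF norm_ge_zero f(2)])
  have w1: "wt 1 x * (C * wt (-2) x) = C * wt (-1) x" for x
    using wt_add[of 1 "-2" x] by (simp add: mult_ac)
  have 1: "cmod (f x) \<le> C * wt (-1) x" for x
    using mult_right_mono[OF wt_ge_1[of 1 x] C[of x]] f(2)[of x] by (simp add: w1)
  have 2: "cmod ((- \<i> * of_real x) * f x) \<le> C * wt (-1) x" for x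
    using mult_mono[OF abs_le_wt f(2), of x x] by (simp add: w1 norm_mult)
  have 3: "cmod (of_real (x\<^sup>2) * f x) \<le> C * wt (-1) x" for x
    using mult_mono[of "x\<^sup>2" "wt 1 x" "cmod (f x)" "C * wt (-2) x"] f(2)[of x]
    by (simp add: w1 norm_mult norm_power) (simp add: wt_1)
  have int: "integrable lborel (\<lambda>x. ce \<eta> x * f x)" "integrable lborel (\<lambda>x. ce \<eta> x * ((- \<i> * of_real x) * f x))" for \<eta>
    using integrable_ce[OF integrable_wt_bound[OF f(1) 1], of "\<lambda>x. x"]
      integrable_ce[OF integrable_wt_bound[OF _ 2], of "\<lambda>x. x"] f(1) by simp_all
  have "fourier f (\<xi> + h) - fourier f \<xi> - of_real h * fourier (\<lambda>x. (- \<i> * of_real x) * f x) \<xi>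
    = (LINT x|lborel. ce (\<xi> + h) x * f x - ce \<xi> x * f x - of_real h * (ce \<xi> x * ((- \<i> * of_real x) * f x)))"
    unfolding fourier_ce by (simp only: Bochner_Integration.integral_diff Bochner_Integration.integrable_diff
      integrable_mult_right integral_mult_right_zero int)
  also have "\<dots> = (LINT x|lborel. ce \<xi> x * (f x * (ce h x - 1 + \<i> * of_real h * of_real x)))"
    by (intro Bochner_Integration.integral_cong refl) (simp add: ce_add algebra_simps)
  also have "cmod \<dots> \<le> (C * h\<^sup>2) * pi"
  proof (rule norm_integral_wt_bound)
    fix x
    have "cmod (ce \<xi> x * (f x * (ce h x - 1 + \<i> * of_real h * of_real x))) \<le> cmod (f x) * (h * x)\<^sup>2"
      unfolding norm_mult norm_ce mult_1 by (intro mult_left_mono ce_taylor2) simp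
    also have "\<dots> = h\<^sup>2 * cmod (of_real (x\<^sup>2) * f x)"
      by (simp add: norm_mult norm_power power_mult_distrib)
    also have "\<dots> \<le> h\<^sup>2 * (C * wt (-1) x)"
      by (intro mult_left_mono 3) simp
    finally show "cmod (ce \<xi> x * (f x * (ce h x - 1 + \<i> * of_real h * of_real x))) \<le> C * h\<^sup>2 * wt (-1) x"
      by (simp add: mult_ac)
  qed (use f(1) in measurable)
  finally show "cmod (fourier f (\<xi> + h) - fourier f \<xi> - of_real h * fourier (\<lambda>x. (- \<i> * of_real x) * f x) \<xi>)
      \<le> C * pi * h\<^sup>2" by (simp add: mult_ac)
qed

text \<open>Fubini for a kernel of modulus 1 that is symmetric in its two arguments.\<close>

lemma integral_fourier_exchange:
  assumes k: "integrable lborel k" and u: "integrable lborel u"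
  shows "(LINT \<xi>|lborel. k \<xi> * fourier u \<xi>) = (LINT y|lborel. fourier k y * u y)"
proof -
  have [measurable]: "k \<in> borel_measurable borel" "u \<in> borel_measurable borel"
    using k u by auto
  let ?f = "\<lambda>\<xi> y. k \<xi> * (ce \<xi> y * u y)"
  have m: "case_prod ?f \<in> borel_measurable (lborel \<Otimes>\<^sub>M lborel)"
    by measurable
  have i: "integrable (lborel \<Otimes>\<^sub>M lborel) (case_prod ?f)"
  proof (rule lborel_pair.Fubini_integrable[OF m])
    have "integrable lborel (\<lambda>x. cmod (k x) * (LINT y|lborel. cmod (u y)))"
      using k by simp
    then show "integrable lborel (\<lambda>x. LINT y|lborel. cmod (case (x, y) of (\<xi>, y) \<Rightarrow> k \<xi> * (ce \<xi> y * u y)))"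
      by (simp add: norm_mult)
    show "AE x in lborel. integrable lborel (\<lambda>y. case (x, y) of (\<xi>, y) \<Rightarrow> k \<xi> * (ce \<xi> y * u y))"
      using integrable_ce[OF u] by simp
  qed
  have "(LINT \<xi>|lborel. k \<xi> * fourier u \<xi>) = (LINT \<xi>|lborel. LINT y|lborel. ?f \<xi> y)"
    by (simp add: fourier_ce)
  also have "\<dots> = (LINT y|lborel. LINT \<xi>|lborel. ?f \<xi> y)"
    by (rule lborel_pair.Fubini_integral[OF i, symmetric])
  also have "\<dots> = (LINT y|lborel. LINT \<xi>|lborel. (ce y \<xi> * k \<xi>) * u y)"
    by (intro Bochner_Integration.integral_cong refl) (simp add: ce_commute mult_ac)
  also have "\<dots> = (LINT y|lborel. fourier k y * u y)"
    by (simp add: fourier_ce)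
  finally show ?thesis .
qed

section \<open>The Schwartz space\<close>

lemma weighted_values_le: "(\<forall>v \<in> weighted_values (wt (- p)) m f. v \<le> A) \<longleftrightarrow> dbound m p A f"
proof -
  have *: "wt (- p) x * c \<le> A \<longleftrightarrow> c \<le> A * wt p x" for x c
    using wt_pos[of p x] by (simp add: wt_minus field_simps)
  have "(\<forall>v \<in> weighted_values (wt (- p)) m f. v \<le> A) \<longleftrightarrow>
      (\<forall>i\<le>m. \<forall>x. wt (- p) x * cmod (nth_deriv i f x) \<le> A)"
    unfolding weighted_values_def by blast
  then show ?thesis
    by (simp add: dbound_def *)
qed

lemma schwartz_values_wt: "schwartz_values n f = weighted_values (wt (- (- int n))) n f"
  by (simp add: wt_of_nat[abs_def])

lemma growth_values_wt: "growth_values m n f = weighted_values (wt (- int n)) m f"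
  by (simp add: wt_of_nat wt_minus[abs_def])

lemma bdd_above_schwartz_values: "bdd_above (schwartz_values n f) \<longleftrightarrow> (\<exists>A. dbound n (- int n) A f)"
  unfolding bdd_above_def schwartz_values_wt weighted_values_le ..

lemma bdd_above_growth_values: "bdd_above (growth_values m n f) \<longleftrightarrow> (\<exists>A. dbound m (int n) A f)"
  unfolding bdd_above_def growth_values_wt weighted_values_le ..

text \<open>The Schwartz norms tie order and weight to one index n. Taking n above both m and -p
  separates the two, which all later estimates require.\<close>

lemma schwartz_iff: "f \<in> schwartz \<longleftrightarrow> f \<in> C_infinity \<and> (\<forall>m p. \<exists>A. dbound m p A f)"
proof -
  note * = bdd_above_schwartz_values
  show ?thesis
  proof
    assume f: "f \<in> schwartz"
    have "\<exists>A. dbound m p A f" for m p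
    proof -
      let ?n = "max m (nat (- p))"
      have "bdd_above (schwartz_values ?n f)" using f by (simp add: schwartz_def)
      then obtain A where "dbound ?n (- int ?n) A f" unfolding * by blast
      then have "dbound m p A f" by (rule dbound_mono) auto
      then show ?thesis by blast
    qed
    then show "f \<in> C_infinity \<and> (\<forall>m p. \<exists>A. dbound m p A f)" using f by (auto simp: schwartz_def)
  qed (auto simp: schwartz_def *)
qed

lemma schwartz_smooth: "f \<in> schwartz \<Longrightarrow> f \<in> C_infinity"
  by (simp add: schwartz_iff)

lemma schwartz_bound: "f \<in> schwartz \<Longrightarrow> \<exists>A. dbound m p A f"
  by (simp add: schwartz_iff)

lemma schwartz_add: "f \<in> schwartz \<Longrightarrow> g \<in> schwartz \<Longrightarrow> (\<lambda>x. f x + g x) \<in> schwartz"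
  unfolding schwartz_iff using C_infinity_add dbound_add by blast

lemma schwartz_cmult: "f \<in> schwartz \<Longrightarrow> (\<lambda>x. c * f x) \<in> schwartz"
  unfolding schwartz_iff using C_infinity_cmult dbound_cmult by blast

lemma schwartz_diff: "f \<in> schwartz \<Longrightarrow> g \<in> schwartz \<Longrightarrow> (\<lambda>x. f x - g x) \<in> schwartz"
  unfolding schwartz_iff using C_infinity_diff dbound_diff by blast

section \<open>The space \<open>OM\<close> and its action on Schwartz functions\<close>

lemma OM_iff: "h \<in> OM \<longleftrightarrow> h \<in> C_infinity \<and> (\<forall>m. \<exists>q A. 0 \<le> q \<and> dbound m q A h)"
proof -
  note * = bdd_above_growth_values
  show ?thesis
  proof
    assume h: "h \<in> OM"
    have "\<exists>q A. 0 \<le> q \<and> dbound m q A h" for m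
    proof -
      have "\<exists>n\<ge>1. bdd_above (growth_values (max m 1) n h)"
        using h by (simp add: OM_def)
      then obtain n A where "dbound (max m 1) (int n) A h"
        unfolding * by blast
      then show ?thesis using dbound_mono[of "max m 1" "int n" A h m "int n" A]
        by (intro exI[of _ "int n"] exI[of _ A]) auto
    qed
    then show "h \<in> C_infinity \<and> (\<forall>m. \<exists>q A. 0 \<le> q \<and> dbound m q A h)"
      using h by (auto simp: OM_def)
  next
    assume h: "h \<in> C_infinity \<and> (\<forall>m. \<exists>q A. 0 \<le> q \<and> dbound m q A h)"
    have "\<exists>n\<ge>1. bdd_above (growth_values m n h)" for m
    proof -
      obtain q A where "dbound m q A h" using h by blast
      then have "dbound m (int (max 1 (nat q))) A h" by (rule dbound_mono) auto
      then show ?thesis using * by (intro exI[of _ "max 1 (nat q)"]) auto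
    qed
    then show "h \<in> OM" using h by (auto simp: OM_def)
  qed
qed

lemma OM_smooth: "h \<in> OM \<Longrightarrow> h \<in> C_infinity"
  by (simp add: OM_iff)

lemma OM_const: "(\<lambda>x. c) \<in> OM"
  unfolding OM_iff using C_infinity_const dbound_const by (metis order_refl)

lemma OM_cmult: "h \<in> OM \<Longrightarrow> (\<lambda>x. c * h x) \<in> OM"
  unfolding OM_iff using C_infinity_cmult dbound_cmult by blast

lemma OM_add:
  assumes "g \<in> OM" "h \<in> OM" shows "(\<lambda>x. g x + h x) \<in> OM"
  unfolding OM_iff
proof (intro conjI allI)
  show "(\<lambda>x. g x + h x) \<in> C_infinity" using assms by (simp add: OM_iff C_infinity_add)
  fix m
  obtain q A q' B where *: "0 \<le> q" "dbound m q A g" "0 \<le> q'" "dbound m q' B h"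
    using assms unfolding OM_iff by metis
  have "dbound m (max q q') (A + B) (\<lambda>x. g x + h x)"
    using assms by (intro dbound_add OM_smooth dbound_mono[OF *(2)] dbound_mono[OF *(4)]) auto
  with * show "\<exists>q A. 0 \<le> q \<and> dbound m q A (\<lambda>x. g x + h x)"
    by (metis max.coboundedI1)
qed

lemma OM_diff: "g \<in> OM \<Longrightarrow> h \<in> OM \<Longrightarrow> (\<lambda>x. g x - h x) \<in> OM"
  using OM_add[of g "\<lambda>x. -1 * h x"] OM_cmult[of h "-1"] by simp

lemma OM_mult:
  assumes "g \<in> OM" "h \<in> OM" shows "(\<lambda>x. g x * h x) \<in> OM"
  unfolding OM_iff
proof (intro conjI allI)
  show "(\<lambda>x. g x * h x) \<in> C_infinity" using assms by (simp add: OM_iff C_infinity_mult)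
  fix m
  obtain q A q' B where *: "0 \<le> q" "dbound m q A g" "0 \<le> q'" "dbound m q' B h"
    using assms unfolding OM_iff by metis
  then have "dbound m (q + q') (2 ^ m * A * B) (\<lambda>x. g x * h x)"
    using assms by (intro dbound_mult OM_smooth)
  with * show "\<exists>q A. 0 \<le> q \<and> dbound m q A (\<lambda>x. g x * h x)"
    by (metis add_nonneg_nonneg)
qed

lemma schwartz_OM_mult:
  assumes "h \<in> OM" "f \<in> schwartz" shows "(\<lambda>x. h x * f x) \<in> schwartz"
  unfolding schwartz_iff
proof (intro conjI allI)
  show "(\<lambda>x. h x * f x) \<in> C_infinity" using assms by (simp add: OM_iff schwartz_iff C_infinity_mult)
  fix m p
  obtain q A where A: "dbound m q A h"
    using assms(1) unfolding OM_iff by metis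
  obtain B where B: "dbound m (p - q) B f"
    using assms(2) unfolding schwartz_iff by metis
  have "dbound m (q + (p - q)) (2 ^ m * A * B) (\<lambda>x. h x * f x)"
    using assms A B by (intro dbound_mult OM_smooth schwartz_smooth)
  then show "\<exists>A. dbound m p A (\<lambda>x. h x * f x)" by auto
qed

lemma schwartz_dv: "f \<in> schwartz \<Longrightarrow> dv f \<in> schwartz"
  unfolding schwartz_iff using C_infinity_dv dbound_Suc by blast

lemma schwartz_nth_deriv: "f \<in> schwartz \<Longrightarrow> nth_deriv i f \<in> schwartz"
  by (induction i) (auto simp: nth_deriv_Suc schwartz_dv)

lemma has_vector_derivative_complex_of_real: "((\<lambda>x. complex_of_real x) has_vector_derivative 1) (at x)"
  by (auto intro!: derivative_eq_intros)

lemma dv_linear [simp]: "dv (\<lambda>x. c * of_real x) = (\<lambda>x. c)"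
  using has_vector_derivative_mult_right[OF has_vector_derivative_complex_of_real, of c]
  by (intro dv_eqI) simp

lemma C_infinity_linear: "(\<lambda>x. c * complex_of_real x) \<in> C_infinity"
proof -
  have "ndiff n (\<lambda>x. c * of_real x)" for n
    by (cases n) (auto simp: ndiff_Suc ndiff_const
        intro!: differentiableI_vector[OF has_vector_derivative_mult_right[OF has_vector_derivative_complex_of_real]])
  then show ?thesis by (simp add: C_infinity_iff_ndiff)
qed

lemma dbound_linear: "dbound m 1 (cmod c) (\<lambda>x. c * of_real x)"
proof (cases m)
  case 0
  then show ?thesis using abs_le_wt by (auto simp: dbound_def norm_mult intro!: mult_left_mono)
next
  case (Suc n)
  have "dbound n 1 (cmod c) (\<lambda>x::real. c)"
    by (rule dbound_mono[OF dbound_const]) auto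
  then show ?thesis using abs_le_wt by (auto simp: Suc dbound_Suc norm_mult intro!: mult_left_mono)
qed

lemma OM_linear: "(\<lambda>x. c * complex_of_real x) \<in> OM"
  unfolding OM_iff using C_infinity_linear dbound_linear zero_le_one by blast

lemma OM_power: "h \<in> OM \<Longrightarrow> (\<lambda>x. h x ^ n) \<in> OM"
  by (induction n) (auto intro: OM_const OM_mult)

lemma schwartz_affine:
  assumes "f \<in> schwartz" "b \<noteq> 0"
  shows "(\<lambda>x. f (a + b * x)) \<in> schwartz"
  unfolding schwartz_iff
proof (intro conjI allI)
  note sm = schwartz_smooth[OF assms(1)]
  show "(\<lambda>x. f (a + b * x)) \<in> C_infinity" by (rule nth_deriv_affine(1)[OF sm])
  fix m p
  define n where "n = nat \<bar>p\<bar>"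
  \<comment> \<open>From bx = (a + bx) - a follows (bx)^2 \<le> 2 (a + bx)^2 + 2 a^2, hence 1 + x^2
    \<le> K (1 + (a + bx)^2).\<close>
  define K where "K = 1 + 2 * (1 + a\<^sup>2) / b\<^sup>2"
  have K: "1 \<le> K" by (simp add: K_def)
  have w: "wt (- int n) (a + b * x) \<le> K ^ n * wt p x" for x
  proof -
    have "0 \<le> (2 * a + b * x)\<^sup>2" by simp
    then have "(b * x)\<^sup>2 \<le> 2 * (a + b * x)\<^sup>2 + 2 * a\<^sup>2"
      by (simp add: power2_eq_square algebra_simps)
    also have "\<dots> \<le> 2 * (1 + a\<^sup>2) * (1 + (a + b * x)\<^sup>2)"
      by (simp add: distrib_left distrib_right)
    finally have "x\<^sup>2 \<le> 2 * (1 + a\<^sup>2) * (1 + (a + b * x)\<^sup>2) / b\<^sup>2"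
      using assms(2) by (simp add: pos_le_divide_eq power_mult_distrib mult.commute)
    then have "1 + x\<^sup>2 \<le> 1 * (1 + (a + b * x)\<^sup>2) + 2 * (1 + a\<^sup>2) / b\<^sup>2 * (1 + (a + b * x)\<^sup>2)"
      using zero_le_power2[of "a + b * x"] by (simp only: times_divide_eq_left mult_1)
    then have "(1 + x\<^sup>2) ^ n \<le> (K * (1 + (a + b * x)\<^sup>2)) ^ n"
      unfolding K_def distrib_right by (rule power_mono) simp
    then have "(1 + x\<^sup>2) ^ n \<le> K ^ n * (1 + (a + b * x)\<^sup>2) ^ n"
      by (simp only: power_mult_distrib)
    then have "wt (- int n) (a + b * x) \<le> K ^ n * wt (- int n) x"
      by (simp add: wt_minus wt_of_nat field_simps)
    also have "\<dots> \<le> K ^ n * wt p x"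
      using K by (intro mult_left_mono wt_mono) (auto simp: n_def)
    finally show ?thesis .
  qed
  show "\<exists>A. dbound m p A (\<lambda>x. f (a + b * x))"
  proof (rule dbound_collect)
    fix i
    obtain A where A: "dbound i (- int n) A f" using schwartz_bound[OF assms(1)] by blast
    have "cmod (nth_deriv i (\<lambda>x. f (a + b * x)) x) \<le> \<bar>b\<bar> ^ i * (A * K ^ n) * wt p x" for x
    proof -
      have "cmod (nth_deriv i f (a + b * x)) \<le> A * (K ^ n * wt p x)"
        by (rule order_trans[OF dboundD[OF A order_refl] mult_left_mono[OF w dbound_nonneg[OF A]]])
      then have "\<bar>b\<bar> ^ i * cmod (nth_deriv i f (a + b * x)) \<le> \<bar>b\<bar> ^ i * (A * (K ^ n * wt p x))"
        by (intro mult_left_mono) auto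
      then show ?thesis
        unfolding nth_deriv_affine(2)[OF sm] by (simp add: norm_mult norm_power mult.assoc)
    qed
    then show "\<exists>A. \<forall>x. cmod (nth_deriv i (\<lambda>x. f (a + b * x)) x) \<le> A * wt p x" by blast
  qed
qed

lemma schwartz_reflect: "f \<in> schwartz \<Longrightarrow> (\<lambda>x. f (- x)) \<in> schwartz"
  using schwartz_affine[of f "-1" 0] by simp

lemma schwartz_translate: "f \<in> schwartz \<Longrightarrow> (\<lambda>x. f (x - a)) \<in> schwartz"
  using schwartz_affine[of f 1 "-a"] by simp

lemma schwartz_wt_bound: "f \<in> schwartz \<Longrightarrow> \<exists>A. \<forall>x. cmod (f x) \<le> A * wt p x"
  using schwartz_bound dboundD0 by metis

lemma schwartz_integrable: "f \<in> schwartz \<Longrightarrow> integrable lborel f"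
  using schwartz_wt_bound[of f "-1"] integrable_wt_bound[OF C_infinity_measurable[OF schwartz_smooth]] by blast

lemma fourier_schwartz_nth_deriv:
  assumes "f \<in> schwartz"
  shows "fourier f \<in> C_infinity"
    and "nth_deriv i (fourier f) = fourier (\<lambda>x. (- \<i> * of_real x) ^ i * f x)"
proof -
  let ?F = "\<lambda>i. fourier (\<lambda>x. (- \<i> * of_real x) ^ i * f x)"
  have "(?F i has_vector_derivative ?F (Suc i) x) (at x)" for i x
  proof -
    let ?f = "\<lambda>x. (- \<i> * complex_of_real x) ^ i * f x"
    have f: "?f \<in> schwartz"
      using assms by (intro schwartz_OM_mult OM_power OM_linear)
    then obtain A where "\<And>x. cmod (?f x) \<le> A * wt (-2) x"
      using schwartz_wt_bound by blast
    from fourier_has_vector_derivative[OF C_infinity_measurable[OF schwartz_smooth[OF f]] this]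
    show ?thesis by (simp add: mult.assoc)
  qed
  from nth_deriv_eqI[of ?F, OF this] show "fourier f \<in> C_infinity"
    "nth_deriv i (fourier f) = ?F i" by simp_all
qed

text \<open>Each derivative of the transform is again the transform of a Schwartz function, so decay
  of transforms is all that is needed.\<close>

lemma fourier_schwartz:
  assumes "f \<in> schwartz" shows "fourier f \<in> schwartz"
  unfolding schwartz_iff
proof (intro conjI allI)
  show "fourier f \<in> C_infinity" by (rule fourier_schwartz_nth_deriv(1)[OF assms])
  fix m p
  define a where "a = nat \<bar>p\<bar>"
  show "\<exists>A. dbound m p A (fourier f)"
  proof (rule dbound_collect)
    fix i
    let ?f = "\<lambda>x. (- \<i> * complex_of_real x) ^ i * f x"
    have f: "?f \<in> schwartz"
      using assms by (intro schwartz_OM_mult OM_power OM_linear)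
    obtain C where C: "dbound (2 * a) (-1) C ?f" using schwartz_bound[OF f] by blast
    have "cmod (nth_deriv i (fourier f) \<xi>) \<le> (2 ^ Suc a * (C * pi)) * wt p \<xi>" for \<xi>
    proof -
      have "cmod (nth_deriv i (fourier f) \<xi>) \<le> (2 ^ Suc a * (C * pi)) * wt (- int a) \<xi>"
        unfolding fourier_schwartz_nth_deriv(2)[OF assms]
        by (rule fourier_decay[OF schwartz_smooth[OF f] C])
      also have "\<dots> \<le> (2 ^ Suc a * (C * pi)) * wt p \<xi>"
        using dbound_nonneg[OF C] by (intro mult_left_mono wt_mono) (auto simp: a_def)
      finally show ?thesis .
    qed
    then show "\<exists>A. \<forall>\<xi>. cmod (nth_deriv i (fourier f) \<xi>) \<le> A * wt p \<xi>" by blast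
  qed
qed

section \<open>Fourier inversion\<close>

definition gauss :: "real \<Rightarrow> complex" where
  "gauss x = of_real (exp (- (x\<^sup>2 / 2)))"

lemma gauss_vderiv: "(gauss has_vector_derivative (-1 * of_real x) * gauss x) (at x)"
proof -
  have "((\<lambda>x. exp (- (x\<^sup>2 / 2))) has_real_derivative - x * exp (- (x\<^sup>2 / 2))) (at x)"
    by (auto intro!: derivative_eq_intros)
  from has_vector_derivative_of_real[OF this] show ?thesis
    by (simp add: gauss_def[abs_def])
qed

lemma dv_gauss: "dv gauss = (\<lambda>x. (-1 * of_real x) * gauss x)"
  by (intro dv_eqI gauss_vderiv)

lemma gauss_smooth: "gauss \<in> C_infinity"
proof -
  have "ndiff n gauss" for n
  proof (induction n)
    case (Suc n)
    have "ndiff n (dv gauss)"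
      unfolding dv_gauss using C_infinity_linear[of "-1", unfolded C_infinity_iff_ndiff] Suc
      by (intro ndiff_mult[of n "\<lambda>x. -1 * of_real x"]) iprover+
    then show ?case
      using gauss_vderiv by (auto simp: ndiff_Suc intro: differentiableI_vector)
  qed simp
  then show ?thesis by (simp add: C_infinity_iff_ndiff)
qed

lemma gauss_schwartz: "gauss \<in> schwartz"
proof -
  have "\<exists>A. dbound m p A gauss" for m p
  proof (induction m arbitrary: p)
    case 0
    define n where "n = Suc (nat \<bar>p\<bar>)"
    have n: "0 < n" by (simp add: n_def)
    have "cmod (gauss x) \<le> (2 * real n) ^ n * wt p x" for x
    proof -
      \<comment> \<open>The rescaling by 2n is chosen so that the n-th power of the exponential is
        exactly e^(x^2/2), which cancels the Gaussian.\<close>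
      have "1 + x\<^sup>2 \<le> 2 * real n * (1 + x\<^sup>2 / (2 * real n))" by (simp add: n_def field_simps)
      also have "\<dots> \<le> 2 * real n * exp (x\<^sup>2 / (2 * real n))"
        by (intro mult_left_mono exp_ge_add_one_self) auto
      finally have "(1 + x\<^sup>2) ^ n \<le> (2 * real n * exp (x\<^sup>2 / (2 * real n))) ^ n"
        by (intro power_mono) auto
      also have "\<dots> = (2 * real n) ^ n * exp (x\<^sup>2 / 2)"
      proof -
        have "exp (x\<^sup>2 / (2 * real n)) ^ n = exp (real n * (x\<^sup>2 / (2 * real n)))"
          by (simp only: exp_of_nat_mult)
        also have "real n * (x\<^sup>2 / (2 * real n)) = x\<^sup>2 / 2" using n by simp
        finally show ?thesis by (simp only: power_mult_distrib)
      qed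
      finally have "exp (- (x\<^sup>2 / 2)) * (1 + x\<^sup>2) ^ n \<le> exp (- (x\<^sup>2 / 2)) * ((2 * real n) ^ n * exp (x\<^sup>2 / 2))"
        by (intro mult_left_mono) auto
      also have "\<dots> = (2 * real n) ^ n" by (simp add: exp_minus)
      finally have "cmod (gauss x) \<le> (2 * real n) ^ n * wt (- int n) x"
        by (simp add: wt_minus wt_of_nat gauss_def field_simps)
      also have "\<dots> \<le> (2 * real n) ^ n * wt p x"
        by (intro mult_left_mono wt_mono) (auto simp: n_def)
      finally show ?thesis .
    qed
    then show ?case by (auto simp: dbound_def)
  next
    case (Suc m)
    \<comment> \<open>The derivative carries the factor -x, which costs one power of the weight;
      hence the exponent p - 1 and an induction over all p.\<close>
    obtain A B where A: "dbound m (p - 1) A gauss" and B: "dbound m p B gauss"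
      using Suc by blast
    from dbound_mult[OF C_infinity_linear gauss_smooth dbound_linear A, of "-1"]
    have "dbound m p (2 ^ m * A) (dv gauss)" by (simp add: dv_gauss)
    then have "dbound m p (max B (2 ^ m * A)) (dv gauss)" by (rule dbound_mono) auto
    moreover have "dbound m p (max B (2 ^ m * A)) gauss"
      by (rule dbound_mono[OF B]) auto
    then have "cmod (gauss x) \<le> max B (2 ^ m * A) * wt p x" for x
      by (rule dboundD0)
    ultimately show ?case by (auto simp: dbound_Suc)
  qed
  then show ?thesis using gauss_smooth by (simp add: schwartz_iff)
qed

text \<open>Up to the normalisation of the density this is the characteristic function of the
  standard normal distribution at -\<xi>.\<close>

lemma fourier_gauss: "fourier gauss \<xi> = of_real (sqrt (2 * pi)) * gauss \<xi>"
proof -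
  have "char std_normal_distribution (- \<xi>) = (LINT x|lborel. std_normal_density x *\<^sub>R iexp (- \<xi> * x))"
    unfolding char_def by (subst integral_density) auto
  also have "\<dots> = (LINT x|lborel. of_real (1 / sqrt (2 * pi)) * (ce \<xi> x * gauss x))"
    by (intro Bochner_Integration.integral_cong refl)
      (simp add: ce_def cis_conv_exp gauss_def std_normal_density_def scaleR_conv_of_real mult_ac)
  also have "\<dots> = of_real (1 / sqrt (2 * pi)) * fourier gauss \<xi>"
    by (simp add: fourier_ce)
  finally show ?thesis
    by (simp add: char_std_normal_distribution gauss_def field_simps)
qed

lemma fourier_scale:
  assumes "0 < \<epsilon>"
  shows "fourier (\<lambda>x. f (\<epsilon> * x)) \<xi> = of_real (inverse \<epsilon>) * fourier f (\<xi> / \<epsilon>)"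
  unfolding fourier_ce
  using assms lborel_integral_real_affine[of "\<epsilon>" "\<lambda>x. ce (\<xi> / \<epsilon>) x * f x" 0]
  by (simp add: ce_def scaleR_conv_of_real)

text \<open>Regularisation by a dilated Gaussian: the exchange formula moves the dilation to f, and
  both sides converge by domination as \<epsilon> tends to 0. The factor 2 pi is sqrt(2 pi) twice,
  from \<open>fourier_gauss\<close> and from the integral of \<open>gauss\<close>. Translation then
  gives the other points.\<close>

lemma fourier_inversion_0:
  assumes "f \<in> schwartz"
  shows "(LINT \<xi>|lborel. fourier f \<xi>) = of_real (2 * pi) * f 0"
proof -
  define \<epsilon> :: "nat \<Rightarrow> real" where "\<epsilon> n = inverse (real (Suc n))" for n
  have \<epsilon>: "\<epsilon> n > 0" for n by (simp add: \<epsilon>_def)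
  have lim: "\<epsilon> \<longlonglongrightarrow> 0" unfolding \<epsilon>_def by (rule LIMSEQ_inverse_real_of_nat)
  note F = fourier_schwartz[OF assms]
  note cont = C_infinity_continuous[OF schwartz_smooth[OF assms], of UNIV]
  note contg = C_infinity_continuous[OF schwartz_smooth[OF gauss_schwartz], of UNIV]
  have [measurable]: "f \<in> borel_measurable borel" "gauss \<in> borel_measurable borel"
    "fourier f \<in> borel_measurable borel"
    using assms F gauss_schwartz by (auto intro!: C_infinity_measurable schwartz_smooth)
  have g1: "cmod (gauss x) \<le> 1" for x by (simp add: gauss_def)
  obtain A where A: "\<And>x. cmod (f x) \<le> A * wt 0 x" using schwartz_wt_bound[OF assms] by blast
  have eq: "(LINT \<xi>|lborel. gauss (\<epsilon> n * \<xi>) * fourier f \<xi>) =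
      (LINT y|lborel. fourier gauss y * f (\<epsilon> n * y))" for n
  proof -
    have "(LINT y|lborel. fourier gauss y * f (\<epsilon> n * y)) = (LINT \<xi>|lborel. gauss \<xi> * fourier (\<lambda>x. f (\<epsilon> n * x)) \<xi>)"
      using schwartz_affine[OF assms, of "\<epsilon> n" 0] \<epsilon>[of n]
      by (intro integral_fourier_exchange[symmetric] schwartz_integrable gauss_schwartz) auto
    also have "\<dots> = (LINT \<xi>|lborel. of_real (inverse (\<epsilon> n)) * (gauss \<xi> * fourier f (\<xi> / \<epsilon> n)))"
      by (simp only: fourier_scale[OF \<epsilon>] mult.left_commute)
    also have "\<dots> = (LINT \<xi>|lborel. gauss (\<epsilon> n * \<xi>) * fourier f \<xi>)"
      using lborel_integral_real_affine[of "\<epsilon> n" "\<lambda>\<xi>. of_real (inverse (\<epsilon> n)) * (gauss \<xi> * fourier f (\<xi> / \<epsilon> n))" 0] \<epsilon>[of n]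
      by (simp add: scaleR_conv_of_real)
    finally show ?thesis by simp
  qed
  have conv: "(\<lambda>n. g (\<epsilon> n * x)) \<longlonglongrightarrow> g 0" if "continuous_on UNIV g" for g :: "real \<Rightarrow> complex" and x
  proof -
    have "(\<lambda>n. \<epsilon> n * x) \<longlonglongrightarrow> 0 * x" by (intro tendsto_intros lim)
    then show ?thesis using that by (intro isCont_tendsto_compose[of 0 g]) (auto simp: continuous_on_eq_continuous_at)
  qed
  have "(\<lambda>n. LINT \<xi>|lborel. gauss (\<epsilon> n * \<xi>) * fourier f \<xi>) \<longlonglongrightarrow> (LINT \<xi>|lborel. gauss 0 * fourier f \<xi>)"
  proof (rule integral_dominated_convergence[where w = "\<lambda>\<xi>. cmod (fourier f \<xi>)"])
    show "AE \<xi> in lborel. (\<lambda>n. gauss (\<epsilon> n * \<xi>) * fourier f \<xi>) \<longlonglongrightarrow> gauss 0 * fourier f \<xi>"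
      by (intro AE_I2 tendsto_mult conv contg tendsto_const)
    show "AE \<xi> in lborel. cmod (gauss (\<epsilon> n * \<xi>) * fourier f \<xi>) \<le> cmod (fourier f \<xi>)" for n
      using g1 by (auto simp: norm_mult intro!: mult_left_le_one_le)
  qed (use schwartz_integrable[OF F] in auto)
  moreover have "(\<lambda>n. LINT y|lborel. fourier gauss y * f (\<epsilon> n * y)) \<longlonglongrightarrow> (LINT y|lborel. fourier gauss y * f 0)"
  proof (rule integral_dominated_convergence[where w = "\<lambda>y. cmod (fourier gauss y) * A"])
    show "AE y in lborel. (\<lambda>n. fourier gauss y * f (\<epsilon> n * y)) \<longlonglongrightarrow> fourier gauss y * f 0"
      by (intro AE_I2 tendsto_mult conv cont tendsto_const)
    show "AE y in lborel. cmod (fourier gauss y * f (\<epsilon> n * y)) \<le> cmod (fourier gauss y) * A" for n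
      using A by (auto simp: norm_mult intro!: mult_left_mono)
  qed (use schwartz_integrable[OF fourier_schwartz[OF gauss_schwartz]] in auto)
  ultimately have "(LINT \<xi>|lborel. gauss 0 * fourier f \<xi>) = (LINT y|lborel. fourier gauss y * f 0)"
    unfolding eq by (rule LIMSEQ_unique)
  also have "\<dots> = of_real (sqrt (2 * pi)) * ((LINT y|lborel. gauss y) * f 0)"
    using schwartz_integrable[OF gauss_schwartz] by (simp add: fourier_gauss mult.assoc)
  also have "(LINT y|lborel. gauss y) = of_real (sqrt (2 * pi))"
    using fourier_gauss[of 0] by (simp add: fourier_ce gauss_def)
  finally show ?thesis
    by (simp add: gauss_def mult.assoc[symmetric] flip: of_real_mult)
qed

lemma fourier_translate: "fourier (\<lambda>y. f (y - a)) \<xi> = ce \<xi> a * fourier f \<xi>"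
  unfolding fourier_ce
  using lborel_integral_real_affine[of 1 "\<lambda>y. ce \<xi> y * f (y - a)" a]
  by (simp add: ce_add_right mult.assoc)

lemma fourier_inversion:
  assumes "f \<in> schwartz"
  shows "fourier (fourier f) x = of_real (2 * pi) * f (- x)"
  using fourier_inversion_0[OF schwartz_translate[OF assms, of x]]
  by (simp add: fourier_translate fourier_ce[of "fourier f"] ce_commute[of x])

lemma fourier_inj:
  assumes "f \<in> schwartz" "g \<in> schwartz" "fourier f = fourier g"
  shows "f = g"
proof
  fix x show "f x = g x"
    using fourier_inversion[OF assms(1), of "- x"] fourier_inversion[OF assms(2), of "- x"] assms(3) by simp
qed

lemma fourier_surj:
  assumes "f \<in> schwartz"
  obtains g where "g \<in> schwartz" "fourier g = f"
proof
  let ?g = "\<lambda>x. of_real (inverse (2 * pi)) * fourier f (- x)"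
  show "?g \<in> schwartz"
    using assms by (intro schwartz_cmult schwartz_reflect fourier_schwartz)
  show "fourier ?g = f"
  proof
    fix \<xi>
    have "fourier ?g \<xi> = of_real (inverse (2 * pi)) * fourier (\<lambda>x. fourier f (- x)) \<xi>"
      by (simp add: fourier_ce[of _ \<xi>] mult.left_commute)
    also have "fourier (\<lambda>x. fourier f (- x)) \<xi> = fourier (fourier f) (- \<xi>)"
      using lborel_integral_real_affine[of "-1" "\<lambda>x. ce \<xi> x * fourier f (- x)" 0]
      by (simp add: fourier_ce[of _ \<xi>] fourier_ce[of _ "- \<xi>"] ce_minus)
    finally show "fourier ?g \<xi> = f \<xi>"
      by (simp add: fourier_inversion[OF assms])
  qed
qed

section \<open>Fourier multipliers on the Schwartz space\<close>

text \<open>The inverse transform is expressed by \<open>fourier\<close> at -x, so a single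
  transform and a single inversion formula suffice.\<close>

definition fmult :: "(real \<Rightarrow> complex) \<Rightarrow> (real \<Rightarrow> complex) \<Rightarrow> real \<Rightarrow> complex" where
  "fmult h f x = of_real (inverse (2 * pi)) * fourier (\<lambda>\<xi>. h \<xi> * fourier f \<xi>) (- x)"

lemma fmult_schwartz: "h \<in> OM \<Longrightarrow> f \<in> schwartz \<Longrightarrow> fmult h f \<in> schwartz"
  unfolding fmult_def[abs_def]
  by (intro schwartz_cmult schwartz_reflect fourier_schwartz schwartz_OM_mult)

lemma fourier_fmult:
  assumes "h \<in> OM" "f \<in> schwartz"
  shows "fourier (fmult h f) = (\<lambda>\<xi>. h \<xi> * fourier f \<xi>)"
proof -
  obtain g where g: "g \<in> schwartz" "fourier g = (\<lambda>\<xi>. h \<xi> * fourier f \<xi>)"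
    using fourier_surj schwartz_OM_mult[OF assms(1) fourier_schwartz[OF assms(2)]] by blast
  have "fmult h f x = g x" for x
    unfolding fmult_def g(2)[symmetric] by (simp add: fourier_inversion[OF g(1)])
  then have "fmult h f = g" ..
  with g(2) show ?thesis by (simp only:)
qed

text \<open>Since the transform is injective on Schwartz functions, every algebraic law of
  multipliers becomes a pointwise identity of symbols.\<close>

lemma fmult_eqI:
  assumes "h \<in> OM" "f \<in> schwartz" "g \<in> schwartz" "\<And>\<xi>. fourier g \<xi> = h \<xi> * fourier f \<xi>"
  shows "fmult h f = g"
  by (rule fourier_inj[OF fmult_schwartz]) (auto simp: fourier_fmult assms)

lemma fourier_add: "f \<in> schwartz \<Longrightarrow> g \<in> schwartz \<Longrightarrow> fourier (\<lambda>x. f x + g x) \<xi> = fourier f \<xi> + fourier g \<xi>"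
  using integrable_ce[OF schwartz_integrable, of _ "\<lambda>x. x"] by (simp add: fourier_ce distrib_left)

lemma fourier_cmult: "fourier (\<lambda>x. c * f x) \<xi> = c * fourier f \<xi>"
  by (simp add: fourier_ce mult.left_commute)

lemma fourier_diff:
  "f \<in> schwartz \<Longrightarrow> g \<in> schwartz \<Longrightarrow> fourier (\<lambda>x. f x - g x) \<xi> = fourier f \<xi> - fourier g \<xi>"
  using fourier_add[of f "\<lambda>x. -1 * g x" \<xi>] fourier_cmult[of "-1" g \<xi>] schwartz_cmult[of g "-1"] by simp

lemma fmult_add:
  "h \<in> OM \<Longrightarrow> f \<in> schwartz \<Longrightarrow> g \<in> schwartz \<Longrightarrow> fmult h (\<lambda>x. f x + g x) = (\<lambda>x. fmult h f x + fmult h g x)"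
  by (rule fmult_eqI) (auto simp: fourier_add fourier_fmult fmult_schwartz schwartz_cmult algebra_simps intro: schwartz_add fmult_schwartz)

lemma fmult_cmult:
  "h \<in> OM \<Longrightarrow> f \<in> schwartz \<Longrightarrow> fmult h (\<lambda>x. c * f x) = (\<lambda>x. c * fmult h f x)"
  by (rule fmult_eqI) (auto simp: fourier_cmult fourier_fmult fmult_schwartz schwartz_cmult algebra_simps intro: schwartz_cmult fmult_schwartz)

lemma fmult_diff:
  "h \<in> OM \<Longrightarrow> f \<in> schwartz \<Longrightarrow> g \<in> schwartz \<Longrightarrow> fmult h (\<lambda>x. f x - g x) = (\<lambda>x. fmult h f x - fmult h g x)"
  by (rule fmult_eqI) (auto simp: fourier_diff fourier_fmult fmult_schwartz schwartz_cmult algebra_simps intro: schwartz_diff fmult_schwartz)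

lemma fmult_mult:
  "h \<in> OM \<Longrightarrow> k \<in> OM \<Longrightarrow> f \<in> schwartz \<Longrightarrow> fmult h (fmult k f) = fmult (\<lambda>\<xi>. h \<xi> * k \<xi>) f"
  by (rule fmult_eqI) (auto simp: fourier_fmult OM_mult fmult_schwartz mult.assoc)

lemma fmult_one: "f \<in> schwartz \<Longrightarrow> fmult (\<lambda>\<xi>. 1) f = f"
  by (rule fmult_eqI[OF OM_const]) auto

lemma fmult_shift:
  "h \<in> OM \<Longrightarrow> f \<in> schwartz \<Longrightarrow> fmult (\<lambda>\<xi>. l - h \<xi>) f = (\<lambda>x. l * f x - fmult h f x)"
  by (rule fmult_eqI)
    (auto simp: fourier_diff fourier_cmult fourier_fmult fmult_schwartz schwartz_cmult algebra_simps
      intro: schwartz_diff schwartz_cmult fmult_schwartz OM_diff OM_const)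

lemma fourier_nth_deriv_schwartz:
  "f \<in> schwartz \<Longrightarrow> fourier (nth_deriv i f) \<xi> = (\<i> * of_real \<xi>) ^ i * fourier f \<xi>"
  using schwartz_bound[of f i "-1"] fourier_nth_deriv[OF schwartz_smooth, of f i] by blast

lemma nth_deriv_fmult:
  "h \<in> OM \<Longrightarrow> f \<in> schwartz \<Longrightarrow> nth_deriv i (fmult h f) = fmult h (nth_deriv i f)"
  by (rule fmult_eqI[symmetric])
    (auto simp: fourier_nth_deriv_schwartz fourier_fmult fmult_schwartz intro: schwartz_nth_deriv fmult_schwartz)

text \<open>The reciprocal of the symbol of 1 + d/dx. Its squared modulus is the weight of exponent
  -1, so the power 2n supplies exactly the weight of exponent -n.\<close>

definition rc :: "real \<Rightarrow> complex" where
  "rc \<xi> = inverse (1 + \<i> * of_real \<xi>)"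

lemma one_plus_i_nz: "1 + \<i> * complex_of_real \<xi> \<noteq> 0"
  by (simp add: complex_eq_iff)

lemma rc_vderiv: "(rc has_vector_derivative - \<i> * (rc \<xi> * rc \<xi>)) (at \<xi>)"
proof -
  have "((\<lambda>\<xi>. 1 + \<i> * complex_of_real \<xi>) has_vector_derivative 0 + \<i> * 1) (at \<xi>)"
    by (intro has_vector_derivative_add has_vector_derivative_mult_right
        has_vector_derivative_complex_of_real has_vector_derivative_const)
  from has_vector_derivative_inverse_complex[OF this one_plus_i_nz]
  show ?thesis by (simp add: rc_def[abs_def])
qed

lemma rc_power_vderiv: "((\<lambda>\<xi>. rc \<xi> ^ n) has_vector_derivative - \<i> * of_nat n * rc \<xi> ^ Suc n) (at \<xi>)"
proof (induction n)
  case (Suc n)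
  from has_vector_derivative_mult[OF rc_vderiv Suc]
  show ?case by (simp add: algebra_simps)
qed simp

lemma rc_power_nth_deriv:
  shows "(\<lambda>\<xi>. rc \<xi> ^ n) \<in> C_infinity"
    "nth_deriv i (\<lambda>\<xi>. rc \<xi> ^ n) = (\<lambda>\<xi>. (- \<i>) ^ i * pochhammer (of_nat n) i * rc \<xi> ^ (n + i))"
proof -
  let ?F = "\<lambda>i \<xi>. (- \<i>) ^ i * pochhammer (of_nat n) i * rc \<xi> ^ (n + i)"
  have "(?F i has_vector_derivative ?F (Suc i) \<xi>) (at \<xi>)" for i \<xi>
    using has_vector_derivative_mult_right[OF rc_power_vderiv[of "n + i" \<xi>], of "(- \<i>) ^ i * pochhammer (of_nat n) i"]
    by (simp add: pochhammer_Suc algebra_simps)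
  from nth_deriv_eqI[of ?F, OF this] show "(\<lambda>\<xi>. rc \<xi> ^ n) \<in> C_infinity"
    "nth_deriv i (\<lambda>\<xi>. rc \<xi> ^ n) = ?F i" by simp_all
qed

lemma norm_rc: "cmod (rc \<xi>) ^ 2 = wt (-1) \<xi>"
  by (simp add: rc_def norm_inverse power_inverse cmod_power2 wt_def power_int_minus)

lemma norm_rc_le_1: "cmod (rc \<xi>) \<le> 1"
proof -
  have "cmod (rc \<xi>) ^ 2 \<le> 1 ^ 2" unfolding norm_rc using wt_mono[of "-1" 0 \<xi>] by simp
  then show ?thesis by (rule power2_le_imp_le) simp
qed

lemma wt_minus_of_nat: "wt (-1) \<xi> ^ n = wt (- int n) \<xi>"
  by (simp add: wt_minus wt_of_nat wt_1 power_inverse)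

text \<open>A derivative only raises the power of \<open>rc\<close>, up to a Pochhammer factor, and
  \<open>rc\<close> has modulus at most 1; so no decay is lost. The sum of these factors serves all
  orders up to m.\<close>

lemma dbound_rc_power: "\<exists>C. dbound m (- int n) C (\<lambda>\<xi>. rc \<xi> ^ (2 * n))"
proof -
  let ?C = "\<Sum>i\<le>m. pochhammer (real (2 * n)) i"
  have "cmod (nth_deriv i (\<lambda>\<xi>. rc \<xi> ^ (2 * n)) \<xi>) \<le> ?C * wt (- int n) \<xi>" if "i \<le> m" for i \<xi>
  proof -
    have p: "0 \<le> pochhammer (real (2 * n)) j" for j by (induction j) (auto simp: pochhammer_Suc)
    have "cmod (nth_deriv i (\<lambda>\<xi>. rc \<xi> ^ (2 * n)) \<xi>) = pochhammer (real (2 * n)) i * cmod (rc \<xi>) ^ (2 * n + i)"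
    proof -
      have "pochhammer (of_nat (2 * n) :: complex) i = of_real (pochhammer (real (2 * n)) i)"
        by (metis pochhammer_of_real of_real_of_nat_eq)
      then show ?thesis
        unfolding rc_power_nth_deriv(2) norm_mult norm_power using p[of i]
        by (simp only: norm_of_real) (simp add: norm_power)
    qed
    also have "\<dots> \<le> pochhammer (real (2 * n)) i * cmod (rc \<xi>) ^ (2 * n)"
      by (intro mult_left_mono power_decreasing p norm_rc_le_1) auto
    also have "cmod (rc \<xi>) ^ (2 * n) = wt (- int n) \<xi>"
      by (simp add: power_mult norm_rc wt_minus_of_nat)
    also have "pochhammer (real (2 * n)) i \<le> ?C"
      using that p by (intro member_le_sum) auto
    finally show ?thesis by simp
  qed
  then show ?thesis unfolding dbound_def by blast
qed

definition one_plus_dv :: "(real \<Rightarrow> complex) \<Rightarrow> real \<Rightarrow> complex" where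
  "one_plus_dv f x = f x + dv f x"

text \<open>The counterpart of dividing the symbol by a power of 1 + i\<xi>: each application uses
  up one derivative of f and doubles the bound.\<close>

lemma one_plus_dv_power:
  assumes "f \<in> schwartz" "dbound (m + K) p A f"
  shows "(one_plus_dv ^^ K) f \<in> schwartz"
    "dbound m p (2 ^ K * A) ((one_plus_dv ^^ K) f)"
    "fourier ((one_plus_dv ^^ K) f) \<xi> = (1 + \<i> * of_real \<xi>) ^ K * fourier f \<xi>"
proof -
  have "(one_plus_dv ^^ K) f \<in> schwartz \<and> dbound m p (2 ^ K * A) ((one_plus_dv ^^ K) f)
    \<and> fourier ((one_plus_dv ^^ K) f) \<xi> = (1 + \<i> * of_real \<xi>) ^ K * fourier f \<xi>"
    using assms(2)
  proof (induction K arbitrary: m)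
    case 0
    then show ?case using assms by simp
  next
    case (Suc K)
    let ?g = "(one_plus_dv ^^ K) f"
    from Suc have g: "?g \<in> schwartz" "dbound (Suc m) p (2 ^ K * A) ?g"
      "fourier ?g \<xi> = (1 + \<i> * of_real \<xi>) ^ K * fourier f \<xi>" by (metis add_Suc_shift)+
    have "dbound m p (2 ^ K * A + 2 ^ K * A) (\<lambda>x. ?g x + dv ?g x)"
      using g by (intro dbound_add C_infinity_dv schwartz_smooth dbound_mono[OF g(2)]) (auto simp: dbound_Suc)
    moreover have "fourier (\<lambda>x. ?g x + dv ?g x) \<xi> = (1 + \<i> * of_real \<xi>) * fourier ?g \<xi>"
      using g(1) fourier_nth_deriv_schwartz[OF g(1), of 1]
      by (simp add: fourier_add schwartz_dv nth_deriv_Suc algebra_simps)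
    ultimately show ?case
      using g by (simp add: one_plus_dv_def[abs_def] schwartz_add schwartz_dv mult_ac)
  qed
  then show "(one_plus_dv ^^ K) f \<in> schwartz" "dbound m p (2 ^ K * A) ((one_plus_dv ^^ K) f)"
    "fourier ((one_plus_dv ^^ K) f) \<xi> = (1 + \<i> * of_real \<xi>) ^ K * fourier f \<xi>" by auto
qed

text \<open>With \<open>h \<xi> = k \<xi> * (1 + \<i> \<xi>) ^ K\<close> the multiplier becomes convolution of \<open>(1 + d/dx) ^ K f\<close>
  with the rapidly decreasing Fourier transform of \<open>k\<close>, which respects all polynomial weights.\<close>

lemma fmult_bound:
  fixes p :: int and B :: real
  assumes "0 \<le> q"
  shows "\<exists>C\<ge>0. \<forall>h\<in>OM. dbound (2 * Suc (nat \<bar>p\<bar>)) q B h \<longrightarrow>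
    (\<forall>f\<in>schwartz. \<forall>A. dbound (2 * Suc (nat q)) p A f \<longrightarrow> (\<forall>x. cmod (fmult h f x) \<le> C * A * wt p x))"
proof -
  \<comment> \<open>The kernel decays with exponent -a; Peetre's inequality consumes |p| of it and
    leaves -1 for integrability. By \<open>fourier_decay\<close> this takes 2a derivatives of the
    symbol.\<close>
  define a where "a = Suc (nat \<bar>p\<bar>)"
  \<comment> \<open>This power of \<open>rc\<close> has weight exponent -(q + 1), so its product
    with a symbol of growth q has exponent -1.\<close>
  define K where "K = 2 * Suc (nat q)"
  obtain D where D: "dbound (2 * a) (- int (Suc (nat q))) D (\<lambda>\<xi>. rc \<xi> ^ K)"
    unfolding K_def using dbound_rc_power by blast
  \<comment> \<open>B is an arbitrary real number; its absolute value keeps E, and with it C,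
    nonnegative.\<close>
  define E where "E = 2 ^ (2 * a) * \<bar>B\<bar> * D"
  \<comment> \<open>The factors come from \<open>fmult\<close>, from the decay of the transform of
    k, from (1 + d/dx)^K, from Peetre's inequality and from the final integral.\<close>
  define C where "C = inverse (2 * pi) * (2 ^ Suc a * (E * pi) * (2 ^ K * 2 ^ nat \<bar>p\<bar>)) * pi"
  have D0: "0 \<le> D" by (rule dbound_nonneg[OF D])
  have E0: "0 \<le> E" using D0 by (simp add: E_def)
  have C0: "0 \<le> C" using E0 by (simp add: C_def)
  have "cmod (fmult h f x) \<le> C * A * wt p x"
    if h: "h \<in> OM" "dbound (2 * a) q B h" and f: "f \<in> schwartz" "dbound K p A f" for h f A x
  proof -
    define k where "k = (\<lambda>\<xi>. h \<xi> * rc \<xi> ^ K)"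
    define u where "u = (one_plus_dv ^^ K) f"
    have A0: "0 \<le> A" by (rule dbound_nonneg[OF f(2)])
    have k: "k \<in> C_infinity"
      unfolding k_def using h by (intro C_infinity_mult OM_smooth rc_power_nth_deriv(1))
    have "dbound (2 * a) (q + (- int (Suc (nat q)))) (2 ^ (2 * a) * B * D) k"
      unfolding k_def using h D by (intro dbound_mult OM_smooth rc_power_nth_deriv(1))
    then have kb: "dbound (2 * a) (-1) E k"
      by (rule dbound_mono) (use assms D0 in \<open>auto simp: E_def intro!: mult_right_mono mult_left_mono\<close>)
    have u: "u \<in> schwartz" "cmod (u y) \<le> 2 ^ K * A * wt p y"
      "fourier u \<xi> = (1 + \<i> * of_real \<xi>) ^ K * fourier f \<xi>" for y \<xi>
      unfolding u_def using one_plus_dv_power[of f 0 K p A, OF f(1)] f(2) dboundD0 by auto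
    have [measurable]: "u \<in> borel_measurable borel" "k \<in> borel_measurable borel"
      using u k by (auto intro: C_infinity_measurable schwartz_smooth)
    have kint: "integrable lborel k"
      by (rule integrable_wt_bound) (use dboundD0[OF kb] in auto)
    have hk: "h \<xi> * fourier f \<xi> = k \<xi> * fourier u \<xi>" for \<xi>
    proof -
      have "rc \<xi> ^ K * (1 + \<i> * of_real \<xi>) ^ K = 1"
        by (simp add: rc_def one_plus_i_nz flip: power_mult_distrib)
      then show ?thesis by (simp add: k_def u(3) mult.assoc flip: mult.assoc[of "rc \<xi> ^ K"])
    qed
    \<comment> \<open>The character is absorbed into k before the exchange; its transform is thereby
      shifted by x, and a convolution with u appears.\<close>
    have "fmult h f x = of_real (inverse (2 * pi)) * (LINT \<xi>|lborel. (ce (- x) \<xi> * k \<xi>) * fourier u \<xi>)"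
      by (simp only: fmult_def hk fourier_ce[of "\<lambda>\<xi>. k \<xi> * fourier u \<xi>"] mult.assoc)
    also have "(LINT \<xi>|lborel. (ce (- x) \<xi> * k \<xi>) * fourier u \<xi>)
        = (LINT y|lborel. fourier (\<lambda>\<xi>. ce (- x) \<xi> * k \<xi>) y * u y)"
      using schwartz_integrable[OF u(1)] by (intro integral_fourier_exchange integrable_ce kint) auto
    also have "\<dots> = (LINT y|lborel. fourier k (y - x) * u y)"
    proof (intro Bochner_Integration.integral_cong refl)
      fix y
      have "ce y \<xi> * (ce (- x) \<xi> * k \<xi>) = ce (y - x) \<xi> * k \<xi>" for \<xi>
        using ce_add[of y "- x" \<xi>] by (simp add: mult.assoc)
      then show "fourier (\<lambda>\<xi>. ce (- x) \<xi> * k \<xi>) y * u y = fourier k (y - x) * u y"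
        by (simp only: fourier_ce)
    qed
    also have "\<dots> = (LINT z|lborel. fourier k z * u (x + z))"
      using lborel_integral_real_affine[of 1 "\<lambda>y. fourier k (y - x) * u y" x] by simp
    finally have eq: "fmult h f x = of_real (inverse (2 * pi)) * (LINT z|lborel. fourier k z * u (x + z))" .
    have "cmod (LINT z|lborel. fourier k z * u (x + z)) \<le>
        (2 ^ Suc a * (E * pi) * (2 ^ K * 2 ^ nat \<bar>p\<bar>) * A * wt p x) * pi"
    proof (rule norm_integral_wt_bound)
      show "(\<lambda>z. fourier k z * u (x + z)) \<in> borel_measurable borel"
        unfolding fourier_ce by measurable
      fix z
      have "cmod (fourier k z * u (x + z)) \<le> (2 ^ Suc a * (E * pi) * wt (- int a) z) * (2 ^ K * A * wt p (x + z))"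
        unfolding norm_mult by (intro mult_mono fourier_decay k kb u) (use E0 in auto)
      also have "\<dots> \<le> (2 ^ Suc a * (E * pi) * wt (- int a) z) * (2 ^ K * A * (2 ^ nat \<bar>p\<bar> * wt p x * wt \<bar>p\<bar> z))"
        using peetre[of p "x + z" x] E0 A0 by (intro mult_left_mono) auto
      also have "\<dots> = 2 ^ Suc a * (E * pi) * (2 ^ K * 2 ^ nat \<bar>p\<bar>) * A * wt p x * (wt (- int a) z * wt \<bar>p\<bar> z)"
        by (simp add: mult_ac)
      also have "wt (- int a) z * wt \<bar>p\<bar> z = wt (-1) z"
        by (simp add: a_def flip: wt_add)
      finally show "cmod (fourier k z * u (x + z)) \<le> 2 ^ Suc a * (E * pi) * (2 ^ K * 2 ^ nat \<bar>p\<bar>) * A * wt p x * wt (-1) z" .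
    qed
    then have "cmod (fmult h f x) \<le> inverse (2 * pi) * ((2 ^ Suc a * (E * pi) * (2 ^ K * 2 ^ nat \<bar>p\<bar>) * A * wt p x) * pi)"
      unfolding eq norm_mult by (intro mult_mono) (auto simp: norm_inverse norm_mult)
    then show ?thesis by (simp add: C_def mult_ac)
  qed
  then show ?thesis using C0 unfolding a_def K_def by blast
qed

text \<open>Multipliers commute with d/dx, so the pointwise bound applies to each derivative. The
  constant therefore depends neither on m nor on the symbol.\<close>

lemma fmult_dbound:
  fixes p :: int and B :: real
  assumes "0 \<le> q"
  shows "\<exists>C\<ge>0. \<forall>h\<in>OM. dbound (2 * Suc (nat \<bar>p\<bar>)) q B h \<longrightarrow>
    (\<forall>f\<in>schwartz. \<forall>m A. dbound (m + 2 * Suc (nat q)) p A f \<longrightarrow> dbound m p (C * A) (fmult h f))"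
proof -
  let ?K = "2 * Suc (nat q)"
  obtain C where C: "C \<ge> 0" "\<And>h f A x. h \<in> OM \<Longrightarrow> dbound (2 * Suc (nat \<bar>p\<bar>)) q B h \<Longrightarrow> f \<in> schwartz \<Longrightarrow>
      dbound ?K p A f \<Longrightarrow> cmod (fmult h f x) \<le> C * A * wt p x"
    using fmult_bound[OF assms, of p B] by blast
  have "dbound m p (C * A) (fmult h f)"
    if h: "h \<in> OM" "dbound (2 * Suc (nat \<bar>p\<bar>)) q B h" and f: "f \<in> schwartz" "dbound (m + ?K) p A f" for h f m A
    unfolding dbound_def nth_deriv_fmult[OF h(1) f(1)]
    using h f by (auto intro!: C schwartz_nth_deriv dbound_nth_deriv intro: dbound_mono[OF f(2)])
  then show ?thesis using C(1) by blast
qed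

section \<open>Fourier multipliers on \<open>O\<^sub>C\<close>\<close>

lemma OC_step_iff: "f \<in> OC_step n \<longleftrightarrow> f \<in> C_infinity \<and> (\<forall>m. \<exists>A. dbound m (int n) A f)"
proof -
  have "\<exists>A. dbound m (int n) A f" if "\<forall>m\<ge>1. \<exists>A. dbound m (int n) A f" for m
  proof -
    have "\<exists>A. dbound (max m 1) (int n) A f" using that by simp
    then obtain A where A: "dbound (max m 1) (int n) A f" by blast
    have "dbound m (int n) A f" by (rule dbound_mono[OF A]) auto
    then show ?thesis by blast
  qed
  then show ?thesis
    unfolding OC_step_def bdd_above_growth_values by auto
qed

lemma OC_step_smooth: "f \<in> OC_step n \<Longrightarrow> f \<in> C_infinity"
  by (simp add: OC_step_iff)

lemma OC_step_mono: "n \<le> n' \<Longrightarrow> OC_step n \<subseteq> OC_step n'"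
  unfolding OC_step_iff subset_iff by (meson dbound_mono of_nat_mono order_refl)

lemma OC_step_bound: "f \<in> OC_step n \<Longrightarrow> \<exists>A. dbound m (int n) A f"
  by (simp add: OC_step_iff)

lemma OC_step_imp_OM: "f \<in> OC_step n \<Longrightarrow> f \<in> OM"
  unfolding OC_step_iff OM_iff by (meson of_nat_0_le_iff)

lemma schwartz_OC_step: "f \<in> schwartz \<Longrightarrow> f \<in> OC_step n"
  by (simp add: schwartz_iff OC_step_iff)

lemma OC_step_add: "f \<in> OC_step n \<Longrightarrow> g \<in> OC_step n \<Longrightarrow> (\<lambda>x. f x + g x) \<in> OC_step n"
  unfolding OC_step_iff using C_infinity_add dbound_add by blast

lemma OC_step_cmult: "f \<in> OC_step n \<Longrightarrow> (\<lambda>x. c * f x) \<in> OC_step n"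
  unfolding OC_step_iff using C_infinity_cmult dbound_cmult by blast

lemma OC_step_diff: "f \<in> OC_step n \<Longrightarrow> g \<in> OC_step n \<Longrightarrow> (\<lambda>x. f x - g x) \<in> OC_step n"
  unfolding OC_step_iff using C_infinity_diff dbound_diff by blast

lemma OC_iff: "f \<in> OC \<longleftrightarrow> (\<exists>n\<ge>1. f \<in> OC_step n)"
  by (auto simp: OC_def)

lemma OC_step_OC: "f \<in> OC_step n \<Longrightarrow> f \<in> OC"
  using OC_step_mono[of n "Suc n"] by (auto simp: OC_iff intro!: exI[of _ "Suc n"])

lemma OC_common_step:
  assumes "f \<in> OC" "g \<in> OC"
  obtains n where "1 \<le> n" "f \<in> OC_step n" "g \<in> OC_step n"
proof -
  obtain n n' where "n \<ge> 1" "f \<in> OC_step n" "g \<in> OC_step n'"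
    using assms by (auto simp: OC_iff)
  then show thesis
    using OC_step_mono[of n "max n n'"] OC_step_mono[of n' "max n n'"]
    by (intro that[of "max n n'"]) auto
qed

section \<open>Truncation by dilated Gaussians\<close>

lemma nth_deriv_const: "nth_deriv (Suc i) (\<lambda>x. c) = (\<lambda>x. 0)"
  by (induction i arbitrary: c) (simp_all add: nth_deriv_Suc')

text \<open>Approximation is carried with the explicit rate 1 / (j + 1): such a rate survives every
  bounded linear map, with only the constant changed.\<close>

lemma tendsto_of_rate:
  fixes a :: "nat \<Rightarrow> complex"
  assumes "\<And>j. cmod (a j - b) \<le> D / real (Suc j) * w"
  shows "a \<longlonglongrightarrow> b"
proof -
  have "(\<lambda>j. D * w * inverse (real (Suc j))) \<longlonglongrightarrow> D * w * 0"
    by (intro tendsto_intros LIMSEQ_inverse_real_of_nat)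
  then have "(\<lambda>j. D / real (Suc j) * w) \<longlonglongrightarrow> 0"
    by (simp add: divide_inverse mult_ac)
  from Lim_null_comparison[OF _ this, of "\<lambda>j. a j - b"] assms
  show ?thesis by (auto simp: LIM_zero_iff)
qed

text \<open>The argument of \<open>gauss\<close> has the shape \<open>a + b * x\<close> of \<open>nth_deriv_affine\<close>.\<close>

definition trunc :: "nat \<Rightarrow> (real \<Rightarrow> complex) \<Rightarrow> real \<Rightarrow> complex" where
  "trunc j f = (\<lambda>x. f x * gauss (0 + inverse (real (Suc j)) * x))"

lemma trunc_schwartz: "f \<in> OC_step n \<Longrightarrow> trunc j f \<in> schwartz"
  unfolding trunc_def
  by (intro schwartz_OM_mult[OF OC_step_imp_OM] schwartz_affine gauss_schwartz) auto

text \<open>The cut-off does not tend to 1 uniformly, but it does after one power of the weight is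
  given away: with e = 1 / (j + 1) the value differs from 1 by at most (ex)^2 / 2, and one factor e
  is kept. Derivatives carry a factor e by the chain rule. This is where the passage from n to n + 1
  originates.\<close>

lemma cutoff_error:
  "\<exists>c\<ge>0. \<forall>j. dbound m 1 (c / real (Suc j)) (\<lambda>x. gauss (0 + inverse (real (Suc j)) * x) - 1)"
proof -
  obtain A where A: "dbound m 0 A gauss" using schwartz_bound[OF gauss_schwartz] by blast
  have A0: "0 \<le> A" by (rule dbound_nonneg[OF A])
  have "dbound m 1 ((1 + A) / real (Suc j)) (\<lambda>x. gauss (0 + inverse (real (Suc j)) * x) - 1)" for j
  proof -
    define e where "e = inverse (real (Suc j))"
    have e: "0 < e" "e \<le> 1" by (simp_all add: e_def field_simps)
    have "cmod (nth_deriv i (\<lambda>x. gauss (0 + e * x) - 1) x) \<le> (1 + A) * e * wt 1 x" if "i \<le> m" for i x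
    proof -
      have eq: "nth_deriv i (\<lambda>x. gauss (0 + e * x) - 1) x = of_real (e ^ i) * nth_deriv i gauss (0 + e * x) - nth_deriv i (\<lambda>x. 1) x"
        by (simp only: nth_deriv_diff[OF nth_deriv_affine(1)[OF gauss_smooth] C_infinity_const] nth_deriv_affine(2)[OF gauss_smooth])
      show ?thesis
      proof (cases i)
        case 0
        define t where "t = (e * x)\<^sup>2 / 2"
        have "cmod (gauss (e * x) - 1) = 1 - exp (- t)"
        proof -
          have "exp (- t) \<le> 1" by (simp add: t_def)
          moreover have "gauss (e * x) - 1 = of_real (exp (- t) - 1)" by (simp add: gauss_def t_def)
          ultimately show ?thesis by (simp only: norm_of_real)
        qed
        also have "\<dots> \<le> t" using exp_ge_add_one_self[of "- t"] by simp
        also have "t \<le> e * e * x\<^sup>2" using e by (simp add: t_def power2_eq_square)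
        also have "\<dots> \<le> e * 1 * (1 + x\<^sup>2)" using e by (intro mult_mono) auto
        also have "\<dots> \<le> (1 + A) * e * wt 1 x" using e A0 by (simp add: wt_1 mult_right_mono)
        finally show ?thesis by (simp add: 0)
      next
        case (Suc k)
        have "cmod (nth_deriv i (\<lambda>x. gauss (0 + e * x) - 1) x) = e ^ i * cmod (nth_deriv i gauss (e * x))"
          unfolding eq using e by (simp add: Suc nth_deriv_const norm_mult norm_power)
        also have "\<dots> \<le> e * A"
          using e dboundD[OF A that, of "e * x"] power_le_one[of e k] by (intro mult_mono) (auto simp: Suc mult_left_le)
        also have "\<dots> \<le> e * (1 + A) * wt 1 x"
          using e A0 wt_ge_1[of 1 x] mult_mono[of "e * A" "e * (1 + A)" 1 "wt 1 x"] by simp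
        finally show ?thesis by (simp add: mult_ac)
      qed
    qed
    then show ?thesis by (simp add: dbound_def e_def divide_inverse)
  qed
  then show ?thesis using A0 by (intro exI[of _ "1 + A"]) auto
qed

text \<open>The constant c depends on the order m only; the bound is linear in A, so it also gives
  boundedness of the truncations uniformly in j.\<close>

lemma trunc_error:
  "\<exists>c\<ge>0. \<forall>j f p A. f \<in> C_infinity \<longrightarrow> dbound m p A f \<longrightarrow>
    dbound m (p + 1) (c * A / real (Suc j)) (\<lambda>x. trunc j f x - f x)"
proof -
  obtain c where c: "c \<ge> 0" "\<And>j. dbound m 1 (c / real (Suc j)) (\<lambda>x. gauss (0 + inverse (real (Suc j)) * x) - 1)"
    using cutoff_error by blast
  have "dbound m (p + 1) ((2 ^ m * c) * A / real (Suc j)) (\<lambda>x. trunc j f x - f x)"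
    if "f \<in> C_infinity" "dbound m p A f" for j f p A
    using dbound_mult[OF that(1) _ that(2) c(2)[of j]]
      C_infinity_diff[OF nth_deriv_affine(1)[OF gauss_smooth] C_infinity_const, of 0 "inverse (real (Suc j))" 1]
    by (simp add: trunc_def algebra_simps)
  then show ?thesis using c(1) by (intro exI[of _ "2 ^ m * c"]) auto
qed

text \<open>Completeness in a weighted scale, with the rate preserved in the limit. The pointwise
  limits of the derivatives form a chain as in \<open>nth_deriv_eqI\<close>.\<close>

lemma dbound_complete:
  fixes f :: "nat \<Rightarrow> real \<Rightarrow> complex"
  assumes sm: "\<And>j. f j \<in> C_infinity"
    and cauchy: "\<And>m. \<exists>D. \<forall>j l. dbound m p (D / real (Suc j) + D / real (Suc l)) (\<lambda>x. f j x - f l x)"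
  obtains F where "F \<in> C_infinity"
    "\<And>m. \<exists>D\<ge>0. \<forall>j. dbound m p (D / real (Suc j)) (\<lambda>x. f j x - F x)"
proof -
  obtain D where D: "\<And>m j l. dbound m p (D m / real (Suc j) + D m / real (Suc l)) (\<lambda>x. f j x - f l x)"
    using cauchy by metis
  have D0: "0 \<le> D m" for m
    using dbound_nonneg[OF D[of m 0 0]] by simp
  have bnd: "cmod (nth_deriv i (f j) x - nth_deriv i (f l) x) \<le> (D m / real (Suc j) + D m / real (Suc l)) * wt p x"
    if "i \<le> m" for i j l m x
    using dboundD[OF D that, of j l x] by (simp add: nth_deriv_diff sm)
  define G where "G i x = lim (\<lambda>l. nth_deriv i (f l) x)" for i x
  have lim0: "(\<lambda>l. c / real (Suc l)) \<longlonglongrightarrow> 0" for c :: real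
    using tendsto_mult[OF tendsto_const[of c] LIMSEQ_inverse_real_of_nat] by (simp add: divide_inverse)
  have conv: "(\<lambda>l. nth_deriv i (f l) x) \<longlonglongrightarrow> G i x" for i x
  proof -
    have "Cauchy (\<lambda>l. nth_deriv i (f l) x)"
    proof (rule metric_CauchyI)
      fix e :: real assume e: "0 < e"
      have "(\<lambda>l. D i / real (Suc l) * wt p x) \<longlonglongrightarrow> 0 * wt p x"
        by (intro tendsto_intros lim0)
      then have "\<forall>\<^sub>F l in sequentially. D i / real (Suc l) * wt p x < e / 2"
        using e by (intro order_tendstoD) auto
      then obtain N where N: "\<And>l. l \<ge> N \<Longrightarrow> D i / real (Suc l) * wt p x < e / 2"
        by (auto simp: eventually_sequentially)
      have "dist (nth_deriv i (f j) x) (nth_deriv i (f l) x) < e" if "j \<ge> N" "l \<ge> N" for j l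
        using bnd[of i i j x l] N[OF that(1)] N[OF that(2)] unfolding dist_norm distrib_right by linarith
      then show "\<exists>M. \<forall>m\<ge>M. \<forall>n\<ge>M. dist (nth_deriv i (f m) x) (nth_deriv i (f n) x) < e" by blast
    qed
    then show ?thesis
      unfolding G_def by (simp add: Cauchy_convergent_iff convergent_LIMSEQ_iff)
  qed
  \<comment> \<open>The Cauchy estimate with l sent to infinity; only the term with j
    survives.\<close>
  have bndG: "cmod (nth_deriv i (f j) x - G i x) \<le> D m / real (Suc j) * wt p x" if "i \<le> m" for i j m x
  proof (rule LIMSEQ_le)
    show "(\<lambda>l. cmod (nth_deriv i (f j) x - nth_deriv i (f l) x)) \<longlonglongrightarrow> cmod (nth_deriv i (f j) x - G i x)"
      by (intro tendsto_intros conv)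
    have "(\<lambda>l. (D m / real (Suc j) + D m / real (Suc l)) * wt p x) \<longlonglongrightarrow> (D m / real (Suc j) + 0) * wt p x"
      by (intro tendsto_intros lim0)
    then show "(\<lambda>l. (D m / real (Suc j) + D m / real (Suc l)) * wt p x) \<longlonglongrightarrow> D m / real (Suc j) * wt p x"
      by simp
    show "\<exists>N. \<forall>l\<ge>N. cmod (nth_deriv i (f j) x - nth_deriv i (f l) x) \<le> (D m / real (Suc j) + D m / real (Suc l)) * wt p x"
      using bnd[OF that] by blast
  qed
  have der: "(G i has_vector_derivative G (Suc i) x) (at x)" for i x
  proof -
    \<comment> \<open>The convergence is uniform only locally: the weight is bounded on a compact
      ball around x, which is enough to differentiate the limit.\<close>
    let ?S = "ball x 1"
    have "bounded (wt p ` cball x 1)"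
      by (intro compact_imp_bounded compact_continuous_image continuous_on_wt compact_cball)
    then obtain M where M: "\<And>y. y \<in> cball x 1 \<Longrightarrow> wt p y \<le> M"
      unfolding bounded_iff by (metis image_eqI abs_le_D1 real_norm_def)
    have "\<exists>g. \<forall>y\<in>?S. (\<lambda>j. nth_deriv i (f j) y) \<longlonglongrightarrow> g y \<and> (g has_derivative (\<lambda>h. h *\<^sub>R G (Suc i) y)) (at y within ?S)"
    proof (rule has_derivative_sequence[where f' = "\<lambda>j y h. h *\<^sub>R nth_deriv (Suc i) (f j) y" and ?x0.0 = x])
      show "(nth_deriv i (f j) has_derivative (\<lambda>h. h *\<^sub>R nth_deriv (Suc i) (f j) y)) (at y within ?S)" for j y
        using C_infinity_nth_vderiv[OF sm] has_derivative_at_withinI unfolding has_vector_derivative_def by blast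
      fix e :: real assume e: "0 < e"
      have "(\<lambda>j. D (Suc i) / real (Suc j) * M) \<longlonglongrightarrow> 0 * M"
        by (intro tendsto_intros lim0)
      then have "\<forall>\<^sub>F j in sequentially. D (Suc i) / real (Suc j) * M < e"
        using e by (intro order_tendstoD) auto
      then show "\<forall>\<^sub>F j in sequentially. \<forall>y\<in>?S. \<forall>h. norm (h *\<^sub>R nth_deriv (Suc i) (f j) y - h *\<^sub>R G (Suc i) y) \<le> e * norm h"
      proof (eventually_elim, intro ballI allI)
        fix j y h assume j: "D (Suc i) / real (Suc j) * M < e" and y: "y \<in> ?S"
        have "cmod (nth_deriv (Suc i) (f j) y - G (Suc i) y) \<le> D (Suc i) / real (Suc j) * wt p y"
          by (rule bndG) simp
        also have "\<dots> \<le> D (Suc i) / real (Suc j) * M"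
          using D0 M[of y] y by (intro mult_left_mono) auto
        finally have "cmod (nth_deriv (Suc i) (f j) y - G (Suc i) y) \<le> e" using j by simp
        then have "\<bar>h\<bar> * cmod (nth_deriv (Suc i) (f j) y - G (Suc i) y) \<le> \<bar>h\<bar> * e"
          by (intro mult_left_mono) auto
        then show "norm (h *\<^sub>R nth_deriv (Suc i) (f j) y - h *\<^sub>R G (Suc i) y) \<le> e * norm h"
          by (simp add: mult.commute flip: scaleR_diff_right)
      qed
    qed (use conv in auto)
    then obtain g where g: "\<And>y. y \<in> ?S \<Longrightarrow> (\<lambda>j. nth_deriv i (f j) y) \<longlonglongrightarrow> g y"
      "\<And>y. y \<in> ?S \<Longrightarrow> (g has_derivative (\<lambda>h. h *\<^sub>R G (Suc i) y)) (at y within ?S)" by blast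
    have "(g has_derivative (\<lambda>h. h *\<^sub>R G (Suc i) x)) (at x)"
      using g(2)[of x] by (simp add: at_within_open[of x ?S])
    then have "(G i has_derivative (\<lambda>h. h *\<^sub>R G (Suc i) x)) (at x)"
      by (rule has_derivative_transform_within_open[OF _ open_ball[of x 1]])
        (use LIMSEQ_unique[OF g(1) conv] in auto)
    then show ?thesis by (simp add: has_vector_derivative_def)
  qed
  from nth_deriv_eqI[of G, OF der] have G: "G 0 \<in> C_infinity" "\<And>i. nth_deriv i (G 0) = G i" by auto
  have "dbound m p (D m / real (Suc j)) (\<lambda>x. f j x - G 0 x)" for m j
    using bndG by (simp add: dbound_def nth_deriv_diff sm G)
  then show thesis using G(1) D0 by (intro that[of "G 0"]) auto
qed

text \<open>\<open>lim\<close> has an arbitrary value without convergence; for h in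
  \<open>OM\<close> and f in \<open>OC\<close> convergence is part of
  \<open>omult_rate\<close>.\<close>

definition omult :: "(real \<Rightarrow> complex) \<Rightarrow> (real \<Rightarrow> complex) \<Rightarrow> real \<Rightarrow> complex" where
  "omult h f x = lim (\<lambda>j. fmult h (trunc j f) x)"

lemma omult_eqI: "(\<And>x. (\<lambda>j. fmult h (trunc j f) x) \<longlonglongrightarrow> g x) \<Longrightarrow> omult h f = g"
  by (auto simp: omult_def limI)

lemma fmult_rate:
  assumes "h \<in> OM"
  shows "\<exists>K. \<forall>m. \<exists>C\<ge>0. \<forall>f\<in>schwartz. \<forall>A. dbound (m + K) p A f \<longrightarrow> dbound m p (C * A) (fmult h f)"
proof -
  obtain q B where q: "0 \<le> q" "dbound (2 * Suc (nat \<bar>p\<bar>)) q B h"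
    using assms OM_iff by metis
  show ?thesis using fmult_dbound[OF q(1), of p B] q(2) assms by blast
qed

text \<open>The truncations of f form a Cauchy sequence with weight n + 1, and the multiplier
  respects that weight up to a loss of derivatives, so completeness applies.\<close>

lemma omult_rate:
  assumes h: "h \<in> OM" and f: "f \<in> OC_step n"
  shows "omult h f \<in> C_infinity"
    "\<exists>D\<ge>0. \<forall>j. dbound m (int n + 1) (D / real (Suc j)) (\<lambda>x. fmult h (trunc j f) x - omult h f x)"
    "(\<lambda>j. fmult h (trunc j f) x) \<longlonglongrightarrow> omult h f x"
    "(\<lambda>j. nth_deriv i (fmult h (trunc j f)) x) \<longlonglongrightarrow> nth_deriv i (omult h f) x"
proof -
  let ?p = "int n + 1"
  note fS = trunc_schwartz[OF f]
  obtain K where K: "\<And>m. \<exists>C\<ge>0. \<forall>f\<in>schwartz. \<forall>A. dbound (m + K) ?p A f \<longrightarrow> dbound m ?p (C * A) (fmult h f)"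
    using fmult_rate[OF h] by metis
  have cauchy: "\<exists>D. \<forall>j l. dbound m ?p (D / real (Suc j) + D / real (Suc l)) (\<lambda>x. fmult h (trunc j f) x - fmult h (trunc l f) x)" for m
  proof -
    obtain C where C: "C \<ge> 0" "\<And>f A. f \<in> schwartz \<Longrightarrow> dbound (m + K) ?p A f \<Longrightarrow> dbound m ?p (C * A) (fmult h f)"
      using K by blast
    obtain A where A: "dbound (m + K) (int n) A f" using OC_step_bound[OF f] by blast
    obtain c where c: "\<And>j. dbound (m + K) ?p (c * A / real (Suc j)) (\<lambda>x. trunc j f x - f x)"
      using trunc_error[of "m + K"] OC_step_smooth[OF f] A by blast
    have "dbound m ?p (C * (c * A) / real (Suc j) + C * (c * A) / real (Suc l)) (\<lambda>x. fmult h (trunc j f) x - fmult h (trunc l f) x)" for j l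
    proof -
      \<comment> \<open>Each truncation is compared with f, but \<open>fmult\<close> is estimated
        only on the difference of two truncations: f itself need not be a Schwartz function.\<close>
      have "dbound (m + K) ?p (c * A / real (Suc j) + c * A / real (Suc l))
          (\<lambda>x. (trunc j f x - f x) - (trunc l f x - f x))"
        by (intro dbound_diff c C_infinity_diff schwartz_smooth fS OC_step_smooth[OF f])
      then have "dbound (m + K) ?p (c * A / real (Suc j) + c * A / real (Suc l)) (\<lambda>x. trunc j f x - trunc l f x)"
        by simp
      from C(2)[OF schwartz_diff[OF fS fS] this] show ?thesis
        using h fS by (simp add: fmult_diff distrib_left)
    qed
    then show ?thesis by blast
  qed
  obtain F where F: "F \<in> C_infinity" "\<And>m. \<exists>D\<ge>0. \<forall>j. dbound m ?p (D / real (Suc j)) (\<lambda>x. fmult h (trunc j f) x - F x)"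
    using dbound_complete[of "\<lambda>j. fmult h (trunc j f)" ?p thesis, OF schwartz_smooth[OF fmult_schwartz[OF h fS]] cauchy]
    by iprover
  have lim: "(\<lambda>j. nth_deriv i (fmult h (trunc j f)) x) \<longlonglongrightarrow> nth_deriv i F x" for i x
  proof -
    obtain D where "\<And>j. dbound i ?p (D / real (Suc j)) (\<lambda>x. fmult h (trunc j f) x - F x)"
      using F(2) by metis
    from dboundD[OF this order_refl] show ?thesis
      by (intro tendsto_of_rate[of _ _ D "wt ?p x"])
        (simp add: nth_deriv_diff F(1) schwartz_smooth fmult_schwartz[OF h fS])
  qed
  have eq: "omult h f = F"
    using lim[of 0] by (intro omult_eqI) simp
  show "omult h f \<in> C_infinity"
    "\<exists>D\<ge>0. \<forall>j. dbound m (int n + 1) (D / real (Suc j)) (\<lambda>x. fmult h (trunc j f) x - omult h f x)"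
    "(\<lambda>j. fmult h (trunc j f) x) \<longlonglongrightarrow> omult h f x"
    "(\<lambda>j. nth_deriv i (fmult h (trunc j f)) x) \<longlonglongrightarrow> nth_deriv i (omult h f) x"
    unfolding eq using F lim lim[of 0] by auto
qed

text \<open>The estimate for \<open>fmult\<close> with p = n + 1 passes to the limit; this p also
  explains the order \<open>2 * Suc (Suc n)\<close> required of the symbol. The constant is still
  chosen before the symbol.\<close>

lemma omult_dbound:
  fixes B :: real
  assumes "0 \<le> q"
  shows "\<exists>C\<ge>0. \<forall>h\<in>OM. dbound (2 * Suc (Suc n)) q B h \<longrightarrow>
    (\<forall>f\<in>OC_step n. \<forall>A. dbound (m + 2 * Suc (nat q)) (int n) A f \<longrightarrow> dbound m (int n + 1) (C * A) (omult h f))"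
proof -
  let ?K = "2 * Suc (nat q)" and ?p = "int n + 1"
  have e: "nat \<bar>?p\<bar> = Suc n" by simp
  obtain C where C: "C \<ge> 0" "\<And>h f A m. h \<in> OM \<Longrightarrow> dbound (2 * Suc (Suc n)) q B h \<Longrightarrow> f \<in> schwartz \<Longrightarrow>
      dbound (m + ?K) ?p A f \<Longrightarrow> dbound m ?p (C * A) (fmult h f)"
    using fmult_dbound[OF assms, of ?p B] unfolding e by blast
  obtain c where c: "c \<ge> 0" "\<And>j f p A. f \<in> C_infinity \<Longrightarrow> dbound (m + ?K) p A f \<Longrightarrow>
      dbound (m + ?K) (p + 1) (c * A / real (Suc j)) (\<lambda>x. trunc j f x - f x)"
    using trunc_error by metis
  have "dbound m ?p (C * (1 + c) * A) (omult h f)"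
    if h: "h \<in> OM" "dbound (2 * Suc (Suc n)) q B h" and f: "f \<in> OC_step n" "dbound (m + ?K) (int n) A f" for h f A
  proof -
    note sm = OC_step_smooth[OF f(1)] and fS = trunc_schwartz[OF f(1)]
    have A0: "0 \<le> A" by (rule dbound_nonneg[OF f(2)])
    \<comment> \<open>A bound independent of j: f contributes A, and the error at most c * A since 1
      / (j + 1) is at most 1.\<close>
    have "dbound (m + ?K) ?p ((1 + c) * A) (trunc j f)" for j
    proof -
      have "dbound (m + ?K) ?p (A + c * A / real (Suc j)) (\<lambda>x. f x + (trunc j f x - f x))"
        by (intro dbound_add c sm C_infinity_diff schwartz_smooth fS dbound_mono[OF f(2)] f(2)) auto
      moreover have "c * A / real (Suc j) \<le> c * A / 1"
        using A0 c(1) by (intro divide_left_mono) auto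
      then have "A + c * A / real (Suc j) \<le> (1 + c) * A" by (simp add: distrib_right)
      ultimately show ?thesis by (auto intro: dbound_mono)
    qed
    from C(2)[OF h fS this] have b: "dbound m ?p (C * ((1 + c) * A)) (fmult h (trunc j f))" for j .
    show ?thesis unfolding dbound_def
    proof (intro allI impI)
      fix i x assume i: "i \<le> m"
      have "(\<lambda>j. cmod (nth_deriv i (fmult h (trunc j f)) x)) \<longlonglongrightarrow> cmod (nth_deriv i (omult h f) x)"
        by (intro tendsto_norm omult_rate(4)[OF h(1) f(1)])
      moreover have "cmod (nth_deriv i (fmult h (trunc j f)) x) \<le> C * (1 + c) * A * wt ?p x" for j
        using dboundD[OF b i, of j x] by (simp add: mult.assoc)
      ultimately show "cmod (nth_deriv i (omult h f) x) \<le> C * (1 + c) * A * wt ?p x"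
        by (intro LIMSEQ_le_const2) auto
    qed
  qed
  then show ?thesis using C(1) c(1) by (intro exI[of _ "C * (1 + c)"]) auto
qed

lemma omult_dbound_single:
  assumes "h \<in> OM"
  obtains K where "\<And>m. \<exists>C\<ge>0. \<forall>f\<in>OC_step n. \<forall>A. dbound (m + K) (int n) A f \<longrightarrow> dbound m (int n + 1) (C * A) (omult h f)"
proof -
  obtain q B where q: "0 \<le> q" "dbound (2 * Suc (Suc n)) q B h"
    using assms OM_iff by metis
  have "\<exists>C\<ge>0. \<forall>f\<in>OC_step n. \<forall>A. dbound (m + 2 * Suc (nat q)) (int n) A f \<longrightarrow> dbound m (int n + 1) (C * A) (omult h f)" for m
    using omult_dbound[OF q(1), of n B m] q(2) assms by blast
  then show thesis by (rule that)
qed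

lemma omult_OC_step:
  assumes "h \<in> OM" "f \<in> OC_step n"
  shows "omult h f \<in> OC_step (Suc n)"
proof -
  obtain K where K: "\<And>m. \<exists>C\<ge>0. \<forall>f\<in>OC_step n. \<forall>A. dbound (m + K) (int n) A f \<longrightarrow> dbound m (int n + 1) (C * A) (omult h f)"
    using omult_dbound_single[OF assms(1)] by metis
  have "\<exists>A. dbound m (int n + 1) A (omult h f)" for m
    using K[of m] OC_step_bound[OF assms(2), of "m + K"] assms(2) by blast
  then show ?thesis using omult_rate(1)[OF assms] by (simp add: OC_step_iff add.commute)
qed

lemma omult_OC: "h \<in> OM \<Longrightarrow> f \<in> OC \<Longrightarrow> omult h f \<in> OC"
  using omult_OC_step OC_step_OC by (metis OC_iff)

lemma omult_add:
  assumes "h \<in> OM" "f \<in> OC" "g \<in> OC"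
  shows "omult h (\<lambda>x. f x + g x) = (\<lambda>x. omult h f x + omult h g x)"
proof -
  obtain n where n: "f \<in> OC_step n" "g \<in> OC_step n" using OC_common_step assms by metis
  have "trunc j (\<lambda>x. f x + g x) = (\<lambda>x. trunc j f x + trunc j g x)" for j
    by (simp add: trunc_def distrib_right)
  then show ?thesis
    using tendsto_add[OF omult_rate(3)[OF assms(1) n(1)] omult_rate(3)[OF assms(1) n(2)]]
    by (intro omult_eqI) (simp add: fmult_add assms trunc_schwartz[OF n(1)] trunc_schwartz[OF n(2)])
qed

lemma omult_cmult:
  assumes "h \<in> OM" "f \<in> OC"
  shows "omult h (\<lambda>x. c * f x) = (\<lambda>x. c * omult h f x)"
proof -
  obtain n where n: "f \<in> OC_step n" using OC_iff assms by metis
  have "trunc j (\<lambda>x. c * f x) = (\<lambda>x. c * trunc j f x)" for j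
    by (simp add: trunc_def mult.assoc)
  then have "fmult h (trunc j (\<lambda>x. c * f x)) = (\<lambda>x. c * fmult h (trunc j f) x)" for j
    by (simp only: fmult_cmult[OF assms(1) trunc_schwartz[OF n]])
  then show ?thesis
    by (intro omult_eqI) (simp only: tendsto_mult_left[OF omult_rate(3)[OF assms(1) n]])
qed

lemma OC_cmult: "f \<in> OC \<Longrightarrow> (\<lambda>x. c * f x) \<in> OC"
  using OC_step_cmult by (force simp: OC_iff)

lemma OC_add: "f \<in> OC \<Longrightarrow> g \<in> OC \<Longrightarrow> (\<lambda>x. f x + g x) \<in> OC"
  by (erule (1) OC_common_step) (rule OC_step_OC[OF OC_step_add])

lemma OC_diff: "f \<in> OC \<Longrightarrow> g \<in> OC \<Longrightarrow> (\<lambda>x. f x - g x) \<in> OC"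
  by (erule (1) OC_common_step) (rule OC_step_OC[OF OC_step_diff])

lemma omult_diff:
  assumes "h \<in> OM" "f \<in> OC" "g \<in> OC"
  shows "omult h (\<lambda>x. f x - g x) = (\<lambda>x. omult h f x - omult h g x)"
  using omult_add[OF assms(1,2) OC_cmult[OF assms(3), of "-1"]] omult_cmult[OF assms(1,3), of "-1"] by simp

text \<open>On a Schwartz function the truncation error already tends to 0 in weight 1, so
  continuity of \<open>fmult\<close> identifies the limit.\<close>

lemma omult_schwartz:
  assumes "h \<in> OM" "f \<in> schwartz"
  shows "omult h f = fmult h f"
proof (rule omult_eqI)
  fix x
  note f = schwartz_OC_step[OF assms(2), of 0]
  obtain K where K: "\<And>m. \<exists>C\<ge>0. \<forall>f\<in>schwartz. \<forall>A. dbound (m + K) 1 A f \<longrightarrow> dbound m 1 (C * A) (fmult h f)"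
    using fmult_rate[OF assms(1)] by metis
  obtain C where C: "C \<ge> 0" "\<And>f A. f \<in> schwartz \<Longrightarrow> dbound K 1 A f \<Longrightarrow> dbound 0 1 (C * A) (fmult h f)"
    using K[of 0] by auto
  obtain A where A: "dbound K 0 A f" using schwartz_bound[OF assms(2)] by blast
  obtain c where c: "\<And>j. dbound K (0 + 1) (c * A / real (Suc j)) (\<lambda>x. trunc j f x - f x)"
    using trunc_error[of K] schwartz_smooth[OF assms(2)] A by blast
  have "cmod (fmult h (trunc j f) x - fmult h f x) \<le> C * (c * A) / real (Suc j) * wt 1 x" for j
  proof -
    have "dbound K 1 (c * A / real (Suc j)) (\<lambda>x. trunc j f x - f x)" using c[of j] by simp
    from dboundD0[OF C(2)[OF schwartz_diff[OF trunc_schwartz[OF f] assms(2)] this], of x]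
    show ?thesis by (simp add: fmult_diff assms trunc_schwartz[OF f])
  qed
  then show "(\<lambda>j. fmult h (trunc j f) x) \<longlonglongrightarrow> fmult h f x"
    by (rule tendsto_of_rate)
qed

text \<open>Any Schwartz approximation with these rates may replace the truncations. Products need
  this, since \<open>fmult k (trunc j f)\<close> approximates \<open>omult k f\<close> without being
  a truncation of it.\<close>

lemma fmult_tendsto_omult:
  assumes "h \<in> OM" "f \<in> OC_step n" "\<And>j. g j \<in> schwartz"
    and "\<And>m. \<exists>D. \<forall>j. dbound m (int n) (D / real (Suc j)) (\<lambda>x. g j x - f x)"
  shows "(\<lambda>j. fmult h (g j) x) \<longlonglongrightarrow> omult h f x"
proof -
  obtain K where K: "\<And>m. \<exists>C\<ge>0. \<forall>f\<in>OC_step n. \<forall>A. dbound (m + K) (int n) A f \<longrightarrow> dbound m (int n + 1) (C * A) (omult h f)"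
    using omult_dbound_single[OF assms(1)] by metis
  obtain C where C: "C \<ge> 0" "\<And>f A. f \<in> OC_step n \<Longrightarrow> dbound K (int n) A f \<Longrightarrow> dbound 0 (int n + 1) (C * A) (omult h f)"
    using K[of 0] by auto
  obtain D where D: "\<And>j. dbound K (int n) (D / real (Suc j)) (\<lambda>x. g j x - f x)" using assms(4) by metis
  note gOC = schwartz_OC_step[OF assms(3)]
  have "cmod (fmult h (g j) x - omult h f x) \<le> C * D / real (Suc j) * wt (int n + 1) x" for j
  proof -
    have "omult h (\<lambda>x. g j x - f x) x = fmult h (g j) x - omult h f x"
      by (simp add: omult_diff[OF assms(1) OC_step_OC[OF gOC] OC_step_OC[OF assms(2)]] omult_schwartz assms(1,3))
    with dboundD0[OF C(2)[OF OC_step_diff[OF gOC assms(2)] D], of j x] show ?thesis by simp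
  qed
  then show ?thesis by (rule tendsto_of_rate)
qed

lemma omult_omult:
  assumes "h \<in> OM" "k \<in> OM" "f \<in> OC"
  shows "omult h (omult k f) = omult (\<lambda>\<xi>. h \<xi> * k \<xi>) f"
proof -
  obtain n where n: "f \<in> OC_step n" using OC_iff assms by metis
  have "(\<lambda>j. fmult h (fmult k (trunc j f)) x) \<longlonglongrightarrow> omult h (omult k f) x" for x
  proof (rule fmult_tendsto_omult[OF assms(1) omult_OC_step[OF assms(2) n]])
    show "\<exists>D. \<forall>j. dbound m (int (Suc n)) (D / real (Suc j)) (\<lambda>x. fmult k (trunc j f) x - omult k f x)" for m
      using omult_rate(2)[OF assms(2) n, of m] by (auto simp: add.commute)
  qed (intro fmult_schwartz assms trunc_schwartz[OF n])
  then show ?thesis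
    by (intro omult_eqI[symmetric]) (simp add: fmult_mult assms trunc_schwartz[OF n])
qed

lemma trunc_tendsto:
  assumes "f \<in> OC_step n" shows "(\<lambda>j. trunc j f x) \<longlonglongrightarrow> f x"
proof -
  obtain A where A: "dbound 0 (int n) A f" using OC_step_bound[OF assms] by blast
  obtain c where c: "\<And>j. dbound 0 (int n + 1) (c * A / real (Suc j)) (\<lambda>x. trunc j f x - f x)"
    using trunc_error[of 0] OC_step_smooth[OF assms] A by blast
  from dboundD0[OF this] show ?thesis by (rule tendsto_of_rate)
qed

lemma omult_one: "f \<in> OC \<Longrightarrow> omult (\<lambda>\<xi>. 1) f = f"
  by (rule omult_eqI) (auto simp: OC_iff fmult_one trunc_schwartz trunc_tendsto)

lemma omult_shift:
  assumes "h \<in> OM" "f \<in> OC"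
  shows "omult (\<lambda>\<xi>. l - h \<xi>) f = (\<lambda>x. l * f x - omult h f x)"
proof -
  obtain n where n: "f \<in> OC_step n" using OC_iff assms by metis
  show ?thesis
    by (intro omult_eqI, simp only: fmult_shift[OF assms(1) trunc_schwartz[OF n]])
      (intro tendsto_diff tendsto_mult_left trunc_tendsto[OF n] omult_rate(3)[OF assms(1) n])
qed

section \<open>Functionals on \<open>O\<^sub>C\<close>\<close>

lemma weighted_values_nonempty: "weighted_values w m f \<noteq> {}"
  by (auto simp: weighted_values_def)

lemma Sup_weighted_values_le:
  assumes "dbound m p A f"
  shows "Sup (weighted_values (wt (- p)) m f) \<le> B \<longleftrightarrow> dbound m p B f"
proof -
  have "bdd_above (weighted_values (wt (- p)) m f)"
    using assms unfolding bdd_above_def weighted_values_le by blast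
  then show ?thesis
    by (simp add: cSup_le_iff weighted_values_nonempty weighted_values_le)
qed

lemma growth_norm_le_iff:
  "f \<in> OC_step n \<Longrightarrow> growth_norm m n f \<le> B \<longleftrightarrow> dbound m (int n) B f"
  unfolding growth_norm_def growth_values_wt using OC_step_bound[of f n m] Sup_weighted_values_le by blast

lemma schwartz_norm_le_iff:
  "f \<in> schwartz \<Longrightarrow> schwartz_norm n f \<le> B \<longleftrightarrow> dbound n (- int n) B f"
  unfolding schwartz_norm_def schwartz_values_wt using schwartz_bound[of f n "- int n"] Sup_weighted_values_le by blast

text \<open>The usual passage from boundedness on a ball to a homogeneous bound, stated for
  \<open>dbound\<close> so that it serves both seminorms and functionals.\<close>

lemma dbound_scaling:
  fixes N :: "(real \<Rightarrow> complex) \<Rightarrow> real"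
  assumes V: "f \<in> V" "f \<in> C_infinity" "\<And>c. (\<lambda>x. c * f x) \<in> V"
    and hom: "\<And>c. N (\<lambda>x. c * f x) = cmod c * N f"
    and d: "0 < d" and e: "\<And>g. g \<in> V \<Longrightarrow> dbound m p d g \<Longrightarrow> N g \<le> e"
    and f: "dbound m p A f"
  shows "N f \<le> e / d * A"
proof -
  have A: "0 \<le> A" by (rule dbound_nonneg[OF f])
  \<comment> \<open>A may be 0, so f is rescaled by d / B with B > A, and B then tends to A.\<close>
  have "N f \<le> e / d * B" if "A < B" for B
  proof -
    have B: "0 < B" using A that by simp
    have "dbound m p B f" using that by (intro dbound_mono[OF f]) auto
    from dbound_cmult[OF V(2) this, of "of_real (d / B)"] B d
    have "dbound m p d (\<lambda>x. of_real (d / B) * f x)" by (simp add: norm_divide)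
    from e[OF V(3) this] have "d / B * N f \<le> e" unfolding hom using B d by (simp add: norm_divide)
    then show ?thesis using B d by (simp add: field_simps)
  qed
  moreover have "((\<lambda>B. e / d * B) \<longlongrightarrow> e / d * A) (at_right A)"
    by (intro tendsto_intros)
  moreover have "\<forall>\<^sub>F B in at_right A. A < B"
    by (simp add: eventually_at_filter)
  ultimately show ?thesis
    by (intro tendsto_lowerbound[of "\<lambda>B. e / d * B" _ "at_right A"]) (auto elim: eventually_mono)
qed

lemma seminorm_topology_nbhd_0:
  assumes "openin (seminorm_topology V P) U" "(\<lambda>x. 0) \<in> U"
  obtains F e where "finite F" "F \<subseteq> P" "0 < e" "\<And>g. g \<in> V \<Longrightarrow> (\<And>q. q \<in> F \<Longrightarrow> q g < e) \<Longrightarrow> g \<in> U"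
proof -
  have "\<exists>F e. finite F \<and> F \<subseteq> P \<and> 0 < e \<and> {g\<in>V. \<forall>p\<in>F. p (\<lambda>x. g x - 0) < e} \<subseteq> U"
    using assms unfolding openin_seminorm_topology by (elim conjE) (erule bspec)
  then obtain F e where "finite F" "F \<subseteq> P" "0 < e" "{g\<in>V. \<forall>p\<in>F. p (\<lambda>x. g x - 0) < e} \<subseteq> U"
    by (elim exE conjE) iprover
  then show thesis by (intro that[of F e]) auto
qed

definition OC_seminorm :: "((real \<Rightarrow> complex) \<Rightarrow> real) \<Rightarrow> bool" where
  "OC_seminorm p \<longleftrightarrow> seminorm_on OC p \<and> (\<forall>n\<ge>1. continuous_map (OC_step_space n) euclideanreal p)"

lemma OC_space_seminorm: "OC_space = seminorm_topology OC {p. OC_seminorm p}"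
  by (simp add: OC_space_def OC_seminorm_def)

lemma topspace_OC_space [simp]: "topspace OC_space = OC"
  by (simp add: OC_space_def)

lemma zero_OC_step: "(\<lambda>x. 0) \<in> OC_step n"
proof -
  have "dbound m (int n) 0 (\<lambda>x. 0)" for m
    using dbound_const[of m 0] by (simp add: dbound_def)
  then show ?thesis using C_infinity_const by (auto simp: OC_step_iff)
qed

text \<open>A neighbourhood of 0 involves finitely many growth norms, all controlled by the one of
  largest order; rescaling gives the homogeneous bound.\<close>

lemma OC_seminorm_bound:
  assumes p: "OC_seminorm p" and n: "1 \<le> n"
  shows "\<exists>m C. 0 \<le> C \<and> (\<forall>f\<in>OC_step n. \<forall>A. dbound m (int n) A f \<longrightarrow> p f \<le> C * A)"
proof -
  have hom: "p (\<lambda>x. c * f x) = cmod c * p f" if "f \<in> OC" for c f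
    using p that by (simp add: OC_seminorm_def seminorm_on_def)
  have p0: "p (\<lambda>x. 0) = 0"
    using hom[OF OC_step_OC[OF zero_OC_step], of 0] by simp
  let ?U = "{f \<in> topspace (OC_step_space n). p f \<in> {..<1}}"
  have "openin (OC_step_space n) ?U"
    using p n by (intro openin_continuous_map_preimage[of _ euclideanreal]) (auto simp: OC_seminorm_def)
  moreover have "(\<lambda>x. 0) \<in> ?U"
    using p0 zero_OC_step by (simp add: OC_step_space_def)
  ultimately obtain F e where F: "finite F" "F \<subseteq> {growth_norm m n |m. 1 \<le> m}" "0 < e"
    "\<And>g. g \<in> OC_step n \<Longrightarrow> (\<And>q. q \<in> F \<Longrightarrow> q g < e) \<Longrightarrow> g \<in> ?U"
    unfolding OC_step_space_def by (rule seminorm_topology_nbhd_0) blast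
  have "F \<subseteq> (\<lambda>m. growth_norm m n) ` {1..}" using F(2) by auto
  then obtain I where I: "finite I" "F = (\<lambda>m. growth_norm m n) ` I"
    using F(1) finite_subset_image by metis
  \<comment> \<open>The 0 covers an empty set of orders.\<close>
  define M where "M = Max (insert 0 I)"
  \<comment> \<open>Half of e turns the weak inequality of \<open>dbound\<close> into the strict one
    that defines the neighbourhood.\<close>
  have "p f < 1" if f: "f \<in> OC_step n" "dbound M (int n) (e / 2) f" for f
  proof -
    have "growth_norm m n f < e" if "m \<in> I" for m
    proof -
      have "m \<le> M" unfolding M_def using that I(1) by (intro Max_ge) auto
      then have "growth_norm m n f \<le> e / 2"
        unfolding growth_norm_le_iff[OF f(1)] by (intro dbound_mono[OF f(2)]) auto
      then show ?thesis using F(3) by simp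
    qed
    then have "f \<in> ?U" using F(4)[OF f(1)] I(2) by auto
    then show ?thesis by simp
  qed
  then have "p f \<le> 1 / (e / 2) * A" if "f \<in> OC_step n" "dbound M (int n) A f" for f A
    using that F(3) hom[OF OC_step_OC[OF that(1)]]
    by (intro dbound_scaling[of f "OC_step n"]) (auto simp: OC_step_smooth OC_step_cmult less_imp_le)
  then show ?thesis using F(3) by (intro exI[of _ M] exI[of _ "1 / (e / 2)"]) auto
qed

text \<open>Continuity without topology: one derivative bound on each step. In this form the class
  is visibly stable under multiplying the argument by -ix.\<close>

definition OC_functional :: "((real \<Rightarrow> complex) \<Rightarrow> complex) \<Rightarrow> bool" where
  "OC_functional T \<longleftrightarrow>
    (\<forall>f\<in>OC. \<forall>g\<in>OC. T (\<lambda>x. f x + g x) = T f + T g) \<and>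
    (\<forall>c. \<forall>f\<in>OC. T (\<lambda>x. c * f x) = c * T f) \<and>
    (\<forall>n\<ge>1. \<exists>m C. 0 \<le> C \<and> (\<forall>f\<in>OC_step n. \<forall>A. dbound m (int n) A f \<longrightarrow> cmod (T f) \<le> C * A))"

lemma OC_functional_add: "OC_functional T \<Longrightarrow> f \<in> OC \<Longrightarrow> g \<in> OC \<Longrightarrow> T (\<lambda>x. f x + g x) = T f + T g"
  and OC_functional_cmult: "OC_functional T \<Longrightarrow> f \<in> OC \<Longrightarrow> T (\<lambda>x. c * f x) = c * T f"
  by (auto simp: OC_functional_def)

lemma OC_functional_diff:
  "OC_functional T \<Longrightarrow> f \<in> OC \<Longrightarrow> g \<in> OC \<Longrightarrow> T (\<lambda>x. f x - g x) = T f - T g"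
  using OC_functional_add[of T f "\<lambda>x. -1 * g x"] OC_functional_cmult[of T g "-1"] OC_cmult[of g "-1"] by simp

lemma OC_functional_bound:
  assumes "OC_functional T" "1 \<le> n"
  obtains m C where "0 \<le> C" "\<And>f A. f \<in> OC_step n \<Longrightarrow> dbound m (int n) A f \<Longrightarrow> cmod (T f) \<le> C * A"
  using assms unfolding OC_functional_def by blast

lemma OC_functional_sum:
  assumes "OC_functional T" "finite I" "\<And>i. i \<in> I \<Longrightarrow> f i \<in> OC"
  shows "(\<lambda>x. \<Sum>i\<in>I. f i x) \<in> OC \<and> T (\<lambda>x. \<Sum>i\<in>I. f i x) = (\<Sum>i\<in>I. T (f i))"
  using assms(2,3)
proof (induction I rule: finite_induct)
  case empty
  have "T (\<lambda>x. 0) = 0"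
    using OC_functional_cmult[OF assms(1) OC_step_OC[OF zero_OC_step], of 0] by simp
  then show ?case using OC_step_OC[OF zero_OC_step] by simp
next
  case (insert i I)
  then show ?case using OC_functional_add[OF assms(1)] OC_add by simp
qed

lemma OC_functional_dual:
  assumes "T \<in> continuous_dual OC_space"
  shows "OC_functional T"
  unfolding OC_functional_def
proof (intro conjI allI impI)
  show "\<forall>f\<in>OC. \<forall>g\<in>OC. T (\<lambda>x. f x + g x) = T f + T g" "\<forall>f\<in>OC. T (\<lambda>x. c * f x) = c * T f" for c
    using assms by (auto simp: continuous_dual_def)
  note hom = this(2)
  have z: "(\<lambda>x. 0) \<in> OC" by (rule OC_step_OC[OF zero_OC_step])
  have T0: "T (\<lambda>x. 0) = 0" using hom[of 0] z by fastforce
  fix n :: nat assume n: "1 \<le> n"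
  let ?U = "{f \<in> topspace OC_space. T f \<in> ball 0 1}"
  have "openin OC_space ?U"
    using assms by (intro openin_continuous_map_preimage[of _ euclidean]) (auto simp: continuous_dual_def)
  moreover have "(\<lambda>x. 0) \<in> ?U" using z T0 by simp
  ultimately obtain F e where F: "finite F" "F \<subseteq> {p. OC_seminorm p}" "0 < e"
    "\<And>g. g \<in> OC \<Longrightarrow> (\<And>q. q \<in> F \<Longrightarrow> q g < e) \<Longrightarrow> g \<in> ?U"
    unfolding OC_space_seminorm by (rule seminorm_topology_nbhd_0) blast
  have "\<exists>m C. 0 \<le> C \<and> (\<forall>f\<in>OC_step n. \<forall>A. dbound m (int n) A f \<longrightarrow> (\<forall>p\<in>F. p f \<le> C * A))"
    using F(1,2)
  proof (induction F rule: finite_induct)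
    case (insert p F)
    have "F \<subseteq> {p. OC_seminorm p}" "OC_seminorm p" using insert.prems by auto
    from insert.IH[OF this(1)] OC_seminorm_bound[OF this(2) n]
    obtain m C m' C' where *: "0 \<le> C" "\<forall>f\<in>OC_step n. \<forall>A. dbound m (int n) A f \<longrightarrow> (\<forall>p\<in>F. p f \<le> C * A)"
      "0 \<le> C'" "\<forall>f\<in>OC_step n. \<forall>A. dbound m' (int n) A f \<longrightarrow> p f \<le> C' * A"
      by (elim exE conjE) iprover
    have "\<forall>q\<in>insert p F. q f \<le> (C + C') * A" if f: "f \<in> OC_step n" "dbound (max m m') (int n) A f" for f A
    proof -
      have "dbound m (int n) A f" "dbound m' (int n) A f" by (auto intro: dbound_mono[OF f(2)])
      with * f(1) have "\<forall>q\<in>F. q f \<le> C * A" "p f \<le> C' * A" by auto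
      moreover have "C * A \<le> (C + C') * A" "C' * A \<le> (C + C') * A"
        using *(1,3) dbound_nonneg[OF f(2)] by (auto intro: mult_right_mono)
      ultimately show ?thesis by (auto intro: order_trans)
    qed
    then show ?case using *(1,3) by (intro exI[of _ "max m m'"] exI[of _ "C + C'"]) auto
  qed (auto intro: exI[of _ "0::real"])
  then obtain m C where C: "0 \<le> C" "\<And>f A p. f \<in> OC_step n \<Longrightarrow> dbound m (int n) A f \<Longrightarrow> p \<in> F \<Longrightarrow> p f \<le> C * A"
    by blast
  \<comment> \<open>C + 1 avoids division by 0 and makes C * d strictly smaller than e.\<close>
  define d where "d = e / (C + 1)"
  have d: "0 < d" "C * d < e" using F(3) C(1) by (auto simp: d_def field_simps)
  have "cmod (T f) \<le> 1" if f: "f \<in> OC_step n" "dbound m (int n) d f" for f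
  proof -
    have "f \<in> ?U"
      by (rule F(4)[OF OC_step_OC[OF f(1)]], rule le_less_trans[OF C(2)[OF f] d(2)])
    then show ?thesis by simp
  qed
  then have "cmod (T f) \<le> 1 / d * A" if "f \<in> OC_step n" "dbound m (int n) A f" for f A
    using that d(1) hom OC_step_OC[OF that(1)]
    by (intro dbound_scaling[of f "OC_step n"]) (auto simp: OC_step_smooth OC_step_cmult norm_mult)
  then show "\<exists>m C. 0 \<le> C \<and> (\<forall>f\<in>OC_step n. \<forall>A. dbound m (int n) A f \<longrightarrow> cmod (T f) \<le> C * A)"
    using d(1) by (intro exI[of _ m] exI[of _ "1 / d"]) auto
qed

text \<open>The classical formula for the transform of T. That it is the function described by
  \<open>fourier_function\<close> is shown in \<open>fourier_function_eq\<close>.\<close>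

definition ft :: "((real \<Rightarrow> complex) \<Rightarrow> complex) \<Rightarrow> real \<Rightarrow> complex" where
  "ft T \<xi> = T (ce \<xi>)"

lemma ce_nth_deriv:
  "ce \<xi> \<in> C_infinity" "nth_deriv i (ce \<xi>) = (\<lambda>x. (- \<i> * of_real \<xi>) ^ i * ce \<xi> x)"
proof -
  let ?F = "\<lambda>i x. (- \<i> * of_real \<xi>) ^ i * ce \<xi> x"
  have "(?F i has_vector_derivative ?F (Suc i) x) (at x)" for i x
    using has_vector_derivative_mult_right[OF ce_has_vector_derivative, of "(- \<i> * of_real \<xi>) ^ i" \<xi> x]
    by (simp add: mult_ac)
  from nth_deriv_eqI[of ?F, OF this] show "ce \<xi> \<in> C_infinity" "nth_deriv i (ce \<xi>) = ?F i"
    by simp_all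
qed

text \<open>Each derivative in x brings down a factor \<xi>; the polynomial dependence on \<xi>
  becomes the polynomial growth of \<open>ft T\<close>.\<close>

lemma dbound_ce: "dbound m 0 ((1 + \<bar>\<xi>\<bar>) ^ m) (ce \<xi>)"
  unfolding dbound_def ce_nth_deriv(2)
proof (intro allI impI)
  fix i x assume "i \<le> m"
  have "\<bar>\<xi>\<bar> ^ i \<le> (1 + \<bar>\<xi>\<bar>) ^ i" by (intro power_mono) auto
  also have "\<dots> \<le> (1 + \<bar>\<xi>\<bar>) ^ m" using \<open>i \<le> m\<close> by (intro power_increasing) auto
  finally show "cmod ((- \<i> * complex_of_real \<xi>) ^ i * ce \<xi> x) \<le> (1 + \<bar>\<xi>\<bar>) ^ m * wt 0 x"
    by (simp add: norm_mult norm_power)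
qed

lemma ce_OC_step: "ce \<xi> \<in> OC_step n"
proof -
  have "dbound m (int n) ((1 + \<bar>\<xi>\<bar>) ^ m) (ce \<xi>)" for m
    by (rule dbound_mono[OF dbound_ce]) auto
  then show ?thesis using ce_nth_deriv(1) by (auto simp: OC_step_iff)
qed

lemma ce_OC: "ce \<xi> \<in> OC"
  by (rule OC_step_OC[OF ce_OC_step])

lemma ce_OM: "ce \<xi> \<in> OM"
  by (rule OC_step_imp_OM[OF ce_OC_step])

text \<open>The transpose of multiplication by -ix. It plays the part of d/d\<xi> on the side of
  functionals.\<close>

definition xm :: "((real \<Rightarrow> complex) \<Rightarrow> complex) \<Rightarrow> (real \<Rightarrow> complex) \<Rightarrow> complex" where
  "xm T f = T (\<lambda>x. (- \<i> * of_real x) * f x)"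

lemma OC_step_xm:
  assumes "f \<in> OC_step n"
  shows "(\<lambda>x. (- \<i> * of_real x) * f x) \<in> OC_step (Suc n)"
  unfolding OC_step_iff
proof (intro conjI allI)
  show "(\<lambda>x. (- \<i> * of_real x) * f x) \<in> C_infinity"
    by (intro C_infinity_mult C_infinity_linear OC_step_smooth[OF assms])
  fix m
  obtain A where "dbound m (int n) A f" using OC_step_bound[OF assms] by blast
  from dbound_mult[OF C_infinity_linear OC_step_smooth[OF assms] dbound_linear this, of "- \<i>"]
  show "\<exists>A. dbound m (int (Suc n)) A (\<lambda>x. (- \<i> * of_real x) * f x)"
    unfolding of_nat_Suc by blast
qed

lemma OC_xm: "f \<in> OC \<Longrightarrow> (\<lambda>x. (- \<i> * of_real x) * f x) \<in> OC"
  using OC_step_xm OC_step_OC by (metis OC_iff)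

lemma OC_functional_xm:
  assumes T: "OC_functional T"
  shows "OC_functional (xm T)"
  unfolding OC_functional_def
proof (intro conjI allI impI ballI)
  show "xm T (\<lambda>x. f x + g x) = xm T f + xm T g" if "f \<in> OC" "g \<in> OC" for f g
    using OC_functional_add[OF T OC_xm[OF that(1)] OC_xm[OF that(2)]] by (simp add: xm_def algebra_simps)
  show "xm T (\<lambda>x. c * f x) = c * xm T f" if "f \<in> OC" for c f
    using OC_functional_cmult[OF T OC_xm[OF that(1)], of c] by (simp add: xm_def algebra_simps)
  fix n :: nat assume "1 \<le> n"
  obtain m C where C: "0 \<le> C" "\<And>f A. f \<in> OC_step (Suc n) \<Longrightarrow> dbound m (int (Suc n)) A f \<Longrightarrow> cmod (T f) \<le> C * A"
    by (rule OC_functional_bound[OF T, of "Suc n"]) (simp, blast)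
  have "cmod (xm T f) \<le> (C * 2 ^ m) * A" if f: "f \<in> OC_step n" "dbound m (int n) A f" for f A
  proof -
    from dbound_mult[OF C_infinity_linear OC_step_smooth[OF f(1)] dbound_linear f(2), of "- \<i>"]
    have "dbound m (int (Suc n)) (2 ^ m * A) (\<lambda>x. (- \<i> * of_real x) * f x)" by simp
    from C(2)[OF OC_step_xm[OF f(1)] this] show ?thesis by (simp add: xm_def mult.assoc)
  qed
  then show "\<exists>m C. 0 \<le> C \<and> (\<forall>f\<in>OC_step n. \<forall>A. dbound m (int n) A f \<longrightarrow> cmod (xm T f) \<le> C * A)"
    using C(1) by (intro exI[of _ m] exI[of _ "C * 2 ^ m"]) auto
qed

text \<open>The order 0 remainder is at most (hx)^2, its derivative is -ih times ce h - 1 and so at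
  most h^2 |x|, and from order 2 on two factors h are explicit. One power of the weight pays for all
  of this.\<close>

lemma dbound_ce_taylor:
  assumes h: "\<bar>h\<bar> \<le> 1"
  shows "dbound m 1 (h\<^sup>2) (\<lambda>x. ce h x - 1 + \<i> * of_real h * of_real x)"
proof -
  let ?s = "\<lambda>x. ce h x - 1 + \<i> * of_real h * of_real x"
  let ?s' = "\<lambda>x. (- \<i> * of_real h) * ce h x + \<i> * of_real h"
  let ?s'' = "\<lambda>x. (- \<i> * of_real h) ^ 2 * ce h x"
  have "dv ?s = (\<lambda>x. ((- \<i> * of_real h) * ce h x - 0) + \<i> * of_real h * 1)"
    by (intro dv_eqI has_vector_derivative_add has_vector_derivative_diff has_vector_derivative_const
        has_vector_derivative_mult_right has_vector_derivative_complex_of_real ce_has_vector_derivative)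
  then have 1: "dv ?s = ?s'" by simp
  have "dv ?s' = (\<lambda>x. (- \<i> * of_real h) * ((- \<i> * of_real h) * ce h x) + 0)"
    by (intro dv_eqI has_vector_derivative_add has_vector_derivative_const
        has_vector_derivative_mult_right ce_has_vector_derivative)
  then have 2: "dv ?s' = ?s''" by (simp add: power2_eq_square mult.assoc)
  have "dbound m 0 1 (ce h)"
    unfolding dbound_def ce_nth_deriv(2) using h by (simp add: norm_mult norm_power power_le_one)
  from dbound_cmult[OF ce_nth_deriv(1) this, of "(- \<i> * of_real h) ^ 2"]
  have "dbound m 0 (h\<^sup>2) ?s''" by (simp add: norm_mult norm_power)
  then have b2: "dbound m 1 (h\<^sup>2) ?s''" by (rule dbound_mono) auto
  have b1: "cmod (?s' x) \<le> h\<^sup>2 * wt 1 x" for x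
  proof -
    have "?s' x = (- \<i> * of_real h) * (ce h x - 1)" by (simp add: algebra_simps)
    then have "cmod (?s' x) = \<bar>h\<bar> * cmod (ce h x - 1)" by (simp only: norm_mult) simp
    also have "\<dots> \<le> \<bar>h\<bar> * (\<bar>h\<bar> * wt 1 x)"
      using order_trans[OF ce_taylor1[of h x], of "\<bar>h\<bar> * wt 1 x"] abs_le_wt[of x]
      by (intro mult_left_mono) (auto simp: abs_mult mult_left_mono)
    finally show ?thesis by (simp add: power2_eq_square)
  qed
  have b0: "cmod (?s x) \<le> h\<^sup>2 * wt 1 x" for x
    using ce_taylor2[of h x] by (rule order_trans) (simp add: wt_1 power_mult_distrib mult_left_mono)
  \<comment> \<open>Two derivatives are peeled off by hand, so the bound is proved for order m + 2
    and then restricted.\<close>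
  have "dbound (Suc (Suc m)) 1 (h\<^sup>2) ?s"
    unfolding dbound_Suc 1 2 using b0 b1 b2 by blast
  then show ?thesis by (rule dbound_mono) auto
qed

text \<open>The error of the linear approximation of \<open>ft T\<close> is T applied to a character
  times the Taylor remainder, and T is bounded on step 1, where that product is quadratic in
  h.\<close>

lemma ft_vderiv:
  assumes T: "OC_functional T"
  shows "(ft T has_vector_derivative ft (xm T) \<xi>) (at \<xi>)"
proof -
  obtain m C where C: "0 \<le> C" "\<And>f A. f \<in> OC_step 1 \<Longrightarrow> dbound m (int 1) A f \<Longrightarrow> cmod (T f) \<le> C * A"
    by (rule OC_functional_bound[OF T, of 1]) (simp, blast)
  show ?thesis
  proof (rule has_vector_derivative_quadratic)
    fix h :: real assume h: "\<bar>h\<bar> \<le> 1"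
    let ?s = "\<lambda>x. ce h x - 1 + \<i> * of_real h * of_real x"
    have s: "?s \<in> C_infinity"
      by (intro C_infinity_add C_infinity_diff ce_nth_deriv(1) C_infinity_const C_infinity_linear)
    have sOC: "?s \<in> OC_step 1"
      unfolding OC_step_iff using s dbound_ce_taylor[OF h] by auto
    have b: "dbound m (int 1) (2 ^ m * (1 + \<bar>\<xi>\<bar>) ^ m * h\<^sup>2) (\<lambda>x. ce \<xi> x * ?s x)"
      using dbound_mult[OF ce_nth_deriv(1) s dbound_ce dbound_ce_taylor[OF h], of m \<xi>] by simp
    have "\<exists>A. dbound m (int 1) A (\<lambda>x. ce \<xi> x * ?s x)" for m
      using dbound_mult[OF ce_nth_deriv(1) s dbound_ce dbound_ce_taylor[OF h], of m \<xi>] by auto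
    then have "(\<lambda>x. ce \<xi> x * ?s x) \<in> OC_step 1"
      unfolding OC_step_iff using C_infinity_mult[OF ce_nth_deriv(1) s] by blast
    from C(2)[OF this b] have "cmod (T (\<lambda>x. ce \<xi> x * ?s x)) \<le> C * (2 ^ m * (1 + \<bar>\<xi>\<bar>) ^ m) * h\<^sup>2"
      by (simp add: mult.assoc)
    also have "(\<lambda>x. ce \<xi> x * ?s x) = (\<lambda>x. (ce (\<xi> + h) x - ce \<xi> x) - of_real h * ((- \<i> * of_real x) * ce \<xi> x))"
      by (auto simp: ce_add algebra_simps)
    also have "T \<dots> = ft T (\<xi> + h) - ft T \<xi> - of_real h * ft (xm T) \<xi>"
      by (simp only: OC_functional_diff[OF T] OC_functional_cmult[OF T] OC_diff OC_cmult OC_xm ce_OC ft_def xm_def)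
    finally show "cmod (ft T (\<xi> + h) - ft T \<xi> - of_real h * ft (xm T) \<xi>) \<le> C * (2 ^ m * (1 + \<bar>\<xi>\<bar>) ^ m) * h\<^sup>2" .
  qed
qed

lemma ft_bound:
  assumes T: "OC_functional T"
  shows "\<exists>q A. 0 \<le> q \<and> 0 \<le> A \<and> (\<forall>\<xi>. cmod (ft T \<xi>) \<le> A * wt q \<xi>)"
proof -
  obtain m C where C: "0 \<le> C" "\<And>f A. f \<in> OC_step 1 \<Longrightarrow> dbound m (int 1) A f \<Longrightarrow> cmod (T f) \<le> C * A"
    by (rule OC_functional_bound[OF T, of 1]) (simp, blast)
  have "cmod (ft T \<xi>) \<le> (C * 2 ^ m) * wt (int m) \<xi>" for \<xi>
  proof -
    have "dbound m (int 1) ((1 + \<bar>\<xi>\<bar>) ^ m) (ce \<xi>)" by (rule dbound_mono[OF dbound_ce]) auto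
    from C(2)[OF ce_OC_step this] have "cmod (ft T \<xi>) \<le> C * (1 + \<bar>\<xi>\<bar>) ^ m" by (simp add: ft_def)
    also have "1 + \<bar>\<xi>\<bar> \<le> 2 * wt 1 \<xi>" using abs_le_wt[of \<xi>] wt_ge_1[of 1 \<xi>] by simp
    then have "C * (1 + \<bar>\<xi>\<bar>) ^ m \<le> C * (2 * wt 1 \<xi>) ^ m"
      using C(1) by (intro mult_left_mono power_mono) auto
    finally show ?thesis by (simp only: power_mult_distrib wt_of_nat wt_1 mult.assoc)
  qed
  then show ?thesis using C(1) by (intro exI[of _ "int m"] exI[of _ "C * 2 ^ m"]) auto
qed

text \<open>\<open>xm T\<close> is again an admissible functional, so differentiation never leaves
  the class; smoothness and polynomial bounds both iterate, the bounds by an induction over all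
  T.\<close>

lemma ft_OM:
  assumes T: "OC_functional T"
  shows "ft T \<in> OM"
  unfolding OM_iff
proof (intro conjI allI)
  have "OC_functional ((xm ^^ i) T)" for i
    by (induction i) (auto intro: T OC_functional_xm)
  from nth_deriv_eqI(1)[of "\<lambda>i. ft ((xm ^^ i) T)"] ft_vderiv[OF this]
  show "ft T \<in> C_infinity" by simp
  show "\<exists>q A. 0 \<le> q \<and> dbound m q A (ft T)" for m
    using T
  proof (induction m arbitrary: T)
    case 0
    then show ?case using ft_bound[OF 0] by (auto simp: dbound_def)
  next
    case (Suc m)
    obtain q A where A: "0 \<le> q" "dbound m q A (ft (xm T))"
      using Suc.IH[OF OC_functional_xm[OF Suc.prems]] by auto
    obtain q' A' where A': "0 \<le> q'" "0 \<le> A'" "\<And>\<xi>. cmod (ft T \<xi>) \<le> A' * wt q' \<xi>"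
      using ft_bound[OF Suc.prems] by auto
    have "dbound m (max q q') (max A A') (ft (xm T))" by (rule dbound_mono[OF A(2)]) auto
    moreover have "dbound 0 q' A' (ft T)" using A'(3) by (simp add: dbound_def)
    then have "dbound 0 (max q q') (max A A') (ft T)" by (rule dbound_mono) auto
    then have "cmod (ft T \<xi>) \<le> max A A' * wt (max q q') \<xi>" for \<xi> by (rule dboundD0)
    moreover have "dv (ft T) = ft (xm T)" by (intro dv_eqI ft_vderiv Suc.prems)
    ultimately have "dbound (Suc m) (max q q') (max A A') (ft T)" by (simp add: dbound_Suc)
    then show ?case using A(1) by (intro exI[of _ "max q q'"] exI[of _ "max A A'"]) auto
  qed
qed

section \<open>The Fourier transform of a functional\<close>

text \<open>With mesh 1/n these indices tile the interval from -n to n by half-open cells, so that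
  mesh and tail shrink together.\<close>

definition cells :: "nat \<Rightarrow> int set" where
  "cells n = {- (int n)\<^sup>2..<(int n)\<^sup>2}"

definition riemann_sum :: "nat \<Rightarrow> (real \<Rightarrow> complex) \<Rightarrow> complex" where
  "riemann_sum n u = (\<Sum>k\<in>cells n. of_real (1 / real n) * u (of_int k / real n))"

lemma riemann_sum_integral:
  fixes u :: "real \<Rightarrow> complex"
  assumes n: "0 < n"
  defines "w \<equiv> \<lambda>\<xi>. if \<lfloor>real n * \<xi>\<rfloor> \<in> cells n then u (of_int \<lfloor>real n * \<xi>\<rfloor> / real n) else 0"
  shows "(LINT \<xi>|lborel. w \<xi>) = riemann_sum n u" "integrable lborel w"
proof -
  let ?I = "\<lambda>k::int. {of_int k / real n..<of_int (k + 1) / real n}"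
  have w: "w = (\<lambda>\<xi>. \<Sum>k\<in>cells n. indicator (?I k) \<xi> *\<^sub>R u (of_int k / real n))"
  proof
    fix \<xi>
    have "indicator (?I k) \<xi> = (if k = \<lfloor>real n * \<xi>\<rfloor> then 1 else 0 :: real)" for k
    proof -
      have "\<xi> \<in> ?I k \<longleftrightarrow> \<lfloor>real n * \<xi>\<rfloor> = k"
        using n by (simp add: floor_eq_iff field_simps)
      then show ?thesis by (auto simp: indicator_def)
    qed
    then have "(\<Sum>k\<in>cells n. indicator (?I k) \<xi> *\<^sub>R u (of_int k / real n))
        = (\<Sum>k\<in>cells n. if k = \<lfloor>real n * \<xi>\<rfloor> then u (of_int k / real n) else 0)"
      by (intro sum.cong) auto
    then show "w \<xi> = (\<Sum>k\<in>cells n. indicator (?I k) \<xi> *\<^sub>R u (of_int k / real n))"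
      by (simp add: w_def cells_def)
  qed
  have i: "integrable lborel (\<lambda>\<xi>. indicator (?I k) \<xi> *\<^sub>R u (of_int k / real n))"
    and I: "(LINT \<xi>|lborel. indicator (?I k) \<xi> *\<^sub>R u (of_int k / real n)) = of_real (1 / real n) * u (of_int k / real n)" for k
  proof -
    have le: "of_int k / real n \<le> of_int (k + 1) / real n"
      by (intro divide_right_mono) auto
    have ind: "integrable lborel (indicator (?I k) :: real \<Rightarrow> real)"
      using le by (simp add: emeasure_lborel_Ico)
    then show "integrable lborel (\<lambda>\<xi>. indicator (?I k) \<xi> *\<^sub>R u (of_int k / real n))"
      by simp
    have "measure lborel (?I k) = 1 / real n"
      using le by (simp add: measure_def emeasure_lborel_Ico add_divide_distrib)
    then show "(LINT \<xi>|lborel. indicator (?I k) \<xi> *\<^sub>R u (of_int k / real n)) = of_real (1 / real n) * u (of_int k / real n)"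
      using ind by (simp add: scaleR_conv_of_real)
  qed
  show "integrable lborel w"
    unfolding w by (intro Bochner_Integration.integrable_sum i)
  show "(LINT \<xi>|lborel. w \<xi>) = riemann_sum n u"
    unfolding w riemann_sum_def by (subst Bochner_Integration.integral_sum) (simp_all only: i I)
qed

text \<open>Two errors of size 1/n. Inside the cells the mean value inequality acts over a distance
  of at most 1/n; outside them one of the two factors in \<open>wt (-2)\<close> is at most 1/n. The
  other factor is integrable.\<close>

lemma riemann_sum_error:
  assumes n: "0 < n" and M: "0 \<le> M"
    and u: "\<And>\<xi>. (u has_vector_derivative u' \<xi>) (at \<xi>)"
    "\<And>\<xi>. cmod (u \<xi>) \<le> M * wt (-2) \<xi>" "\<And>\<xi>. cmod (u' \<xi>) \<le> M * wt (-2) \<xi>"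
  shows "cmod (riemann_sum n u - (LINT \<xi>|lborel. u \<xi>)) \<le> 4 * M / real n * pi"
proof -
  define w where "w = (\<lambda>\<xi>. if \<lfloor>real n * \<xi>\<rfloor> \<in> cells n then u (of_int \<lfloor>real n * \<xi>\<rfloor> / real n) else 0)"
  note w = riemann_sum_integral[OF n, of u, folded w_def]
  have "continuous_on UNIV u"
    using u(1) by (meson continuous_at_imp_continuous_on has_vector_derivative_continuous)
  then have um: "u \<in> borel_measurable borel" by (intro borel_measurable_continuous_onI)
  have "cmod (u \<xi>) \<le> M * wt (-1) \<xi>" for \<xi>
    using u(2)[of \<xi>] wt_mono[of "-2" "-1" \<xi>] M by (meson mult_left_mono order_trans neg_le_iff_le one_le_numeral)
  then have ui: "integrable lborel u" by (rule integrable_wt_bound[OF um])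
  have close: "cmod (w \<xi> - u \<xi>) \<le> 4 * M / real n * wt (-1) \<xi>" for \<xi>
  proof (cases "\<lfloor>real n * \<xi>\<rfloor> \<in> cells n")
    case True
    define \<eta> where "\<eta> = of_int \<lfloor>real n * \<xi>\<rfloor> / real n"
    have \<eta>: "\<eta> \<le> \<xi>" "\<xi> - \<eta> \<le> 1 / real n"
    proof -
      have e: "real n * \<eta> = of_int \<lfloor>real n * \<xi>\<rfloor>" using n by (simp add: \<eta>_def)
      then have "real n * \<eta> \<le> real n * \<xi>" by simp
      then show "\<eta> \<le> \<xi>" using n by simp
      have "(\<xi> - \<eta>) * real n = real n * \<xi> - real n * \<eta>" by (simp add: algebra_simps)
      also have "\<dots> \<le> 1" unfolding e by linarith
      finally show "\<xi> - \<eta> \<le> 1 / real n" using n by (subst pos_le_divide_eq) auto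
    qed
    have n1: "1 / real n \<le> 1" using n by simp
    have "cmod (u \<eta> - u \<xi>) \<le> (4 * M * wt (-1) \<xi>) * norm (\<eta> - \<xi>)"
    proof (rule differentiable_bound[where S = "{\<eta>..\<xi>}" and f' = "\<lambda>x h. h *\<^sub>R u' x"])
      fix x assume x: "x \<in> {\<eta>..\<xi>}"
      show "(u has_derivative (\<lambda>h. h *\<^sub>R u' x)) (at x within {\<eta>..\<xi>})"
        using u(1) has_derivative_at_withinI unfolding has_vector_derivative_def by blast
      \<comment> \<open>Peetre's inequality moves the weight from x to \<xi>: its own factor 2 and a
        factor 2 for a distance of at most 1 give the 4.\<close>
      have "\<bar>\<xi> - x\<bar> \<le> 1" using x \<eta> n1 by auto
      then have "(\<xi> - x)\<^sup>2 \<le> 1" by (simp add: abs_square_le_1)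
      then have "wt 1 (\<xi> - x) \<le> 2" by (simp add: wt_1)
      then have "2 * wt (-1) \<xi> * wt 1 (\<xi> - x) \<le> 2 * wt (-1) \<xi> * 2"
        by (intro mult_left_mono) auto
      moreover have "wt (-1) x \<le> 2 * wt (-1) \<xi> * wt 1 (\<xi> - x)"
        using peetre[of "-1" x \<xi>] by simp
      ultimately have "wt (-1) x \<le> 4 * wt (-1) \<xi>" by linarith
      moreover have "cmod (u' x) \<le> M * wt (-1) x"
        using u(3)[of x] wt_mono[of "-2" "-1" x] M by (meson mult_left_mono order_trans neg_le_iff_le one_le_numeral)
      ultimately have "cmod (u' x) \<le> M * (4 * wt (-1) \<xi>)"
        using M by (meson mult_left_mono order_trans)
      then have "cmod (u' x) \<le> 4 * M * wt (-1) \<xi>" by (simp add: mult_ac)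
      then have *: "\<bar>h\<bar> * cmod (u' x) \<le> \<bar>h\<bar> * (4 * M * wt (-1) \<xi>)" for h :: real
        by (intro mult_left_mono) auto
      show "onorm (\<lambda>h. h *\<^sub>R u' x) \<le> 4 * M * wt (-1) \<xi>"
      proof (rule onorm_le)
        show "norm (h *\<^sub>R u' x) \<le> 4 * M * wt (-1) \<xi> * norm h" for h
          using *[of h] by (simp only: norm_scaleR real_norm_def mult.commute)
      qed
    qed (use \<eta> in auto)
    also have "\<dots> \<le> (4 * M * wt (-1) \<xi>) * (1 / real n)"
      using \<eta> M by (intro mult_left_mono) auto
    finally show ?thesis using True by (simp add: w_def \<eta>_def mult_ac)
  next
    case False
    have "real n \<le> \<bar>\<xi>\<bar>"
    proof (rule ccontr)
      assume "\<not> real n \<le> \<bar>\<xi>\<bar>"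
      then have "- real n \<le> \<xi>" "\<xi> < real n" by auto
      then have "real n * (- real n) \<le> real n * \<xi>" "real n * \<xi> < real n * real n"
        using n by (intro mult_left_mono mult_strict_left_mono; simp)+
      then have "\<lfloor>real n * \<xi>\<rfloor> \<in> cells n"
        unfolding cells_def atLeastLessThan_iff le_floor_iff floor_less_iff by (simp add: power2_eq_square)
      with False show False by simp
    qed
    then have "real n \<le> wt 1 \<xi>" using abs_le_wt[of \<xi>] by simp
    then have "inverse (wt 1 \<xi>) \<le> inverse (real n)"
      using n by (intro le_imp_inverse_le) auto
    then have "wt (-1) \<xi> \<le> 1 / real n"
      using wt_minus[of 1 \<xi>] by (simp add: inverse_eq_divide)
    then have "wt (-1) \<xi> * wt (-1) \<xi> \<le> 1 / real n * wt (-1) \<xi>" by (intro mult_right_mono) auto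
    moreover have "wt (-2) \<xi> = wt (-1) \<xi> * wt (-1) \<xi>"
      using wt_add[of "-1" "-1" \<xi>] by simp
    ultimately have "M * wt (-2) \<xi> \<le> M * (1 / real n * wt (-1) \<xi>)"
      using M by (intro mult_left_mono) auto
    also have "\<dots> \<le> 4 * (M * (1 / real n * wt (-1) \<xi>))"
    proof -
      have "0 \<le> M * (1 / real n * wt (-1) \<xi>)" using M by simp
      then show ?thesis by linarith
    qed
    finally show ?thesis using False u(2)[of \<xi>] by (simp add: w_def mult_ac)
  qed
  have "riemann_sum n u - (LINT \<xi>|lborel. u \<xi>) = (LINT \<xi>|lborel. w \<xi> - u \<xi>)"
    using w ui by simp
  also have "cmod \<dots> \<le> 4 * M / real n * pi"
    using w(2) um by (intro norm_integral_wt_bound close) auto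
  finally show ?thesis .
qed

lemma riemann_sum_tendsto:
  assumes "f \<in> schwartz"
  shows "(\<lambda>n. riemann_sum (Suc n) f) \<longlonglongrightarrow> (LINT \<xi>|lborel. f \<xi>)"
proof -
  obtain M where M: "dbound 1 (-2) M f" using schwartz_bound[OF assms] by blast
  have "cmod (riemann_sum (Suc n) f - (LINT \<xi>|lborel. f \<xi>)) \<le> 4 * M / real (Suc n) * pi" for n
    using dboundD0[OF M] dboundD[OF M, of 1]
    by (intro riemann_sum_error[of _ _ f "dv f"] dbound_nonneg[OF M] C_infinity_vderiv schwartz_smooth assms)
      (auto simp: nth_deriv_Suc)
  then show ?thesis by (rule tendsto_of_rate)
qed

text \<open>A Riemann sum of the Fourier integral, seen as a function of x: a finite combination of
  characters, on which T is computed by linearity.\<close>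

definition fourier_sum :: "nat \<Rightarrow> (real \<Rightarrow> complex) \<Rightarrow> real \<Rightarrow> complex" where
  "fourier_sum n f x = (\<Sum>k\<in>cells n. (of_real (1 / real n) * f (of_int k / real n)) * ce (of_int k / real n) x)"

lemma fourier_sum_nth_deriv:
  "fourier_sum n f \<in> C_infinity"
  "nth_deriv i (fourier_sum n f) x = riemann_sum n (\<lambda>\<xi>. ce x \<xi> * ((- \<i> * of_real \<xi>) ^ i * f \<xi>))"
proof -
  let ?F = "\<lambda>i x. \<Sum>k\<in>cells n. (of_real (1 / real n) * f (of_int k / real n)) * nth_deriv i (ce (of_int k / real n)) x"
  have "(?F i has_vector_derivative ?F (Suc i) x) (at x)" for i x
    by (intro has_vector_derivative_sum has_vector_derivative_mult_right C_infinity_nth_vderiv ce_nth_deriv(1))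
  from nth_deriv_eqI[of ?F, OF this]
  have *: "?F 0 \<in> C_infinity" "nth_deriv i (?F 0) = ?F i" by blast+
  have F: "?F 0 = fourier_sum n f" by (simp add: fourier_sum_def[abs_def])
  show "fourier_sum n f \<in> C_infinity" using * F by simp
  have "nth_deriv i (fourier_sum n f) x = ?F i x" using * F by simp
  then show "nth_deriv i (fourier_sum n f) x = riemann_sum n (\<lambda>\<xi>. ce x \<xi> * ((- \<i> * of_real \<xi>) ^ i * f \<xi>))"
    by (simp only: ce_nth_deriv(2) riemann_sum_def ce_commute mult_ac)
qed

text \<open>Differentiating the integrand in \<xi> brings a factor x out of the kernel, so the rate
  holds with weight 1. This suffices because functionals are bounded on step 1.\<close>

lemma fourier_sum_rate:
  assumes f: "f \<in> schwartz"
  shows "\<exists>D\<ge>0. \<forall>n. dbound m 1 (D / real (Suc n)) (\<lambda>x. fourier_sum (Suc n) f x - fourier f x)"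
proof -
  have "\<exists>D\<ge>0. \<forall>n x. cmod (nth_deriv i (fourier_sum (Suc n) f) x - nth_deriv i (fourier f) x) \<le> D / real (Suc n) * wt 1 x" for i
  proof -
    let ?f = "\<lambda>\<xi>. (- \<i> * complex_of_real \<xi>) ^ i * f \<xi>"
    have fs: "?f \<in> schwartz"
      using f by (intro schwartz_OM_mult OM_power OM_linear)
    obtain M where M: "dbound 1 (-2) M ?f" using schwartz_bound[OF fs] by blast
    have M0: "0 \<le> M" by (rule dbound_nonneg[OF M])
    have "cmod (nth_deriv i (fourier_sum (Suc n) f) x - nth_deriv i (fourier f) x) \<le> 8 * M * pi / real (Suc n) * wt 1 x" for n x
    proof -
      let ?u = "\<lambda>\<xi>. ce x \<xi> * ?f \<xi>"
      let ?u' = "\<lambda>\<xi>. ce x \<xi> * dv ?f \<xi> + ((- \<i> * of_real x) * ce x \<xi>) * ?f \<xi>"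
      have f1: "cmod (?f \<xi>) \<le> M * wt (-2) \<xi>" "cmod (dv ?f \<xi>) \<le> M * wt (-2) \<xi>" for \<xi>
        using dboundD[OF M, of 0 \<xi>] dboundD[OF M, of 1 \<xi>] by (simp_all add: nth_deriv_Suc)
      \<comment> \<open>In the derivative of the integrand, M bounds the term where
        \<open>?f\<close> is differentiated and |x| * M the term from the kernel.\<close>
      have "cmod (riemann_sum (Suc n) ?u - (LINT \<xi>|lborel. ?u \<xi>)) \<le> 4 * (2 * M * wt 1 x) / real (Suc n) * pi"
      proof (rule riemann_sum_error[where u' = ?u'])
        show "(?u has_vector_derivative ?u' \<xi>) (at \<xi>)" for \<xi>
          by (intro has_vector_derivative_mult ce_has_vector_derivative C_infinity_vderiv schwartz_smooth fs)
        have 1: "M * wt (-2) \<xi> \<le> M * wt (-2) \<xi> * wt 1 x" for \<xi>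
          using mult_left_mono[OF wt_ge_1[of 1 x], of "M * wt (-2) \<xi>"] M0 by simp
        have 0: "0 \<le> M * wt (-2) \<xi>" for \<xi> using M0 by simp
        show "cmod (?u \<xi>) \<le> 2 * M * wt 1 x * wt (-2) \<xi>" for \<xi>
        proof -
          have "cmod (?u \<xi>) \<le> M * wt (-2) \<xi>" using f1(1)[of \<xi>] by (simp only: norm_mult norm_ce mult_1)
          then show ?thesis using 1[of \<xi>] 0[of \<xi>] by (simp add: mult_ac)
        qed
        show "cmod (?u' \<xi>) \<le> 2 * M * wt 1 x * wt (-2) \<xi>" for \<xi>
        proof -
          have "cmod (?u' \<xi>) \<le> cmod (dv ?f \<xi>) + \<bar>x\<bar> * cmod (?f \<xi>)"
            by (rule order_trans[OF norm_triangle_ineq]) (simp only: norm_mult norm_ce, simp)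
          also have "\<dots> \<le> M * wt (-2) \<xi> * wt 1 x + wt 1 x * (M * wt (-2) \<xi>)"
            using f1[of \<xi>] 1[of \<xi>] by (intro add_mono mult_mono abs_le_wt) auto
          finally show ?thesis by (simp add: mult_ac)
        qed
        show "0 \<le> 2 * M * wt 1 x" using M0 by simp
      qed simp
      moreover have "nth_deriv i (fourier f) x = (LINT \<xi>|lborel. ?u \<xi>)"
        unfolding fourier_schwartz_nth_deriv(2)[OF f] fourier_ce ..
      ultimately show ?thesis by (simp add: fourier_sum_nth_deriv(2) mult_ac)
    qed
    then show ?thesis using M0 by (intro exI[of _ "8 * M * pi"]) auto
  qed
  then obtain D where D: "\<And>i. 0 \<le> D i"
    "\<And>i n x. cmod (nth_deriv i (fourier_sum (Suc n) f) x - nth_deriv i (fourier f) x) \<le> D i / real (Suc n) * wt 1 x"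
    by metis
  define E where "E = (\<Sum>i\<le>m. D i)"
  have "dbound m 1 (E / real (Suc n)) (\<lambda>x. fourier_sum (Suc n) f x - fourier f x)" for n
    unfolding dbound_def nth_deriv_diff[OF fourier_sum_nth_deriv(1) fourier_schwartz_nth_deriv(1)[OF f]]
  proof (intro allI impI)
    fix i x assume "i \<le> m"
    then have "D i \<le> E" unfolding E_def using D(1) by (intro member_le_sum) auto
    then have "D i / real (Suc n) * wt 1 x \<le> E / real (Suc n) * wt 1 x"
      by (intro mult_right_mono divide_right_mono) auto
    with D(2)[of i n x] show "cmod (nth_deriv i (fourier_sum (Suc n) f) x - nth_deriv i (fourier f) x) \<le> E / real (Suc n) * wt 1 x"
      by (rule order_trans)
  qed
  moreover have "0 \<le> E" using D(1) by (auto simp: E_def intro: sum_nonneg)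
  ultimately show ?thesis by blast
qed

text \<open>Riemann sums take the place of an integral with values in \<open>OC\<close>: T is linear
  on them and they converge to the transform in step 1.\<close>

lemma fourier_distr_ft:
  assumes T: "OC_functional T" and f: "f \<in> schwartz"
  shows "T (fourier f) = (LINT \<xi>|lborel. ft T \<xi> * f \<xi>)"
proof -
  have A: "fourier_sum n f \<in> OC \<and> T (fourier_sum n f) = riemann_sum n (\<lambda>\<xi>. ft T \<xi> * f \<xi>)" for n
  proof -
    let ?g = "\<lambda>k x. (of_real (1 / real n) * f (of_int k / real n)) * ce (of_int k / real n) x"
    have "(\<lambda>x. \<Sum>k\<in>cells n. ?g k x) \<in> OC \<and> T (\<lambda>x. \<Sum>k\<in>cells n. ?g k x) = (\<Sum>k\<in>cells n. T (?g k))"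
      by (rule OC_functional_sum[OF T _ OC_cmult[OF ce_OC]]) (simp add: cells_def)
    moreover have "T (?g k) = of_real (1 / real n) * (ft T (of_int k / real n) * f (of_int k / real n))" for k
      unfolding OC_functional_cmult[OF T ce_OC] ft_def by (simp only: mult_ac)
    ultimately show ?thesis
      by (simp only: fourier_sum_def[abs_def] riemann_sum_def)
  qed
  obtain m C where C: "0 \<le> C" "\<And>f A. f \<in> OC_step 1 \<Longrightarrow> dbound m (int 1) A f \<Longrightarrow> cmod (T f) \<le> C * A"
    by (rule OC_functional_bound[OF T, of 1]) (simp, blast)
  obtain D where D: "\<And>n. dbound m 1 (D / real (Suc n)) (\<lambda>x. fourier_sum (Suc n) f x - fourier f x)"
    using fourier_sum_rate[OF f] by blast
  have F: "fourier f \<in> OC" by (rule OC_step_OC[OF schwartz_OC_step[OF fourier_schwartz[OF f], of 1]])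
  have "cmod (riemann_sum (Suc n) (\<lambda>\<xi>. ft T \<xi> * f \<xi>) - T (fourier f)) \<le> C * D / real (Suc n) * 1" for n
  proof -
    have "(\<lambda>x. fourier_sum (Suc n) f x - fourier f x) \<in> OC_step 1"
      unfolding OC_step_iff using fourier_sum_rate[OF f]
        C_infinity_diff[OF fourier_sum_nth_deriv(1) fourier_schwartz_nth_deriv(1)[OF f]] by (metis int_ops(2))
    from C(2)[OF this, of "D / real (Suc n)"] D
    have "cmod (T (\<lambda>x. fourier_sum (Suc n) f x - fourier f x)) \<le> C * (D / real (Suc n))" by simp
    then show ?thesis
      using A[of "Suc n"] by (simp add: OC_functional_diff[OF T _ F])
  qed
  then have "(\<lambda>n. riemann_sum (Suc n) (\<lambda>\<xi>. ft T \<xi> * f \<xi>)) \<longlonglongrightarrow> T (fourier f)"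
    by (rule tendsto_of_rate)
  moreover have "(\<lambda>n. riemann_sum (Suc n) (\<lambda>\<xi>. ft T \<xi> * f \<xi>)) \<longlonglongrightarrow> (LINT \<xi>|lborel. ft T \<xi> * f \<xi>)"
    by (intro riemann_sum_tendsto schwartz_OM_mult ft_OM T f)
  ultimately show ?thesis by (rule LIMSEQ_unique)
qed

section \<open>Uniqueness of the representing function\<close>

lemma OM_cnj:
  assumes "h \<in> OM" shows "(\<lambda>x. cnj (h x)) \<in> OM"
proof -
  let ?F = "\<lambda>i x. cnj (nth_deriv i h x)"
  have "(?F i has_vector_derivative ?F (Suc i) x) (at x)" for i x
    by (intro has_vector_derivative_cnj C_infinity_nth_vderiv OM_smooth assms)
  from nth_deriv_eqI[of ?F, OF this] assms show ?thesis
    by (simp add: OM_iff dbound_def)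
qed

text \<open>Testing against the conjugate of h times \<open>gauss\<close> yields a nonnegative
  integrand, so h vanishes almost everywhere; an open set of measure zero is empty.\<close>

lemma OM_eq_0:
  assumes h: "h \<in> OM" and z: "\<And>f. f \<in> schwartz \<Longrightarrow> (LINT \<xi>|lborel. h \<xi> * f \<xi>) = 0"
  shows "h x = 0"
proof (rule ccontr)
  assume hx: "h x \<noteq> 0"
  let ?r = "\<lambda>\<xi>. (cmod (h \<xi>))\<^sup>2 * exp (- (\<xi>\<^sup>2 / 2))"
  let ?f = "\<lambda>\<xi>. cnj (h \<xi>) * gauss \<xi>"
  have f: "?f \<in> schwartz" by (intro schwartz_OM_mult OM_cnj h gauss_schwartz)
  have eq: "h \<xi> * ?f \<xi> = of_real (?r \<xi>)" for \<xi>
    by (simp only: gauss_def complex_norm_square of_real_mult mult.assoc)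
  have i: "integrable lborel (\<lambda>\<xi>. complex_of_real (?r \<xi>))"
    using schwartz_integrable[OF schwartz_OM_mult[OF h f]] unfolding eq .
  have "complex_of_real (LINT \<xi>|lborel. ?r \<xi>) = 0"
    using z[OF f] unfolding eq integral_complex_of_real .
  then have "(LINT \<xi>|lborel. ?r \<xi>) = 0" by simp
  moreover have "integrable lborel ?r"
    using i by (simp only: complex_of_real_integrable_eq)
  ultimately have "AE \<xi> in lborel. ?r \<xi> = 0"
    using integral_nonneg_eq_0_iff_AE[of lborel ?r] by auto
  then have ae: "AE \<xi> in lborel. h \<xi> = 0" by simp
  let ?S = "{\<xi>. h \<xi> \<noteq> 0}"
  have "open ?S"
    using C_infinity_continuous[OF OM_smooth[OF h], of UNIV] continuous_on_const
    by (intro open_Collect_neq)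
  moreover have "negligible ?S"
  proof -
    have "?S \<in> null_sets lborel"
      using ae by (subst (asm) AE_iff_null_sets[symmetric, of ?S, simplified]) (use \<open>open ?S\<close> in auto)
    then show ?thesis using negligible_iff_null_sets null_sets_completionI by blast
  qed
  ultimately show False using open_not_negligible hx by blast
qed

lemma fourier_function_eq:
  assumes T: "OC_functional T"
  shows "fourier_function T = ft T"
  unfolding fourier_function_def
proof (rule the_equality)
  show "ft T \<in> OM \<and> (\<forall>f\<in>schwartz. fourier_distr T f = (LINT \<xi>|lborel. ft T \<xi> * f \<xi>))"
    using ft_OM[OF T] fourier_distr_ft[OF T] by (simp add: fourier_distr_def)
  fix g assume g: "g \<in> OM \<and> (\<forall>f\<in>schwartz. fourier_distr T f = (LINT \<xi>|lborel. g \<xi> * f \<xi>))"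
  have "g \<xi> - ft T \<xi> = 0" for \<xi>
  proof (rule OM_eq_0[of "\<lambda>\<xi>. g \<xi> - ft T \<xi>"])
    show "(\<lambda>\<xi>. g \<xi> - ft T \<xi>) \<in> OM" using g ft_OM[OF T] by (intro OM_diff) auto
    fix f assume f: "f \<in> schwartz"
    have "(LINT \<xi>|lborel. (g \<xi> - ft T \<xi>) * f \<xi>) = (LINT \<xi>|lborel. g \<xi> * f \<xi>) - (LINT \<xi>|lborel. ft T \<xi> * f \<xi>)"
      using g f ft_OM[OF T] by (simp add: left_diff_distrib schwartz_integrable schwartz_OM_mult)
    then show "(LINT \<xi>|lborel. (g \<xi> - ft T \<xi>) * f \<xi>) = 0"
      using g f fourier_distr_ft[OF T f] by (simp add: fourier_distr_def)
  qed
  then show "g = ft T" by auto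
qed

text \<open>The function y \<mapsto> f (x - y) is itself a transform, namely that of e^(ix\<xi>) /
  (2 pi) times the transform of f, so \<open>fourier_distr_ft\<close> evaluates T on it.\<close>

lemma convolution_schwartz:
  assumes T: "OC_functional T" and f: "f \<in> schwartz"
  shows "convolution T f = fmult (ft T) f"
proof
  fix x
  let ?\<phi> = "\<lambda>\<xi>. of_real (inverse (2 * pi)) * (ce (- x) \<xi> * fourier f \<xi>)"
  have \<phi>: "?\<phi> \<in> schwartz"
    by (intro schwartz_cmult schwartz_OM_mult ce_OM fourier_schwartz f)
  have "fourier ?\<phi> y = f (x - y)" for y
  proof -
    have "ce y \<xi> * (ce (- x) \<xi> * fourier f \<xi>) = ce (y - x) \<xi> * fourier f \<xi>" for \<xi>
      using ce_add[of y "- x" \<xi>] by (simp add: mult.assoc)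
    then have "fourier ?\<phi> y = of_real (inverse (2 * pi)) * fourier (fourier f) (y - x)"
      unfolding fourier_cmult by (simp only: fourier_ce[of _ y] fourier_ce[of _ "y - x"])
    then show ?thesis by (simp add: fourier_inversion[OF f])
  qed
  then have "(\<lambda>y. f (x - y)) = fourier ?\<phi>" by auto
  then have "convolution T f x = T (fourier ?\<phi>)" by (simp only: convolution_def)
  also have "\<dots> = (LINT \<xi>|lborel. ft T \<xi> * ?\<phi> \<xi>)" by (rule fourier_distr_ft[OF T \<phi>])
  also have "\<dots> = (LINT \<xi>|lborel. of_real (inverse (2 * pi)) * (ce (- x) \<xi> * (ft T \<xi> * fourier f \<xi>)))"
    by (simp only: mult_ac)
  also have "\<dots> = fmult (ft T) f x"
    by (simp only: integral_mult_right_zero fmult_def fourier_ce[of _ "- x"])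
  finally show "convolution T f x = fmult (ft T) f x" .
qed

lemma dbound_reflect:
  assumes "f \<in> C_infinity" "dbound m (int n) A f"
  shows "dbound m (int n) (A * (2 ^ n * wt (int n) x)) (\<lambda>y. f (x - y))"
proof -
  have A0: "0 \<le> A" by (rule dbound_nonneg[OF assms(2)])
  have "cmod (nth_deriv i (\<lambda>y. f (x - y)) y) \<le> A * (2 ^ n * wt (int n) x) * wt (int n) y" if "i \<le> m" for i y
  proof -
    have "cmod (nth_deriv i (\<lambda>y. f (x - y)) y) = cmod (nth_deriv i f (x - y))"
      using nth_deriv_affine(2)[OF assms(1), of i x "-1"] by (simp add: norm_mult norm_power)
    also have "\<dots> \<le> A * wt (int n) (x - y)" by (rule dboundD[OF assms(2) that])
    also have "\<dots> \<le> A * (2 ^ n * wt (int n) x * wt (int n) y)"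
      using peetre_pos[of n "x - y" x] A0 by (intro mult_left_mono) auto
    finally show ?thesis by (simp add: mult_ac)
  qed
  then show ?thesis by (simp add: dbound_def)
qed

lemma OC_step_reflect:
  assumes "f \<in> OC_step n"
  shows "(\<lambda>y. f (x - y)) \<in> OC_step n"
  unfolding OC_step_iff
proof (intro conjI allI)
  show "(\<lambda>y. f (x - y)) \<in> C_infinity"
    using nth_deriv_affine(1)[OF OC_step_smooth[OF assms], of x "-1"] by simp
  show "\<exists>A. dbound m (int n) A (\<lambda>y. f (x - y))" for m
    using OC_step_bound[OF assms, of m] dbound_reflect[OF OC_step_smooth[OF assms]] by blast
qed

text \<open>Truncations converge in step n + 1, where T is bounded, and reflection and translation
  cost only a factor depending on the fixed point x. Hence both sides are limits of the Schwartz
  case.\<close>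

lemma convolution_OC:
  assumes T: "OC_functional T" and f: "f \<in> OC"
  shows "convolution T f = omult (ft T) f"
proof
  fix x
  obtain n where n: "f \<in> OC_step n" using f OC_iff by metis
  note tr = trunc_schwartz[OF n]
  obtain m C where C: "0 \<le> C" "\<And>f A. f \<in> OC_step (Suc n) \<Longrightarrow> dbound m (int (Suc n)) A f \<Longrightarrow> cmod (T f) \<le> C * A"
    by (rule OC_functional_bound[OF T, of "Suc n"]) (simp, blast)
  obtain A where A: "dbound m (int n) A f" using OC_step_bound[OF n] by blast
  obtain c where c: "\<And>j. dbound m (int n + 1) (c * A / real (Suc j)) (\<lambda>x. trunc j f x - f x)"
    using trunc_error[of m] OC_step_smooth[OF n] A by blast
  have n': "f \<in> OC_step (Suc n)" using n OC_step_mono[of n "Suc n"] by auto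
  define w where "w = 2 ^ Suc n * wt (int (Suc n)) x"
  have "cmod (convolution T (trunc j f) x - convolution T f x) \<le> C * (c * A) / real (Suc j) * w" for j
  proof -
    have s: "(\<lambda>y. trunc j f y - f y) \<in> OC_step (Suc n)"
      by (intro OC_step_diff schwartz_OC_step tr n')
    have "dbound m (int (Suc n)) (c * A / real (Suc j)) (\<lambda>x. trunc j f x - f x)"
      using c[of j] by (simp add: add.commute)
    from C(2)[OF OC_step_reflect[OF s] dbound_reflect[OF OC_step_smooth[OF s] this], of x]
    have "cmod (T (\<lambda>y. trunc j f (x - y) - f (x - y))) \<le> C * (c * A) / real (Suc j) * w"
      by (simp add: w_def mult_ac)
    also have "T (\<lambda>y. trunc j f (x - y) - f (x - y)) = convolution T (trunc j f) x - convolution T f x"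
      unfolding convolution_def
      by (rule OC_functional_diff[OF T OC_step_OC[OF OC_step_reflect[OF schwartz_OC_step[OF tr]]] OC_step_OC[OF OC_step_reflect[OF n]]])
    finally show ?thesis .
  qed
  then have "(\<lambda>j. convolution T (trunc j f) x) \<longlonglongrightarrow> convolution T f x"
    by (rule tendsto_of_rate)
  moreover have "(\<lambda>j. convolution T (trunc j f) x) \<longlonglongrightarrow> omult (ft T) f x"
    unfolding convolution_schwartz[OF T tr] by (rule omult_rate(3)[OF ft_OM[OF T] n])
  ultimately show "convolution T f x = omult (ft T) f x" by (rule LIMSEQ_unique)
qed

section \<open>Equicontinuous families and resolvents\<close>

definition function_subspace :: "('a \<Rightarrow> complex) set \<Rightarrow> bool" where
  "function_subspace V \<longleftrightarrow> (\<lambda>x. 0) \<in> V \<and> (\<forall>f\<in>V. \<forall>g\<in>V. (\<lambda>x. f x + g x) \<in> V) \<and>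
    (\<forall>c. \<forall>f\<in>V. (\<lambda>x. c * f x) \<in> V)"

lemma function_subspaceD:
  assumes "function_subspace V"
  shows "(\<lambda>x. 0) \<in> V" "f \<in> V \<Longrightarrow> g \<in> V \<Longrightarrow> (\<lambda>x. f x + g x) \<in> V" "f \<in> V \<Longrightarrow> (\<lambda>x. c * f x) \<in> V"
  using assms by (simp_all add: function_subspace_def)

lemma function_subspace_diff:
  assumes "function_subspace V" "f \<in> V" "g \<in> V"
  shows "(\<lambda>x. f x - g x) \<in> V"
  using function_subspaceD(2)[OF assms(1,2) function_subspaceD(3)[OF assms(1,3), of "-1"]] by simp

definition linear_operator :: "('a \<Rightarrow> complex) set \<Rightarrow> (('a \<Rightarrow> complex) \<Rightarrow> 'a \<Rightarrow> complex) \<Rightarrow> bool" where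
  "linear_operator V A \<longleftrightarrow> (\<forall>f\<in>V. A f \<in> V) \<and>
    (\<forall>f\<in>V. \<forall>g\<in>V. A (\<lambda>x. f x + g x) = (\<lambda>x. A f x + A g x)) \<and>
    (\<forall>c. \<forall>f\<in>V. A (\<lambda>x. c * f x) = (\<lambda>x. c * A f x))"

lemma linear_operatorD:
  assumes "linear_operator V A"
  shows "f \<in> V \<Longrightarrow> A f \<in> V" "f \<in> V \<Longrightarrow> g \<in> V \<Longrightarrow> A (\<lambda>x. f x + g x) = (\<lambda>x. A f x + A g x)"
    "f \<in> V \<Longrightarrow> A (\<lambda>x. c * f x) = (\<lambda>x. c * A f x)"
  using assms by (simp_all add: linear_operator_def)

lemma linear_operator_diff:
  assumes "function_subspace V" "linear_operator V A" "f \<in> V" "g \<in> V"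
  shows "A (\<lambda>x. f x - g x) = (\<lambda>x. A f x - A g x)"
  using linear_operatorD(2)[OF assms(2,3) function_subspaceD(3)[OF assms(1,4), of "-1"]]
    linear_operatorD(3)[OF assms(2,4), of "-1"] by simp

lemma seminorm_onD:
  assumes "seminorm_on V p"
  shows "f \<in> V \<Longrightarrow> 0 \<le> p f" "f \<in> V \<Longrightarrow> p (\<lambda>x. c * f x) = cmod c * p f"
    "f \<in> V \<Longrightarrow> g \<in> V \<Longrightarrow> p (\<lambda>x. f x + g x) \<le> p f + p g"
  using assms by (simp_all add: seminorm_on_def)

text \<open>The inequality for inverse c, applied to c * f, is the reverse inequality for c. Suprema
  of seminorms satisfy the one-sided form directly.\<close>

lemma seminorm_onI:
  assumes V: "function_subspace V" and nn: "\<And>f. f \<in> V \<Longrightarrow> 0 \<le> p f"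
    and le: "\<And>f c. f \<in> V \<Longrightarrow> p (\<lambda>x. c * f x) \<le> cmod c * p f"
    and add: "\<And>f g. f \<in> V \<Longrightarrow> g \<in> V \<Longrightarrow> p (\<lambda>x. f x + g x) \<le> p f + p g"
  shows "seminorm_on V p"
proof -
  have "p (\<lambda>x. c * f x) = cmod c * p f" if f: "f \<in> V" for f c
  proof (cases "c = 0")
    case True
    then show ?thesis using le[OF f, of 0] nn[OF function_subspaceD(3)[OF V f], of 0] by simp
  next
    case False
    have "p (\<lambda>x. inverse c * (c * f x)) \<le> cmod (inverse c) * p (\<lambda>x. c * f x)"
      by (rule le[OF function_subspaceD(3)[OF V f]])
    moreover have "(\<lambda>x. inverse c * (c * f x)) = f" using False by (simp add: fun_eq_iff)
    ultimately have "p f \<le> inverse (cmod c) * p (\<lambda>x. c * f x)"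
      by (simp only: norm_inverse)
    then have "cmod c * p f \<le> p (\<lambda>x. c * f x)"
      using False by (simp add: field_simps)
    then show ?thesis using le[OF f, of c] by simp
  qed
  then show ?thesis using nn add by (simp add: seminorm_on_def)
qed

lemma seminorm_on_ball_open:
  assumes V: "function_subspace V" and q: "q \<in> P" "seminorm_on V q"
  shows "openin (seminorm_topology V P) {f \<in> V. q f < e}"
  unfolding openin_seminorm_topology
proof (intro conjI ballI)
  fix f assume f: "f \<in> {f \<in> V. q f < e}"
  have "g \<in> {f \<in> V. q f < e}" if "g \<in> V" "q (\<lambda>x. g x - f x) < e - q f" for g
  proof -
    have "q (\<lambda>x. (g x - f x) + f x) \<le> q (\<lambda>x. g x - f x) + q f"
      using f that(1) by (intro seminorm_onD(3)[OF q(2)] function_subspace_diff[OF V]) auto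
    then show ?thesis using that by simp
  qed
  then show "\<exists>F d. finite F \<and> F \<subseteq> P \<and> 0 < d \<and> {g \<in> V. \<forall>p\<in>F. p (\<lambda>x. g x - f x) < d} \<subseteq> {f \<in> V. q f < e}"
    using f q(1) by (intro exI[of _ "{q}"] exI[of _ "e - q f"]) auto
qed auto

lemma equicontinuous_family:
  assumes V: "function_subspace V" and P: "\<And>p. p \<in> P \<Longrightarrow> seminorm_on V p"
    and H: "\<And>A. A \<in> H \<Longrightarrow> linear_operator V A"
    and bound: "\<And>p. p \<in> P \<Longrightarrow> \<exists>q\<in>P. \<exists>C\<ge>0. \<forall>A\<in>H. \<forall>f\<in>V. p (A f) \<le> C * q f"
  shows "equicontinuous_operators (seminorm_topology V P) H"
proof -
  let ?E = "seminorm_topology V P"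
  obtain q C where qC: "\<And>p. p \<in> P \<Longrightarrow> q p \<in> P" "\<And>p. p \<in> P \<Longrightarrow> 0 \<le> C p"
    "\<And>p A f. p \<in> P \<Longrightarrow> A \<in> H \<Longrightarrow> f \<in> V \<Longrightarrow> p (A f) \<le> C p * q p f"
    using bound by metis
  \<comment> \<open>One radius serves all p in F: the sum dominates each C p, and the summand 1
    keeps the denominator positive.\<close>
  have close: "p (A f) < e"
    if "p \<in> F" "finite F" "F \<subseteq> P" "0 < e" "A \<in> H" "f \<in> V" "q p f < e / (1 + (\<Sum>p\<in>F. C p))" for p F e A f
  proof -
    define S where "S = (\<Sum>p\<in>F. C p)"
    have S: "C p \<le> S" "0 \<le> S"
      unfolding S_def using that qC(2) by (auto intro!: member_le_sum sum_nonneg)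
    have "p (A f) \<le> C p * q p f" using that qC(3) by blast
    also have "\<dots> \<le> C p * (e / (1 + S))"
      using that qC(2)[of p] by (intro mult_left_mono) (auto simp: S_def)
    also have "\<dots> \<le> S * (e / (1 + S))" using S that by (intro mult_right_mono) auto
    also have "\<dots> < e" using S that by (simp add: field_simps)
    finally show ?thesis .
  qed
  have pos: "0 < e / (1 + (\<Sum>p\<in>F. C p))" if "0 < e" "F \<subseteq> P" for e :: real and F
    using that qC(2) by (intro divide_pos_pos add_pos_nonneg sum_nonneg) auto
  have cont: "A \<in> continuous_operators ?E" if A: "A \<in> H" for A
  proof -
    have "openin ?E {f \<in> V. A f \<in> U}" if U: "openin ?E U" for U
      unfolding openin_seminorm_topology
    proof (intro conjI ballI)
      fix f assume f: "f \<in> {f \<in> V. A f \<in> U}"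
      have "\<exists>F e. finite F \<and> F \<subseteq> P \<and> 0 < e \<and> {g \<in> V. \<forall>p\<in>F. p (\<lambda>x. g x - A f x) < e} \<subseteq> U"
        using U f unfolding openin_seminorm_topology by simp
      then obtain F e where F: "finite F" "F \<subseteq> P" "0 < e"
        "{g \<in> V. \<forall>p\<in>F. p (\<lambda>x. g x - A f x) < e} \<subseteq> U" by (elim exE conjE) iprover
      let ?d = "e / (1 + (\<Sum>p\<in>F. C p))"
      have "g \<in> {f \<in> V. A f \<in> U}" if g: "g \<in> V" "\<forall>p\<in>q ` F. p (\<lambda>x. g x - f x) < ?d" for g
      proof -
        have "p (\<lambda>x. A g x - A f x) < e" if "p \<in> F" for p
          using close[OF that F(1-3) A function_subspace_diff[OF V g(1)], of f] that g f
          by (simp add: linear_operator_diff[OF V H[OF A]])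
        moreover have "A g \<in> V" using H[OF A] g(1) by (simp add: linear_operator_def)
        ultimately show ?thesis using F(4) g(1) by auto
      qed
      then show "\<exists>F d. finite F \<and> F \<subseteq> P \<and> 0 < d \<and> {g \<in> V. \<forall>p\<in>F. p (\<lambda>x. g x - f x) < d} \<subseteq> {f \<in> V. A f \<in> U}"
        using F qC(1) pos by (intro exI[of _ "q ` F"] exI[of _ ?d]) auto
    qed auto
    then show ?thesis
      using H[OF A] by (auto simp: continuous_operators_def continuous_map_def linear_operator_def)
  qed
  moreover have "\<exists>W. openin ?E W \<and> (\<lambda>x. 0) \<in> W \<and> (\<forall>A\<in>H. A ` W \<subseteq> U)"
    if U: "openin ?E U" "(\<lambda>x. 0) \<in> U" for U
  proof -
    obtain F e where F: "finite F" "F \<subseteq> P" "0 < e" "\<And>g. g \<in> V \<Longrightarrow> (\<And>p. p \<in> F \<Longrightarrow> p g < e) \<Longrightarrow> g \<in> U"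
      using U by (rule seminorm_topology_nbhd_0) blast
    let ?d = "e / (1 + (\<Sum>p\<in>F. C p))"
    define W where "W = {f \<in> V. \<forall>p\<in>F. q p f < ?d}"
    have "openin ?E {f \<in> V. \<forall>p\<in>G. q p f < ?d}" if "finite G" "G \<subseteq> P" for G
      using that
    proof (induction G rule: finite_induct)
      case (insert p G)
      have "{f \<in> V. \<forall>p\<in>insert p G. q p f < ?d} = {f \<in> V. q p f < ?d} \<inter> {f \<in> V. \<forall>p\<in>G. q p f < ?d}" by auto
      then show ?case
        using insert seminorm_on_ball_open[OF V qC(1) P[OF qC(1)]] by auto
    qed (use openin_topspace[of ?E] in simp)
    then have "openin ?E W" using F unfolding W_def by blast
    moreover have "(\<lambda>x. 0) \<in> W"
    proof -
      have "q p (\<lambda>x. 0) = 0" if "p \<in> F" for p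
      proof -
        have "seminorm_on V (q p)" using P[OF qC(1)] that F(2) by blast
        from seminorm_onD(2)[OF this function_subspaceD(1)[OF V], of 0] show ?thesis by simp
      qed
      then show ?thesis using V pos[OF F(3,2)] by (auto simp: W_def function_subspace_def)
    qed
    moreover have "A f \<in> U" if "A \<in> H" "f \<in> W" for A f
    proof (rule F(4))
      show "A f \<in> V" using H that by (auto simp: linear_operator_def W_def)
      show "p (A f) < e" if "p \<in> F" for p
        using close[OF that F(1-3) \<open>A \<in> H\<close>, of f] that \<open>f \<in> W\<close> by (auto simp: W_def)
    qed
    ultimately show ?thesis by (intro exI[of _ W]) auto
  qed
  ultimately show ?thesis unfolding equicontinuous_operators_def by blast
qed

text \<open>Resolvents are defined by \<open>inv_into\<close> and agree with the explicit inverses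
  on V only; linearity on V transfers because V is a subspace.\<close>

lemma linear_operator_cong:
  assumes "linear_operator V A" "function_subspace V" "\<And>f. f \<in> V \<Longrightarrow> B f = A f"
  shows "linear_operator V B"
  using assms unfolding linear_operator_def function_subspace_def by simp

text \<open>All six claims come from an explicit inverse off the closure of G, bounded uniformly
  near each point, and from failure of bijectivity on G. A ball in the resolvent set misses G and,
  being open, misses its closure too.\<close>

lemma spectra_criterion:
  fixes A :: "('a \<Rightarrow> complex) \<Rightarrow> 'a \<Rightarrow> complex" and R :: "complex \<Rightarrow> ('a \<Rightarrow> complex) \<Rightarrow> 'a \<Rightarrow> complex"
  assumes E: "E = seminorm_topology V P" and V: "function_subspace V"
    and P: "\<And>p. p \<in> P \<Longrightarrow> seminorm_on V p"
    and maps: "\<And>l f. f \<in> V \<Longrightarrow> spectral_shift l A f \<in> V"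
    and R: "\<And>l. l \<notin> closure G \<Longrightarrow> linear_operator V (R l)"
    and inverse: "\<And>l f. l \<notin> closure G \<Longrightarrow> f \<in> V \<Longrightarrow> spectral_shift l A (R l f) = f"
      "\<And>l f. l \<notin> closure G \<Longrightarrow> f \<in> V \<Longrightarrow> R l (spectral_shift l A f) = f"
    and bound: "\<And>l \<delta> p. 0 < \<delta> \<Longrightarrow> \<forall>m\<in>ball l \<delta>. \<forall>z\<in>G. \<delta> \<le> dist m z \<Longrightarrow> p \<in> P \<Longrightarrow>
      \<exists>q\<in>P. \<exists>C\<ge>0. \<forall>m\<in>ball l \<delta>. \<forall>f\<in>V. p (R m f) \<le> C * q f"
    and not_bij: "\<And>l. l \<in> G \<Longrightarrow> \<not> bij_betw (spectral_shift l A) V V"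
  shows "- closure G \<subseteq> resolvent_set E A \<and> resolvent_set E A \<subseteq> - G \<and> star_resolvent_set E A = - closure G \<and>
    G \<subseteq> spectrum E A \<and> spectrum E A \<subseteq> closure G \<and> star_spectrum E A = closure G"
proof -
  have top: "topspace E = V" by (simp add: E)
  have bij: "bij_betw (spectral_shift l A) V V" if l: "l \<notin> closure G" for l
    using maps inverse[OF l] R[OF l] unfolding linear_operator_def
    by (intro bij_betw_byWitness[where f' = "R l"]) auto
  have res: "resolvent E l A f = R l f" if "l \<notin> closure G" "f \<in> V" for l f
  proof -
    have "R l f \<in> V" using R[OF that(1)] that(2) by (simp add: linear_operator_def)
    then show ?thesis
      unfolding resolvent_def top using bij[OF that(1)] inverse(1)[OF that] 
      by (intro inv_into_f_eq) (auto simp: bij_betw_def)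
  qed
  have star: "\<exists>\<delta>>0. ball l \<delta> \<subseteq> resolvent_set E A \<and> equicontinuous_operators E ((\<lambda>m. resolvent E m A) ` ball l \<delta>)"
    if l: "l \<notin> closure G" for l
  proof -
    have "open (- closure G)" by auto
    then obtain d where d: "0 < d" "ball l d \<subseteq> - closure G"
      using l by (meson ComplI openE)
    \<comment> \<open>Halving the radius keeps every point of the smaller ball at distance at least
      \<delta> from G, as the uniform bound requires.\<close>
    define \<delta> where "\<delta> = d / 2"
    have \<delta>: "0 < \<delta>" using d by (simp add: \<delta>_def)
    have sep: "\<forall>m\<in>ball l \<delta>. \<forall>z\<in>G. \<delta> \<le> dist m z"
    proof (intro ballI, rule ccontr)
      fix m z assume that: "m \<in> ball l \<delta>" "z \<in> G"
      assume "\<not> \<delta> \<le> dist m z"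
      then have "z \<in> ball l d" using that(1) dist_triangle[of l z m] by (simp add: \<delta>_def)
      then show False using d(2) that(2) closure_subset by blast
    qed
    have out: "m \<notin> closure G" if "m \<in> ball l \<delta>" for m
    proof -
      have "m \<in> ball l d" using that d(1) by (simp add: \<delta>_def)
      then show ?thesis using d(2) by blast
    qed
    have eq: "equicontinuous_operators E ((\<lambda>m. resolvent E m A) ` ball l \<delta>)"
      unfolding E
    proof (rule equicontinuous_family[OF V P], assumption)
      show "linear_operator V B" if "B \<in> (\<lambda>m. resolvent (seminorm_topology V P) m A) ` ball l \<delta>" for B
        using that out R res unfolding E by (blast intro: linear_operator_cong[OF _ V])
      show "\<exists>q\<in>P. \<exists>C\<ge>0. \<forall>B\<in>(\<lambda>m. resolvent (seminorm_topology V P) m A) ` ball l \<delta>. \<forall>f\<in>V. p (B f) \<le> C * q f"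
        if "p \<in> P" for p
        using bound[OF \<delta> sep that] res[OF out] unfolding E by simp
    qed
    \<comment> \<open>Continuity of each single resolvent is contained in
      \<open>equicontinuous_operators\<close>.\<close>
    moreover have "ball l \<delta> \<subseteq> resolvent_set E A"
      using bij[OF out] eq unfolding resolvent_set_def equicontinuous_operators_def top by blast
    ultimately show ?thesis using \<delta> by blast
  qed
  have 1: "- closure G \<subseteq> resolvent_set E A"
    using star by (meson ComplD centre_in_ball subset_iff)
  have 2: "resolvent_set E A \<subseteq> - G"
    using not_bij by (auto simp: resolvent_set_def top)
  have 3: "star_resolvent_set E A = - closure G"
  proof
    show "- closure G \<subseteq> star_resolvent_set E A"
      using star by (auto simp: star_resolvent_set_def)
    show "star_resolvent_set E A \<subseteq> - closure G"
    proof
      fix l assume "l \<in> star_resolvent_set E A"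
      then obtain \<delta> where "0 < \<delta>" "ball l \<delta> \<subseteq> - G"
        using 2 by (auto simp: star_resolvent_set_def)
      then have "ball l \<delta> \<inter> G = {}" by blast
      then have "ball l \<delta> \<inter> closure G = {}" by (simp add: open_Int_closure_eq_empty)
      then show "l \<in> - closure G" using \<open>0 < \<delta>\<close> centre_in_ball by blast
    qed
  qed
  show ?thesis
    using 1 2 3 unfolding spectrum_def star_spectrum_def by blast
qed

section \<open>The spectra of a convolution operator\<close>

definition inverse_symbol :: "(real \<Rightarrow> complex) \<Rightarrow> complex \<Rightarrow> real \<Rightarrow> complex" where
  "inverse_symbol g l = (\<lambda>\<xi>. inverse (l - g \<xi>))"

text \<open>\<open>dbound_inverse\<close> sees m only through a lower bound of |m - g| and an upper
  bound of |m|, so its output serves the whole set M: a ball for equicontinuity, a single point for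
  membership in \<open>OM\<close>.\<close>

lemma inverse_symbol_dbound:
  assumes g: "g \<in> OM" and \<delta>: "0 < \<delta>" and sep: "\<And>m \<xi>. m \<in> M \<Longrightarrow> \<delta> \<le> dist m (g \<xi>)"
    and bdd: "\<And>m. m \<in> M \<Longrightarrow> cmod m \<le> B"
  shows "\<exists>q C. 0 \<le> q \<and> (\<forall>m\<in>M. inverse_symbol g m \<in> C_infinity \<and> dbound N q C (inverse_symbol g m))"
proof -
  obtain q A where A: "0 \<le> q" "dbound N q A g" using g OM_iff by metis
  obtain q' C where C: "0 \<le> q'" "0 \<le> C" "\<And>u. u \<in> C_infinity \<Longrightarrow> (\<And>x. \<delta> \<le> cmod (u x)) \<Longrightarrow>
      dbound N q (B + A) u \<Longrightarrow> dbound N q' C (\<lambda>x. inverse (u x))"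
    using dbound_inverse[OF A(1), where \<delta> = \<delta> and A = "B + A" and m = N] \<delta> by blast
  have "inverse_symbol g m \<in> C_infinity \<and> dbound N q' C (inverse_symbol g m)" if m: "m \<in> M" for m
  proof -
    have u: "(\<lambda>\<xi>. m - g \<xi>) \<in> C_infinity"
      by (intro C_infinity_diff C_infinity_const OM_smooth g)
    have s: "\<delta> \<le> cmod (m - g \<xi>)" for \<xi> using sep[OF m, of \<xi>] by (simp add: dist_norm)
    have "dbound N q (B + A) (\<lambda>\<xi>. m - g \<xi>)"
      by (intro dbound_diff C_infinity_const OM_smooth g A dbound_mono[OF dbound_const]) (use A bdd[OF m] in auto)
    with u s have "dbound N q' C (\<lambda>\<xi>. inverse (m - g \<xi>))" by (intro C(3))
    moreover have "m - g \<xi> \<noteq> 0" for \<xi> using s[of \<xi>] \<delta> by auto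
    then have "(\<lambda>\<xi>. inverse (m - g \<xi>)) \<in> C_infinity" by (rule C_infinity_inverse[OF u])
    ultimately show ?thesis by (simp add: inverse_symbol_def)
  qed
  then show ?thesis using C(1) by blast
qed

lemma inverse_symbol_dbound_ball:
  assumes "g \<in> OM" "0 < \<delta>" "\<forall>m\<in>ball l \<delta>. \<forall>z\<in>range g. \<delta> \<le> dist m z"
  shows "\<exists>q C. 0 \<le> q \<and> (\<forall>m\<in>ball l \<delta>. inverse_symbol g m \<in> C_infinity \<and> dbound N q C (inverse_symbol g m))"
proof (rule inverse_symbol_dbound[OF assms(1,2)])
  show "\<delta> \<le> dist m (g \<xi>)" if "m \<in> ball l \<delta>" for m \<xi> using assms(3) that by auto
  show "cmod m \<le> cmod l + \<delta>" if "m \<in> ball l \<delta>" for m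
    using that norm_triangle_sub[of m l] by (simp add: dist_norm norm_minus_commute)
qed

lemma inverse_symbol_OM_ball:
  assumes "g \<in> OM" "0 < \<delta>" "\<forall>m\<in>ball l \<delta>. \<forall>z\<in>range g. \<delta> \<le> dist m z" "m \<in> ball l \<delta>"
  shows "inverse_symbol g m \<in> OM"
  unfolding OM_iff using inverse_symbol_dbound_ball[OF assms(1-3)] assms(4) by meson

lemma inverse_symbol_OM:
  assumes g: "g \<in> OM" and l: "l \<notin> closure (range g)"
  shows "inverse_symbol g l \<in> OM" "inverse_symbol g l \<xi> * (l - g \<xi>) = 1"
proof -
  obtain d where d: "0 < d" "\<And>z. z \<in> range g \<Longrightarrow> d \<le> dist z l"
    using l unfolding closure_approachable by (meson not_le)
  have "\<exists>q C. 0 \<le> q \<and> (\<forall>m\<in>{l}. inverse_symbol g m \<in> C_infinity \<and> dbound N q C (inverse_symbol g m))" for N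
  proof (rule inverse_symbol_dbound[OF g d(1), of _ "cmod l"])
    show "d \<le> dist m (g \<xi>)" if "m \<in> {l}" for m \<xi>
      using d(2)[of "g \<xi>"] that by (simp add: dist_commute)
  qed simp
  then show "inverse_symbol g l \<in> OM" unfolding OM_iff by blast
  have "l - g \<xi> \<noteq> 0" using d(1) d(2)[of "g \<xi>"] by auto
  then show "inverse_symbol g l \<xi> * (l - g \<xi>) = 1" by (simp add: inverse_symbol_def)
qed

section \<open>Spectra on the Schwartz space\<close>

lemma function_subspace_schwartz: "function_subspace schwartz"
proof -
  have "(\<lambda>x. 0 * gauss x) \<in> schwartz" by (intro schwartz_cmult gauss_schwartz)
  then show ?thesis by (auto simp: function_subspace_def schwartz_add schwartz_cmult)
qed

lemma function_subspace_OC: "function_subspace OC"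
  by (auto simp: function_subspace_def OC_add OC_cmult OC_step_OC[OF zero_OC_step])

lemma schwartz_norm_dbound: "f \<in> schwartz \<Longrightarrow> dbound n (- int n) (schwartz_norm n f) f"
  using schwartz_norm_le_iff[of f n "schwartz_norm n f"] by simp

lemma seminorm_on_schwartz: "seminorm_on schwartz (schwartz_norm n)"
proof -
  have le: "schwartz_norm n (\<lambda>x. c * f x) \<le> cmod c * schwartz_norm n f" if "f \<in> schwartz" for f c
    using that schwartz_norm_le_iff[OF schwartz_cmult[OF that]]
      dbound_cmult[OF schwartz_smooth[OF that] schwartz_norm_dbound[OF that]] by blast
  have nn: "0 \<le> schwartz_norm n f" if "f \<in> schwartz" for f
    by (rule dbound_nonneg[OF schwartz_norm_dbound[OF that]])
  have "schwartz_norm n (\<lambda>x. f x + g x) \<le> schwartz_norm n f + schwartz_norm n g"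
    if "f \<in> schwartz" "g \<in> schwartz" for f g
    using that schwartz_norm_le_iff[OF schwartz_add[OF that]]
      dbound_add[OF schwartz_smooth[OF that(1)] schwartz_smooth[OF that(2)]
        schwartz_norm_dbound[OF that(1)] schwartz_norm_dbound[OF that(2)]] by blast
  then show ?thesis using nn le by (intro seminorm_onI function_subspace_schwartz)
qed

lemma spectral_shift_schwartz:
  assumes "OC_functional T" "f \<in> schwartz"
  shows "spectral_shift l (convolution T) f = fmult (\<lambda>\<xi>. l - ft T \<xi>) f"
  using assms by (simp add: spectral_shift_def convolution_schwartz fmult_shift ft_OM)

lemma spectral_shift_OC:
  assumes "OC_functional T" "f \<in> OC"
  shows "spectral_shift l (convolution T) f = omult (\<lambda>\<xi>. l - ft T \<xi>) f"
  using assms by (simp add: spectral_shift_def convolution_OC omult_shift ft_OM)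

text \<open>\<open>gauss\<close> has no zeros, so its Fourier preimage is a Schwartz function that
  is not attained.\<close>

lemma not_surj_schwartz:
  assumes "h \<in> OM" "h \<xi> = 0"
  shows "\<not> bij_betw (fmult h) schwartz schwartz"
proof
  assume "bij_betw (fmult h) schwartz schwartz"
  moreover obtain f where f: "f \<in> schwartz" "fourier f = gauss" using fourier_surj[OF gauss_schwartz] .
  ultimately obtain u where u: "u \<in> schwartz" "f = fmult h u"
    by (metis bij_betw_imp_surj_on imageE)
  have "gauss \<xi> = h \<xi> * fourier u \<xi>"
    using f(2) unfolding u(2) fourier_fmult[OF assms(1) u(1)] by (rule fun_cong[symmetric])
  then show False using assms(2) by (simp add: gauss_def)
qed

lemma spectra_schwartz:
  fixes T :: "(real \<Rightarrow> complex) \<Rightarrow> complex"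
  assumes T: "OC_functional T"
  defines "G \<equiv> range (ft T)" and "A \<equiv> convolution T"
  shows "- closure G \<subseteq> resolvent_set schwartz_space A \<and> resolvent_set schwartz_space A \<subseteq> - G \<and>
    star_resolvent_set schwartz_space A = - closure G \<and> G \<subseteq> spectrum schwartz_space A \<and>
    spectrum schwartz_space A \<subseteq> closure G \<and> star_spectrum schwartz_space A = closure G"
proof (rule spectra_criterion[where V = schwartz and P = "range schwartz_norm" and R = "\<lambda>l. fmult (inverse_symbol (ft T) l)"])
  note g = ft_OM[OF T]
  have lg: "(\<lambda>\<xi>. l - ft T \<xi>) \<in> OM" for l by (intro OM_diff OM_const g)
  show "schwartz_space = seminorm_topology schwartz (range schwartz_norm)" by (rule schwartz_space_def)
  show "function_subspace schwartz" by (rule function_subspace_schwartz)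
  show "seminorm_on schwartz p" if "p \<in> range schwartz_norm" for p
    using that seminorm_on_schwartz by blast
  show "spectral_shift l A f \<in> schwartz" if "f \<in> schwartz" for l f
    unfolding A_def spectral_shift_schwartz[OF T that] by (intro fmult_schwartz lg that)
  fix l :: complex
  show "linear_operator schwartz (fmult (inverse_symbol (ft T) l))" if "l \<notin> closure G"
    using inverse_symbol_OM(1)[OF g] that
    by (auto simp: linear_operator_def G_def fmult_schwartz fmult_add fmult_cmult)
  show "spectral_shift l A (fmult (inverse_symbol (ft T) l) f) = f" if "l \<notin> closure G" "f \<in> schwartz" for f
    using that inverse_symbol_OM[OF g, of l] lg unfolding G_def A_def
    by (simp add: spectral_shift_schwartz[OF T] fmult_schwartz fmult_mult mult.commute[of "l - _"] fmult_one)
  show "fmult (inverse_symbol (ft T) l) (spectral_shift l A f) = f" if "l \<notin> closure G" "f \<in> schwartz" for f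
    using that inverse_symbol_OM[OF g, of l] lg unfolding G_def A_def
    by (simp add: spectral_shift_schwartz[OF T] fmult_mult fmult_one)
  show "\<not> bij_betw (spectral_shift l A) schwartz schwartz" if "l \<in> G"
  proof -
    obtain \<xi> where "ft T \<xi> = l" using \<open>l \<in> G\<close> by (auto simp: G_def)
    then have "\<not> bij_betw (fmult (\<lambda>\<xi>. l - ft T \<xi>)) schwartz schwartz"
      by (intro not_surj_schwartz[OF lg, of _ \<xi>]) simp
    then show ?thesis
      using bij_betw_cong[of schwartz "spectral_shift l A" "fmult (\<lambda>\<xi>. l - ft T \<xi>)"] spectral_shift_schwartz[OF T]
      unfolding A_def by blast
  qed
  fix \<delta> :: real and p
  assume \<delta>: "0 < \<delta>" and sep: "\<forall>m\<in>ball l \<delta>. \<forall>z\<in>G. \<delta> \<le> dist m z" and p: "p \<in> range schwartz_norm"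
  obtain n where n: "p = schwartz_norm n" using p by blast
  note sep' = sep[unfolded G_def]
  obtain q B where q: "0 \<le> q" "\<And>m. m \<in> ball l \<delta> \<Longrightarrow> dbound (2 * Suc n) q B (inverse_symbol (ft T) m)"
    using inverse_symbol_dbound_ball[OF g \<delta> sep', where N = "2 * Suc n"] by blast
  obtain C where C: "0 \<le> C" "\<And>h f m A. h \<in> OM \<Longrightarrow> dbound (2 * Suc n) q B h \<Longrightarrow> f \<in> schwartz \<Longrightarrow>
      dbound (m + 2 * Suc (nat q)) (- int n) A f \<Longrightarrow> dbound m (- int n) (C * A) (fmult h f)"
    using fmult_dbound[OF q(1), of "- int n" B] by auto
  \<comment> \<open>The multiplier costs 2 (q + 1) derivatives; as k is at least n, the Schwartz
    norm of index k also dominates the weight of index n.\<close>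
  define k where "k = n + 2 * Suc (nat q)"
  have "p (fmult (inverse_symbol (ft T) m) f) \<le> C * schwartz_norm k f" if m: "m \<in> ball l \<delta>" and f: "f \<in> schwartz" for m f
  proof -
    note h = inverse_symbol_OM_ball[OF g \<delta> sep' m]
    have "dbound k (- int n) (schwartz_norm k f) f"
      by (rule dbound_mono[OF schwartz_norm_dbound[OF f]]) (auto simp: k_def)
    then have "dbound n (- int n) (C * schwartz_norm k f) (fmult (inverse_symbol (ft T) m) f)"
      unfolding k_def by (intro C(2) h q(2) m f)
    then show ?thesis
      by (simp only: n schwartz_norm_le_iff[OF fmult_schwartz[OF h f]])
  qed
  then show "\<exists>q\<in>range schwartz_norm. \<exists>C\<ge>0. \<forall>m\<in>ball l \<delta>. \<forall>f\<in>schwartz. p (fmult (inverse_symbol (ft T) m) f) \<le> C * q f"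
    using C(1) by blast
qed

text \<open>Converse of \<open>OC_seminorm_bound\<close>; through it a supremum over a family of
  resolvents is recognised as a continuous seminorm.\<close>

lemma OC_seminormI:
  assumes q: "seminorm_on OC q"
    and b: "\<And>n. 1 \<le> n \<Longrightarrow> \<exists>m C. 0 \<le> C \<and> (\<forall>f\<in>OC_step n. \<forall>A. dbound m (int n) A f \<longrightarrow> q f \<le> C * A)"
  shows "OC_seminorm q"
  unfolding OC_seminorm_def
proof (intro conjI allI impI q)
  fix n :: nat assume n: "1 \<le> n"
  obtain m C where C: "0 \<le> C" "\<And>f A. f \<in> OC_step n \<Longrightarrow> dbound m (int n) A f \<Longrightarrow> q f \<le> C * A"
    using b[OF n] by blast
  have tri: "q f \<le> q (\<lambda>x. f x - g x) + q g" if "f \<in> OC" "g \<in> OC" for f g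
  proof -
    have "q (\<lambda>x. (f x - g x) + g x) \<le> q (\<lambda>x. f x - g x) + q g"
      by (intro seminorm_onD(3)[OF q] OC_diff that)
    then show ?thesis by simp
  qed
  have "openin (OC_step_space n) {f \<in> OC_step n. q f \<in> U}" if U: "open U" for U
    unfolding OC_step_space_def openin_seminorm_topology
  proof (intro conjI ballI)
    fix f assume f: "f \<in> {f \<in> OC_step n. q f \<in> U}"
    then obtain e where e: "0 < e" "\<And>y. \<bar>y - q f\<bar> < e \<Longrightarrow> y \<in> U"
      using U by (auto simp: open_dist dist_real_def)
    \<comment> \<open>The topology of a step is generated by growth norms of order at least
      1.\<close>
    define k where "k = max m 1"
    define d where "d = e / (C + 1)"
    have d: "0 < d" "C * d < e" using e C(1) by (auto simp: d_def field_simps)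
    have "g \<in> {f \<in> OC_step n. q f \<in> U}" if g: "g \<in> OC_step n" "growth_norm k n (\<lambda>x. g x - f x) < d" for g
    proof -
      have f': "f \<in> OC_step n" using f by simp
      have *: "q u \<le> C * d" if "u \<in> OC_step n" "growth_norm k n u < d" for u
      proof -
        have "dbound k (int n) d u" using that growth_norm_le_iff[OF that(1), of k d] by simp
        then have "dbound m (int n) d u" by (rule dbound_mono) (auto simp: k_def)
        then show ?thesis by (rule C(2)[OF that(1)])
      qed
      \<comment> \<open>Both differences are estimated, one for each direction of the triangle
        inequality; a change of sign does not affect \<open>dbound\<close>.\<close>
      have "dbound k (int n) d (\<lambda>x. g x - f x)"
        using g growth_norm_le_iff[OF OC_step_diff[OF g(1) f'], of k d] by simp
      then have "dbound k (int n) d (\<lambda>x. -1 * (g x - f x))"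
        using dbound_cmult[OF OC_step_smooth[OF OC_step_diff[OF g(1) f']], of k "int n" d "-1"] by simp
      then have "dbound k (int n) d (\<lambda>x. f x - g x)" by simp
      then have "dbound m (int n) d (\<lambda>x. f x - g x)" by (rule dbound_mono) (auto simp: k_def)
      then have "q (\<lambda>x. f x - g x) \<le> C * d" by (rule C(2)[OF OC_step_diff[OF f' g(1)]])
      moreover have "q (\<lambda>x. g x - f x) \<le> C * d" by (rule *[OF OC_step_diff[OF g(1) f'] g(2)])
      ultimately have "\<bar>q g - q f\<bar> < e"
        using tri[OF OC_step_OC[OF g(1)] OC_step_OC[OF f']] tri[OF OC_step_OC[OF f'] OC_step_OC[OF g(1)]] d(2) by linarith
      then show ?thesis using e(2) g(1) by simp
    qed
    then show "\<exists>F d. finite F \<and> F \<subseteq> {growth_norm m n |m. 1 \<le> m} \<and> 0 < d \<and>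
        {g \<in> OC_step n. \<forall>p\<in>F. p (\<lambda>x. g x - f x) < d} \<subseteq> {f \<in> OC_step n. q f \<in> U}"
      using d(1) by (intro exI[of _ "{growth_norm k n}"] exI[of _ d]) (auto simp: k_def)
  qed auto
  then show "continuous_map (OC_step_space n) euclideanreal q"
    by (auto simp: continuous_map_def OC_step_space_def)
qed

text \<open>The supremum over the family is again one of the seminorms that generate the
  inductive limit topology, so the family is equicontinuous.\<close>

lemma omult_family_bound:
  assumes g: "g \<in> OM" and \<delta>: "0 < \<delta>" and sep: "\<forall>m\<in>ball l \<delta>. \<forall>z\<in>range g. \<delta> \<le> dist m z"
    and p: "OC_seminorm p"
  shows "\<exists>q. OC_seminorm q \<and> (\<forall>m\<in>ball l \<delta>. \<forall>f\<in>OC. p (omult (inverse_symbol g m) f) \<le> q f)"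
proof -
  let ?R = "\<lambda>m. omult (inverse_symbol g m)"
  note OM = inverse_symbol_OM_ball[OF g \<delta> sep]
  define q where "q f = (SUP m\<in>ball l \<delta>. p (?R m f))" for f
  have ps: "seminorm_on OC p" using p by (simp add: OC_seminorm_def)
  \<comment> \<open>The supremum runs over a non-empty set, which its least upper bound property and
    its nonnegativity require.\<close>
  have l: "l \<in> ball l \<delta>" using \<delta> by simp
  \<comment> \<open>Each resolvent maps step n into step n + 1, so p is estimated there; the
    constants are common to all k in the ball.\<close>
  have est: "\<exists>m C. 0 \<le> C \<and> (\<forall>k\<in>ball l \<delta>. \<forall>f\<in>OC_step n. \<forall>A. dbound m (int n) A f \<longrightarrow> p (?R k f) \<le> C * A)"
    if n: "1 \<le> n" for n
  proof -
    obtain m C where C: "0 \<le> C" "\<And>f A. f \<in> OC_step (Suc n) \<Longrightarrow> dbound m (int (Suc n)) A f \<Longrightarrow> p f \<le> C * A"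
      using OC_seminorm_bound[OF p, of "Suc n"] by auto
    obtain q B where q: "0 \<le> q" "\<And>k. k \<in> ball l \<delta> \<Longrightarrow> dbound (2 * Suc (Suc n)) q B (inverse_symbol g k)"
      using inverse_symbol_dbound_ball[OF g \<delta> sep, where N = "2 * Suc (Suc n)"] by blast
    obtain D where D: "0 \<le> D" "\<And>h f A. h \<in> OM \<Longrightarrow> dbound (2 * Suc (Suc n)) q B h \<Longrightarrow> f \<in> OC_step n \<Longrightarrow>
        dbound (m + 2 * Suc (nat q)) (int n) A f \<Longrightarrow> dbound m (int n + 1) (D * A) (omult h f)"
      using omult_dbound[OF q(1), of n B m] by blast
    have "p (?R k f) \<le> C * D * A"
      if "k \<in> ball l \<delta>" "f \<in> OC_step n" "dbound (m + 2 * Suc (nat q)) (int n) A f" for k f A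
    proof -
      have "dbound m (int (Suc n)) (D * A) (?R k f)"
        using D(2)[OF OM[OF that(1)] q(2)[OF that(1)] that(2,3)] by (simp add: add.commute)
      from C(2)[OF omult_OC_step[OF OM[OF that(1)] that(2)] this] show ?thesis by (simp add: mult.assoc)
    qed
    then show ?thesis
      using C(1) D(1) by (intro exI[of _ "m + 2 * Suc (nat q)"] exI[of _ "C * D"]) auto
  qed
  have bdd: "bdd_above ((\<lambda>k. p (?R k f)) ` ball l \<delta>)" if f: "f \<in> OC" for f
  proof -
    obtain n where n: "1 \<le> n" "f \<in> OC_step n" using f OC_iff by metis
    obtain m C where C: "\<And>k A. k \<in> ball l \<delta> \<Longrightarrow> dbound m (int n) A f \<Longrightarrow> p (?R k f) \<le> C * A"
      using est[OF n(1)] n(2) by blast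
    obtain A where "dbound m (int n) A f" using OC_step_bound[OF n(2)] by blast
    with C show ?thesis by (auto intro!: bdd_aboveI[of _ "C * A"])
  qed
  have upper: "p (?R k f) \<le> q f" if "k \<in> ball l \<delta>" "f \<in> OC" for k f
    unfolding q_def by (rule cSUP_upper[OF that(1) bdd[OF that(2)]])
  have least: "q f \<le> c" if "\<And>k. k \<in> ball l \<delta> \<Longrightarrow> p (?R k f) \<le> c" for f c
    unfolding q_def using l by (intro cSUP_least that) auto
  have nn: "0 \<le> q f" if f: "f \<in> OC" for f
    using seminorm_onD(1)[OF ps omult_OC[OF OM[OF l] f]] upper[OF l f] by (rule order_trans)
  have le: "q (\<lambda>x. c * f x) \<le> cmod c * q f" if f: "f \<in> OC" for f c
  proof (rule least)
    fix k assume k: "k \<in> ball l \<delta>"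
    have "p (?R k (\<lambda>x. c * f x)) = cmod c * p (?R k f)"
      unfolding omult_cmult[OF OM[OF k] f] by (rule seminorm_onD(2)[OF ps omult_OC[OF OM[OF k] f]])
    then show "p (?R k (\<lambda>x. c * f x)) \<le> cmod c * q f"
      using upper[OF k f] by (simp add: mult_left_mono)
  qed
  have add: "q (\<lambda>x. f x + f' x) \<le> q f + q f'" if f: "f \<in> OC" "f' \<in> OC" for f f'
  proof (rule least)
    fix k assume k: "k \<in> ball l \<delta>"
    have "p (?R k (\<lambda>x. f x + f' x)) \<le> p (?R k f) + p (?R k f')"
      unfolding omult_add[OF OM[OF k] f]
      by (intro seminorm_onD(3)[OF ps] omult_OC[OF OM[OF k]] f)
    then show "p (?R k (\<lambda>x. f x + f' x)) \<le> q f + q f'"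
      using upper[OF k f(1)] upper[OF k f(2)] by linarith
  qed
  have "seminorm_on OC q" using nn le add by (intro seminorm_onI function_subspace_OC)
  moreover have "\<exists>m C. 0 \<le> C \<and> (\<forall>f\<in>OC_step n. \<forall>A. dbound m (int n) A f \<longrightarrow> q f \<le> C * A)" if n: "1 \<le> n" for n
  proof -
    obtain m C where C: "0 \<le> C" "\<And>k f A. k \<in> ball l \<delta> \<Longrightarrow> f \<in> OC_step n \<Longrightarrow> dbound m (int n) A f \<Longrightarrow> p (?R k f) \<le> C * A"
      using est[OF n] by blast
    then have "q f \<le> C * A" if "f \<in> OC_step n" "dbound m (int n) A f" for f A
      using that by (intro least)
    then show ?thesis using C(1) by blast
  qed
  ultimately have "OC_seminorm q" by (rule OC_seminormI)
  then show ?thesis using upper by blast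
qed

lemma not_inj_OC:
  assumes T: "OC_functional T"
  shows "\<not> bij_betw (spectral_shift (ft T \<xi>) (convolution T)) OC OC"
proof
  assume "bij_betw (spectral_shift (ft T \<xi>) (convolution T)) OC OC"
  then have inj: "inj_on (spectral_shift (ft T \<xi>) (convolution T)) OC" by (rule bij_betw_imp_inj_on)
  have "convolution T (ce (- \<xi>)) x = ft T \<xi> * ce (- \<xi>) x" for x
  proof -
    \<comment> \<open>The sign is reversed because the convolution reflects the argument: the part
      depending on y is then \<open>ce \<xi>\<close>, on which T has the value
      \<open>ft T \<xi>\<close>.\<close>
    have "ce (- \<xi>) (x - y) = ce (- \<xi>) x * ce \<xi> y" for y
      using ce_add_right[of "- \<xi>" x "- y"] by (simp add: ce_minus)
    then have "convolution T (ce (- \<xi>)) x = T (\<lambda>y. ce (- \<xi>) x * ce \<xi> y)"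
      by (simp only: convolution_def)
    also have "\<dots> = ce (- \<xi>) x * T (ce \<xi>)"
      by (rule OC_functional_cmult[OF T ce_OC])
    finally show ?thesis by (simp only: ft_def mult.commute)
  qed
  then have 1: "spectral_shift (ft T \<xi>) (convolution T) (ce (- \<xi>)) = (\<lambda>x. 0)"
    by (simp add: spectral_shift_def)
  have "T (\<lambda>y. 0) = 0"
    using OC_functional_cmult[OF T ce_OC, of 0] by simp
  then have 2: "spectral_shift (ft T \<xi>) (convolution T) (\<lambda>x. 0) = (\<lambda>x. 0)"
    by (simp add: spectral_shift_def convolution_def)
  have "ce (- \<xi>) = (\<lambda>x. 0)"
    using inj_onD[OF inj _ ce_OC OC_step_OC[OF zero_OC_step]] 1 2 by simp
  then show False using norm_ce[of "- \<xi>" 0] by simp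
qed

lemma spectra_OC:
  fixes T :: "(real \<Rightarrow> complex) \<Rightarrow> complex"
  assumes T: "OC_functional T"
  defines "G \<equiv> range (ft T)" and "A \<equiv> convolution T"
  shows "- closure G \<subseteq> resolvent_set OC_space A \<and> resolvent_set OC_space A \<subseteq> - G \<and>
    star_resolvent_set OC_space A = - closure G \<and> G \<subseteq> spectrum OC_space A \<and>
    spectrum OC_space A \<subseteq> closure G \<and> star_spectrum OC_space A = closure G"
proof (rule spectra_criterion[where V = OC and P = "{p. OC_seminorm p}" and R = "\<lambda>l. omult (inverse_symbol (ft T) l)"])
  note g = ft_OM[OF T]
  have lg: "(\<lambda>\<xi>. l - ft T \<xi>) \<in> OM" for l by (intro OM_diff OM_const g)
  show "OC_space = seminorm_topology OC {p. OC_seminorm p}" by (rule OC_space_seminorm)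
  show "function_subspace OC" by (rule function_subspace_OC)
  show "seminorm_on OC p" if "p \<in> {p. OC_seminorm p}" for p
    using that by (simp add: OC_seminorm_def)
  show "spectral_shift l A f \<in> OC" if "f \<in> OC" for l f
    unfolding A_def spectral_shift_OC[OF T that] by (intro omult_OC lg that)
  fix l :: complex
  show "linear_operator OC (omult (inverse_symbol (ft T) l))" if "l \<notin> closure G"
    using inverse_symbol_OM(1)[OF g] that
    by (auto simp: linear_operator_def G_def omult_OC omult_add omult_cmult)
  show "spectral_shift l A (omult (inverse_symbol (ft T) l) f) = f" if "l \<notin> closure G" "f \<in> OC" for f
    using that inverse_symbol_OM[OF g, of l] lg unfolding G_def A_def
    by (simp add: spectral_shift_OC[OF T] omult_OC omult_omult mult.commute[of "l - _"] omult_one)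
  show "omult (inverse_symbol (ft T) l) (spectral_shift l A f) = f" if "l \<notin> closure G" "f \<in> OC" for f
    using that inverse_symbol_OM[OF g, of l] lg unfolding G_def A_def
    by (simp add: spectral_shift_OC[OF T] omult_omult omult_one)
  show "\<not> bij_betw (spectral_shift l A) OC OC" if "l \<in> G"
    using that not_inj_OC[OF T] unfolding G_def A_def by auto
  fix \<delta> :: real and p
  assume \<delta>: "0 < \<delta>" and sep: "\<forall>m\<in>ball l \<delta>. \<forall>z\<in>G. \<delta> \<le> dist m z" and p: "p \<in> {p. OC_seminorm p}"
  obtain q where "OC_seminorm q" "\<And>m f. m \<in> ball l \<delta> \<Longrightarrow> f \<in> OC \<Longrightarrow> p (omult (inverse_symbol (ft T) m) f) \<le> q f"
    using omult_family_bound[OF g \<delta> sep[unfolded G_def]] p by blast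
  then show "\<exists>q\<in>{p. OC_seminorm p}. \<exists>C\<ge>0. \<forall>m\<in>ball l \<delta>. \<forall>f\<in>OC. p (omult (inverse_symbol (ft T) m) f) \<le> C * q f"
    by (intro bexI[of _ q] exI[of _ 1]) auto
qed

section \<open>Bump functions and the point spectrum\<close>

text \<open>\<open>flat 0\<close> is the classical smooth function e^(-1/x) on the positive axis;
  the powers of 1/x appear when it is differentiated.\<close>

definition flat :: "nat \<Rightarrow> real \<Rightarrow> complex" where
  "flat k x = (if 0 < x then of_real (inverse x ^ k * exp (- inverse x)) else 0)"

text \<open>The inequality t \<le> e^t at t = y / n, raised to the power n. At y = 1/x it shows that
  e^(-1/x) beats every power of 1/x near 0.\<close>

lemma power_le_exp: "0 \<le> y \<Longrightarrow> y ^ n \<le> real n ^ n * exp y" for y :: real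
proof (cases "n = 0")
  case False
  assume y: "0 \<le> y"
  have "y ^ n = real n ^ n * (y / real n) ^ n" using False by (simp add: power_divide)
  also have "\<dots> \<le> real n ^ n * exp (y / real n) ^ n"
  proof (intro mult_left_mono power_mono)
    show "y / real n \<le> exp (y / real n)"
      using exp_ge_add_one_self[of "y / real n"] by linarith
  qed (use y in auto)
  also have "exp (y / real n) ^ n = exp (real n * (y / real n))" by (simp only: exp_of_nat_mult)
  finally show ?thesis using False by simp
qed simp

text \<open>The family is closed under differentiation up to linear combinations; this gives smoothness
  without formulas for the higher derivatives.\<close>

lemma flat_vderiv:
  "(flat k has_vector_derivative (- of_nat k) * flat (Suc k) x + flat (k + 2) x) (at x)"
proof -
  let ?r = "\<lambda>x::real. inverse x ^ k * exp (- inverse x)"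
  consider "0 < x" | "x < 0" | "x = 0" by linarith
  then show ?thesis
  proof cases
    case 1
    have "(?r has_real_derivative - real k * (inverse x ^ Suc k * exp (- inverse x)) + inverse x ^ (k + 2) * exp (- inverse x)) (at x)"
    proof -
      have i: "(inverse has_real_derivative - (inverse x * inverse x)) (at x)"
        using DERIV_inverse[of x] 1 by (simp add: power2_eq_square)
      have p: "((\<lambda>x. inverse x ^ n) has_real_derivative - real n * inverse x ^ Suc n) (at x)" for n
      proof (induction n)
        case (Suc n)
        from DERIV_mult[OF i Suc] show ?case by (simp add: algebra_simps)
      qed simp
      from DERIV_mult[OF p[of k] DERIV_fun_exp[OF DERIV_minus[OF i]]]
      show ?thesis by (simp add: algebra_simps)
    qed
    from has_vector_derivative_of_real[OF this]
    have "((\<lambda>x. complex_of_real (?r x)) has_vector_derivative of_real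
        (- real k * (inverse x ^ Suc k * exp (- inverse x)) + inverse x ^ (k + 2) * exp (- inverse x))) (at x)" .
    also have "complex_of_real (- real k * (inverse x ^ Suc k * exp (- inverse x)) + inverse x ^ (k + 2) * exp (- inverse x))
        = (- of_nat k) * flat (Suc k) x + flat (k + 2) x"
      using 1 by (simp add: flat_def)
    finally show ?thesis
      by (rule has_vector_derivative_transform_within_open[where S = "{0<..}"])
        (use 1 in \<open>auto simp: flat_def\<close>)
  next
    case 2
    have "((\<lambda>x. 0) has_vector_derivative (- of_nat k) * flat (Suc k) x + flat (k + 2) x) (at x)"
      using 2 by (simp add: flat_def)
    then show ?thesis
      by (rule has_vector_derivative_transform_within_open[where S = "{..<0}"])
        (use 2 in \<open>auto simp: flat_def\<close>)
  next
    case 3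
    have "(flat k has_vector_derivative 0) (at 0)"
    proof (rule has_vector_derivative_quadratic)
      fix h :: real
      \<comment> \<open>The exponent k + 2 absorbs the factor (1/h)^k and leaves h^2, the quadratic
        bound that gives derivative 0 at the origin.\<close>
      let ?K = "real (k + 2) ^ (k + 2)"
      have "cmod (flat k h) \<le> ?K * h\<^sup>2"
      proof (cases "0 < h")
        case True
        have "inverse h ^ (k + 2) \<le> ?K * exp (inverse h)"
          using True by (intro power_le_exp) auto
        then have "inverse h ^ (k + 2) * exp (- inverse h) \<le> ?K * exp (inverse h) * exp (- inverse h)"
          by (rule mult_right_mono) simp
        also have "\<dots> = ?K" by (simp only: mult.assoc exp_minus_inverse mult_1_right)
        also have "inverse h ^ (k + 2) * exp (- inverse h) = inverse h ^ k * exp (- inverse h) * (inverse h)\<^sup>2"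
          by (simp only: power_add mult_ac)
        finally have "inverse h ^ k * exp (- inverse h) * (inverse h)\<^sup>2 \<le> ?K" .
        then have "inverse h ^ k * exp (- inverse h) * (inverse h)\<^sup>2 * h\<^sup>2 \<le> ?K * h\<^sup>2"
          by (rule mult_right_mono) simp
        moreover have "(inverse h)\<^sup>2 * h\<^sup>2 = 1" using True by (simp flip: power_mult_distrib)
        ultimately have "inverse h ^ k * exp (- inverse h) \<le> ?K * h\<^sup>2"
          by (simp only: mult.assoc mult_1_right)
        then show ?thesis using True by (simp only: flat_def if_True norm_of_real) simp
      qed (simp add: flat_def)
      then show "cmod (flat k (0 + h) - flat k 0 - of_real h * 0) \<le> ?K * h\<^sup>2"
        by (simp add: flat_def)
    qed
    then show ?thesis by (simp add: 3 flat_def)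
  qed
qed

lemma flat_smooth: "flat k \<in> C_infinity"
proof -
  have "ndiff n (flat k)" for n
  proof (induction n arbitrary: k)
    case (Suc n)
    have "dv (flat k) = (\<lambda>x. (- of_nat k) * flat (Suc k) x + flat (k + 2) x)"
      by (intro dv_eqI flat_vderiv)
    moreover have "ndiff n (\<lambda>x. (- of_nat k) * flat (Suc k) x + flat (k + 2) x)"
      by (intro ndiff_add ndiff_mult ndiff_const Suc)
    ultimately show ?case
      using differentiableI_vector[OF flat_vderiv] by (simp add: ndiff_Suc)
  qed simp
  then show ?thesis by (simp add: C_infinity_iff_ndiff)
qed

text \<open>The complement of the interval is open, so all derivatives vanish there too; on the
  interval continuity gives the bounds.\<close>

lemma compact_support_schwartz:
  assumes f: "f \<in> C_infinity" and supp: "\<And>x. x \<notin> {a..b} \<Longrightarrow> f x = 0"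
  shows "f \<in> schwartz"
proof -
  have z: "nth_deriv i f x = 0" if "x \<notin> {a..b}" for i x
    using that
  proof (induction i arbitrary: x)
    case (Suc i)
    have "((\<lambda>x. 0) has_vector_derivative 0) (at x)" by simp
    then have "(nth_deriv i f has_vector_derivative 0) (at x)"
      by (rule has_vector_derivative_transform_within_open[where S = "- {a..b}"])
        (use Suc in auto)
    then show ?case by (simp add: nth_deriv_Suc dv_def vector_derivative_at)
  qed (simp add: supp)
  have "\<exists>A. \<forall>x. cmod (nth_deriv i f x) \<le> A * wt p x" for i p
  proof -
    have "compact ((\<lambda>x. of_real (wt (- p) x) * nth_deriv i f x) ` {a..b})"
      by (intro compact_continuous_image continuous_intros continuous_on_of_real continuous_on_wt
          C_infinity_continuous C_infinity_nth_deriv f compact_Icc)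
    then have "bounded ((\<lambda>x. of_real (wt (- p) x) * nth_deriv i f x) ` {a..b})"
      by (rule compact_imp_bounded)
    then obtain A where A: "\<And>x. x \<in> {a..b} \<Longrightarrow> cmod (of_real (wt (- p) x) * nth_deriv i f x) \<le> A"
      unfolding bounded_iff by blast
    have "cmod (nth_deriv i f x) \<le> max A 0 * wt p x" for x
    proof (cases "x \<in> {a..b}")
      case True
      from A[OF this] have "wt (- p) x * cmod (nth_deriv i f x) \<le> max A 0"
        by (simp add: norm_mult)
      then have "wt (- p) x * cmod (nth_deriv i f x) * wt p x \<le> max A 0 * wt p x"
        by (intro mult_right_mono) auto
      moreover have "wt (- p) x * cmod (nth_deriv i f x) * wt p x = cmod (nth_deriv i f x) * wt (- p + p) x"
        unfolding wt_add by (simp only: mult_ac)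
      ultimately show ?thesis by simp
    qed (simp add: z)
    then show ?thesis by blast
  qed
  then show ?thesis using f dbound_collect by (simp add: schwartz_iff)
qed

lemma bump_exists:
  assumes "a < b"
  obtains f where "f \<in> schwartz" "\<And>x. f x \<noteq> 0 \<longleftrightarrow> a < x \<and> x < b"
proof
  \<comment> \<open>One factor cuts off to the left of a, the other to the right of b; the arguments
    are written in the shape of \<open>nth_deriv_affine\<close>.\<close>
  let ?f = "\<lambda>x. flat 0 (- a + 1 * x) * flat 0 (b + (-1) * x)"
  show nz: "?f x \<noteq> 0 \<longleftrightarrow> a < x \<and> x < b" for x
    by (auto simp: flat_def)
  show "?f \<in> schwartz"
  proof (rule compact_support_schwartz)
    show "?f \<in> C_infinity" by (intro C_infinity_mult nth_deriv_affine flat_smooth)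
    show "?f x = 0" if "x \<notin> {a..b}" for x using nz[of x] that by force
  qed
qed

text \<open>Two functions with the same image have transforms that differ only where
  \<open>ft T\<close> equals l, and they differ on a non-empty open set. Conversely, a bump that
  vanishes off the level set is the transform of a non-zero function annihilated by the shifted
  operator.\<close>

lemma point_spectrum_schwartz:
  assumes T: "OC_functional T"
  shows "point_spectrum schwartz_space (convolution T) = {l. interior {\<xi>. ft T \<xi> = l} \<noteq> {}}"
proof -
  note g = ft_OM[OF T]
  have top: "topspace schwartz_space = schwartz" by (simp add: schwartz_space_def)
  have lg: "(\<lambda>\<xi>. l - ft T \<xi>) \<in> OM" for l by (intro OM_diff OM_const g)
  have zero: "(\<lambda>x. 0) \<in> schwartz" using function_subspace_schwartz by (simp add: function_subspace_def)
  have fz: "fourier (\<lambda>x. 0) = (\<lambda>\<xi>. 0)" by (simp add: fourier_ce fun_eq_iff)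
  have m0: "fmult h (\<lambda>x. 0) = (\<lambda>x. 0)" for h by (simp add: fmult_def fz fun_eq_iff)
  have "interior {\<xi>. ft T \<xi> = l} \<noteq> {}" if not_inj: "\<not> inj_on (spectral_shift l (convolution T)) schwartz" for l
  proof -
    obtain f f' where f: "f \<in> schwartz" "f' \<in> schwartz" "f \<noteq> f'"
      and "spectral_shift l (convolution T) f = spectral_shift l (convolution T) f'"
      using not_inj unfolding inj_on_def by blast
    then have m: "fmult (\<lambda>\<xi>. l - ft T \<xi>) f = fmult (\<lambda>\<xi>. l - ft T \<xi>) f'"
      by (simp only: spectral_shift_schwartz[OF T])
    have eq: "(l - ft T \<xi>) * fourier f \<xi> = (l - ft T \<xi>) * fourier f' \<xi>" for \<xi>
      using arg_cong[OF m, of "\<lambda>f. fourier f \<xi>"] by (simp only: fourier_fmult[OF lg] f(1,2))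
    obtain \<xi> where \<xi>: "fourier f \<xi> \<noteq> fourier f' \<xi>"
      using fourier_inj[OF f(1,2)] f(3) by blast
    have "open {\<xi>. fourier f \<xi> \<noteq> fourier f' \<xi>}"
      using f by (intro open_Collect_neq C_infinity_continuous schwartz_smooth fourier_schwartz)
    moreover have "ft T \<xi> = l \<or> fourier f \<xi> = fourier f' \<xi>" for \<xi>
      using eq[of \<xi>] by auto
    then have "{\<xi>. fourier f \<xi> \<noteq> fourier f' \<xi>} \<subseteq> {\<xi>. ft T \<xi> = l}" by blast
    ultimately have "\<xi> \<in> interior {\<xi>. ft T \<xi> = l}"
      using \<xi> by (intro interiorI[of "{\<xi>. fourier f \<xi> \<noteq> fourier f' \<xi>}"]) auto
    then show ?thesis by blast
  qed
  moreover have "\<not> inj_on (spectral_shift l (convolution T)) schwartz" if int: "interior {\<xi>. ft T \<xi> = l} \<noteq> {}" for l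
  proof
    assume inj: "inj_on (spectral_shift l (convolution T)) schwartz"
    obtain x where "x \<in> interior {\<xi>. ft T \<xi> = l}" using int by blast
    then obtain e where e: "0 < e" "ball x e \<subseteq> {\<xi>. ft T \<xi> = l}" by (auto simp: mem_interior)
    have "x - e < x + e" using e by simp
    then obtain b where b: "b \<in> schwartz" "\<And>y. b y \<noteq> 0 \<longleftrightarrow> x - e < y \<and> y < x + e"
      using bump_exists by blast
    obtain f where f: "f \<in> schwartz" "fourier f = b" using fourier_surj[OF b(1)] .
    have "(l - ft T \<xi>) * b \<xi> = 0" for \<xi>
    proof (cases "b \<xi> = 0")
      case False
      then have "\<xi> \<in> ball x e" unfolding b(2) by (auto simp: dist_real_def)
      then show ?thesis using e by auto
    qed simp
    then have "fmult (\<lambda>\<xi>. l - ft T \<xi>) f = (\<lambda>x. 0)"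
      by (intro fmult_eqI lg f zero) (simp add: fz f(2))
    then have "spectral_shift l (convolution T) f = spectral_shift l (convolution T) (\<lambda>x. 0)"
      by (simp add: spectral_shift_schwartz[OF T] f zero m0)
    then have "f = (\<lambda>x. 0)" by (rule inj_onD[OF inj _ f(1) zero])
    then have "b x = 0" using f(2) fz by metis
    then show False using b(2)[of x] e by simp
  qed
  ultimately show ?thesis unfolding point_spectrum_def top by blast
qed

theorem theorem3p7:
  fixes T :: "(real \<Rightarrow> complex) \<Rightarrow> complex"
  assumes "T \<in> continuous_dual OC_space"
  shows
    "(\<forall>E \<in> {schwartz_space, OC_space}.
        - closure (range (fourier_function T)) \<subseteq> resolvent_set E (convolution T) \<and>
        resolvent_set E (convolution T) \<subseteq> - range (fourier_function T) \<and>
        star_resolvent_set E (convolution T) = - closure (range (fourier_function T)) \<and>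
        range (fourier_function T) \<subseteq> spectrum E (convolution T) \<and>
        spectrum E (convolution T) \<subseteq> closure (range (fourier_function T)) \<and>
        star_spectrum E (convolution T) = closure (range (fourier_function T))) \<and>
     point_spectrum schwartz_space (convolution T) =
       {l. interior {\<xi>. fourier_function T \<xi> = l} \<noteq> {}} \<and>
     {l. interior {\<xi>. fourier_function T \<xi> = l} \<noteq> {}} \<subseteq> range (fourier_function T)"
proof -
  have T: "OC_functional T" by (rule OC_functional_dual[OF assms])
  have "{l. interior {\<xi>. ft T \<xi> = l} \<noteq> {}} \<subseteq> range (ft T)"
    using interior_subset by fastforce
  then show ?thesis
    unfolding fourier_function_eq[OF T]
    using spectra_schwartz[OF T] spectra_OC[OF T] point_spectrum_schwartz[OF T] by simp
qed

end
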